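(* Let $m>0$ and let $A_m$ be the imaginary Airy-Dirac operator in $L^2(\mathbb{R},\mathbb{C}^2)$ $$A_m=-i\partial_x\sigma_1+m\sigma_3+ixI_2,\qquad \mathrm{Dom}(A_m)=H^1(\mathbb{R},\mathbb{C}^2)\cap\mathrm{Dom}(xI_2).$$ Then the following claims hold. (i) For all $u\in\mathrm{Dom}(A_m)=\mathrm{Dom}(A_m^* )$ $$\|A_mu\|^2+\|u\|^2\ge\|u'\|^2+\|xI_2u\|^2+m^2\|u\|^2,\qquad \|A_m^*u\|^2+\|u\|^2\ge\|u'\|^2+\|xI_2u\|^2+m^2\|u\|^2.$$ (ii) The resolvent of $A_m$ is compact, $\sigma(A_m)=\emptyset$ and $$\|(A_m-\lambda)^{-1}\|=\|(A_m-\operatorname{Re}\lambda)^{-1}\|,\qquad\lambda\in\mathbb{C}.$$ (iii) The singular values of $A_m^{-1}$ read $$s_{2k}=\frac1{\sqrt{m^2+2k}},\qquad s_{2k+1}=\frac1{\sqrt{m^2+2k+2}},\qquad k\in\mathbb{N}_0,$$ thus in particular $\|A_m^{-1}\|=\frac1m$. (iv) There exists $c>0$ such that $$\log\|(A_m-\lambda)^{-1}\|\le c\,(\operatorname{Re}\lambda)^2,\qquad\lambda\in\mathbb{C}.$$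
   Context: $\sigma_1=\begin{pmatrix}0&1\\1&0\end{pmatrix}$, $\sigma_3=\begin{pmatrix}1&0\\0&-1\end{pmatrix}$, $I_2$ is the $2\times2$ identity matrix, so $A_mu=\big((m+ix)u_1-iu_2',\,-iu_1'+(-m+ix)u_2\big)^t$ for $u=(u_1,u_2)^t$. $\mathrm{Dom}(xI_2)=\{u\in L^2(\mathbb{R},\mathbb{C}^2):xu\in L^2(\mathbb{R},\mathbb{C}^2)\}$. $\|\cdot\|$ is the norm of $L^2(\mathbb{R},\mathbb{C}^2)$ or the corresponding operator norm; $A_m^*$ is the adjoint of $A_m$ and $\sigma(\cdot)$ is the spectrum. $\mathbb{N}_0=\{0,1,2,\dots\}$. Singular values are listed in non-increasing order and repeated according to their multiplicities.
   Formalization: In (iv) the bound proved is c (Re λ)^2 + max(0, log(1/m)): for 0<m<1 the printed bound fails at λ=0, where log‖A_m^{-1}‖ = log(1/m) > 0; for m≥1 the added term is zero and the claim is as printed. *)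

theory Defs
  imports "HOL-Analysis.Analysis"
begin

section \<open>Complex inner product spaces and unbounded operators\<close>

text \<open>The complex inner product is linear in its first argument.  The norm, the topology and the
  operator norm are those of the underlying \<^class>\<open>real_inner\<close> structure, whose
  inner product is the real part of the complex one.\<close>

class complex_inner_space = real_inner +
  fixes scaleC :: "complex \<Rightarrow> 'a \<Rightarrow> 'a" (infixr "*\<^sub>C" 75)
    and cinner :: "'a \<Rightarrow> 'a \<Rightarrow> complex"
  assumes scaleC_add_right: "a *\<^sub>C (x + y) = a *\<^sub>C x + a *\<^sub>C y"
    and scaleC_add_left: "(a + b) *\<^sub>C x = a *\<^sub>C x + b *\<^sub>C x"
    and scaleC_scaleC: "a *\<^sub>C b *\<^sub>C x = (a * b) *\<^sub>C x"
    and scaleR_scaleC: "scaleR r x = complex_of_real r *\<^sub>C x"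
    and cinner_commute: "cinner x y = cnj (cinner y x)"
    and cinner_add_left: "cinner (x + y) z = cinner x z + cinner y z"
    and cinner_scaleC_left: "cinner (a *\<^sub>C x) y = a * cinner x y"
    and inner_Re_cinner: "inner x y = Re (cinner x y)"

text \<open>An operator \<open>T\<close> with domain \<open>D\<close> is given by a set \<open>D\<close> and a function \<open>T\<close>, of which only the
  values on \<open>D\<close> matter.\<close>

definition bounded_clinear :: "('a::complex_inner_space \<Rightarrow> 'a) \<Rightarrow> bool" where
  "bounded_clinear T \<longleftrightarrow> bounded_linear T \<and> (\<forall>c x. T (c *\<^sub>C x) = c *\<^sub>C T x)"

definition adjoint_domain :: "'a::complex_inner_space set \<Rightarrow> ('a \<Rightarrow> 'a) \<Rightarrow> 'a set" where
  "adjoint_domain D T = {v. \<exists>w. \<forall>u\<in>D. cinner (T u) v = cinner u w}"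

text \<open>The adjoint is well defined on its domain as soon as \<open>D\<close> is dense.\<close>

definition adjoint_op :: "'a::complex_inner_space set \<Rightarrow> ('a \<Rightarrow> 'a) \<Rightarrow> 'a \<Rightarrow> 'a" where
  "adjoint_op D T v = (THE w. \<forall>u\<in>D. cinner (T u) v = cinner u w)"

definition resolvent :: "'a::complex_inner_space set \<Rightarrow> ('a \<Rightarrow> 'a) \<Rightarrow> complex \<Rightarrow> 'a \<Rightarrow> 'a" where
  "resolvent D T z = inv_into D (\<lambda>u. T u - z *\<^sub>C u)"

definition resolvent_set :: "'a::complex_inner_space set \<Rightarrow> ('a \<Rightarrow> 'a) \<Rightarrow> complex set" where
  "resolvent_set D T =
    {z. bij_betw (\<lambda>u. T u - z *\<^sub>C u) D UNIV \<and> bounded_clinear (resolvent D T z)}"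

definition spectrum :: "'a::complex_inner_space set \<Rightarrow> ('a \<Rightarrow> 'a) \<Rightarrow> complex set" where
  "spectrum D T = - resolvent_set D T"

definition compact_op :: "('a::complex_inner_space \<Rightarrow> 'a) \<Rightarrow> bool" where
  "compact_op T \<longleftrightarrow> bounded_clinear T \<and> compact (closure (T ` cball 0 1))"

text \<open>The singular values of a compact operator \<open>T\<close> are the square roots of the eigenvalues of
  \<open>T\<^sup>* T\<close>, in non-increasing order and repeated according to the complex dimension of the
  eigenspaces.  Only positive values are constrained by the multiplicities, so that the sequence
  of an operator of finite rank is padded with zeros.\<close>

definition singular_values :: "('a::complex_inner_space \<Rightarrow> 'a) \<Rightarrow> (nat \<Rightarrow> real) \<Rightarrow> bool" where
  "singular_values T s \<longleftrightarrow> compact_op T \<and> decseq s \<and> (\<forall>j. 0 \<le> s j) \<and>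
    (\<forall>\<mu>>0. finite {j. s j = \<mu>} \<and>
       card {j. s j = \<mu>} =
         vector_space.dim (*\<^sub>C) {v. adjoint_op UNIV T (T v) = complex_of_real (\<mu>\<^sup>2) *\<^sub>C v})"


section \<open>The space of square-integrable functions from the reals to pairs of complex numbers\<close>

definition sq_integrable :: "(real \<Rightarrow> complex^2) \<Rightarrow> bool" where
  "sq_integrable f \<longleftrightarrow> f \<in> borel_measurable lborel \<and> integrable lborel (\<lambda>x. (norm (f x))\<^sup>2)"

definition L2_eq :: "(real \<Rightarrow> complex^2) \<Rightarrow> (real \<Rightarrow> complex^2) \<Rightarrow> bool" where
  "L2_eq f g \<longleftrightarrow> sq_integrable f \<and> sq_integrable g \<and> (AE x in lborel. f x = g x)"

lemma sq_integrable_zero: "sq_integrable (\<lambda>_. 0)"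
  by (simp add: sq_integrable_def)

lemma sq_integrable_bound:
  assumes "sq_integrable f" "sq_integrable g" "h \<in> borel_measurable lborel"
    and "\<And>x. norm (h x) \<le> C * (norm (f x) + norm (g x))"
  shows "sq_integrable h"
proof -
  have "(norm (h x))\<^sup>2 \<le> 2 * C\<^sup>2 * ((norm (f x))\<^sup>2 + (norm (g x))\<^sup>2)" for x
  proof -
    have "(norm (h x))\<^sup>2 \<le> (C * (norm (f x) + norm (g x)))\<^sup>2"
      using assms(4) by (intro power_mono) auto
    also have "\<dots> = C\<^sup>2 * (norm (f x) + norm (g x))\<^sup>2" by (simp add: power_mult_distrib)
    also have "\<dots> \<le> C\<^sup>2 * (2 * ((norm (f x))\<^sup>2 + (norm (g x))\<^sup>2))"
      using sum_squares_bound[of "norm (f x)" "norm (g x)"]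
      by (intro mult_left_mono) (auto simp: power2_sum)
    finally show ?thesis by (simp add: algebra_simps)
  qed
  then have "integrable lborel (\<lambda>x. (norm (h x))\<^sup>2)"
    using assms(1-3) unfolding sq_integrable_def
    by - (rule Bochner_Integration.integrable_bound
        [where f = "\<lambda>x. 2 * C\<^sup>2 * ((norm (f x))\<^sup>2 + (norm (g x))\<^sup>2)"], auto)
  with assms(3) show ?thesis by (simp add: sq_integrable_def)
qed

lemma integrable_bound_sq:
  fixes h :: "real \<Rightarrow> 'b::{banach, second_countable_topology}"
  assumes "sq_integrable f" "sq_integrable g" "h \<in> borel_measurable lborel"
    and "\<And>x. norm (h x) \<le> norm (f x) * norm (g x)"
  shows "integrable lborel h"
proof -
  have "norm (h x) \<le> (norm (f x))\<^sup>2 + (norm (g x))\<^sup>2" for x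
    using assms(4)[of x] sum_squares_bound[of "norm (f x)" "norm (g x)"]
      mult_nonneg_nonneg[OF norm_ge_zero[of "f x"] norm_ge_zero[of "g x"]]
    by linarith
  then show ?thesis
    using assms(1-3) unfolding sq_integrable_def
    by - (rule Bochner_Integration.integrable_bound
        [where f = "\<lambda>x. (norm (f x))\<^sup>2 + (norm (g x))\<^sup>2"], auto)
qed

quotient_type L2 = "real \<Rightarrow> complex^2" / partial: L2_eq
  by (rule part_equivpI)
    (use sq_integrable_zero in \<open>auto simp: L2_eq_def symp_def transp_def elim: AE_mp\<close>)

definition cdot :: "complex^2 \<Rightarrow> complex^2 \<Rightarrow> complex" where
  "cdot a b = (\<Sum>i\<in>UNIV. a $ i * cnj (b $ i))"

lemma norm_cdot_le: "norm (cdot a b) \<le> norm a * norm b"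
proof -
  have "norm (cdot a b) \<le> (\<Sum>i\<in>UNIV. \<bar>norm (a $ i)\<bar> * \<bar>norm (b $ i)\<bar>)"
    unfolding cdot_def by (rule order_trans[OF norm_sum]) (simp add: norm_mult)
  also have "\<dots> \<le> norm a * norm b"
    unfolding norm_vec_def by (rule L2_set_mult_ineq)
  finally show ?thesis .
qed

lemma Re_cdot: "Re (cdot a b) = a \<bullet> b"
  by (simp add: cdot_def inner_vec_def inner_complex_def)

lemma measurable_cdot:
  assumes "f \<in> borel_measurable M" "g \<in> borel_measurable M"
  shows "(\<lambda>x. cdot (f x) (g x)) \<in> borel_measurable M"
  using assms by (rule borel_measurable_continuous_Pair)
    (auto simp: cdot_def intro!: continuous_intros)

lemma integrable_cdot:
  "sq_integrable f \<Longrightarrow> sq_integrable g \<Longrightarrow> integrable lborel (\<lambda>x. cdot (f x) (g x))"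
  by (rule integrable_bound_sq[of f g])
    (auto simp: sq_integrable_def intro: measurable_cdot norm_cdot_le)

lemma integrable_inner:
  "sq_integrable f \<Longrightarrow> sq_integrable g \<Longrightarrow> integrable lborel (\<lambda>x. f x \<bullet> g x)"
  by (rule integrable_bound_sq[of f g])
    (auto simp: sq_integrable_def intro: Cauchy_Schwarz_ineq2)

lemma norm_vector_scalar_mult: "norm (c *s (a::complex^2)) = norm c * norm a"
  by (simp add: norm_vec_def norm_mult L2_set_right_distrib)

lemma bounded_linear_matrix_vector_mult:
  "bounded_linear (\<lambda>a::complex^2. (M::complex^2^2) *v a)"
  unfolding linear_conv_bounded_linear[symmetric]
  by (rule linearI) (simp_all add: vec_eq_iff matrix_vector_mult_def distrib_left sum.distrib
    scaleR_sum_right)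

lemma bounded_linear_vector_scalar_mult: "bounded_linear (\<lambda>a::complex^2. c *s a)"
  unfolding linear_conv_bounded_linear[symmetric]
  by (rule linearI) (simp_all add: vec_eq_iff algebra_simps)

lemma sq_integrable_bounded_linear:
  assumes "bounded_linear h" "sq_integrable f"
  shows "sq_integrable (\<lambda>x. h (f x))"
proof -
  obtain K where K: "\<And>x. norm (h x) \<le> norm x * K"
    using bounded_linear.bounded[OF assms(1)] by blast
  have "h \<in> borel_measurable borel"
    using assms(1) by (intro borel_measurable_continuous_onI linear_continuous_on)
  then have "(\<lambda>x. h (f x)) \<in> borel_measurable lborel"
    using assms(2) by (auto simp: sq_integrable_def)
  then show ?thesis
    using K by (intro sq_integrable_bound[OF assms(2) sq_integrable_zero, where C = K])
      (auto simp: mult.commute)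
qed

lemma sq_integrable_add:
  "sq_integrable f \<Longrightarrow> sq_integrable g \<Longrightarrow> sq_integrable (\<lambda>x. f x + g x)"
  by (rule sq_integrable_bound[of f g _ 1])
    (auto simp: sq_integrable_def intro: norm_triangle_ineq)

lemma sq_integrable_diff:
  "sq_integrable f \<Longrightarrow> sq_integrable g \<Longrightarrow> sq_integrable (\<lambda>x. f x - g x)"
  by (rule sq_integrable_bound[of f g _ 1])
    (auto simp: sq_integrable_def intro: norm_triangle_ineq4)

lemma L2_eq_bounded_linear:
  "bounded_linear h \<Longrightarrow> L2_eq f g \<Longrightarrow> L2_eq (\<lambda>x. h (f x)) (\<lambda>x. h (g x))"
  by (auto simp: L2_eq_def sq_integrable_bounded_linear)

lift_definition matrix_L2 :: "complex^2^2 \<Rightarrow> L2 \<Rightarrow> L2" is "\<lambda>M f x. M *v f x"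
  by (rule L2_eq_bounded_linear[OF bounded_linear_matrix_vector_mult])

instantiation L2 :: complex_inner_space
begin

lift_definition zero_L2 :: L2 is "\<lambda>_. 0"
  by (simp add: L2_eq_def sq_integrable_zero)

lift_definition plus_L2 :: "L2 \<Rightarrow> L2 \<Rightarrow> L2" is "\<lambda>f g x. f x + g x"
  by (auto simp: L2_eq_def sq_integrable_add)

lift_definition minus_L2 :: "L2 \<Rightarrow> L2 \<Rightarrow> L2" is "\<lambda>f g x. f x - g x"
  by (auto simp: L2_eq_def sq_integrable_diff)

lift_definition uminus_L2 :: "L2 \<Rightarrow> L2" is "\<lambda>f x. - f x"
  by (rule L2_eq_bounded_linear[OF bounded_linear_minus[OF bounded_linear_ident]])

lift_definition scaleR_L2 :: "real \<Rightarrow> L2 \<Rightarrow> L2" is "\<lambda>r f x. r *\<^sub>R f x"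
  by (rule L2_eq_bounded_linear[OF bounded_linear_scaleR_right])

lift_definition scaleC_L2 :: "complex \<Rightarrow> L2 \<Rightarrow> L2" is "\<lambda>c f x. c *s f x"
  by (rule L2_eq_bounded_linear[OF bounded_linear_vector_scalar_mult])

lift_definition inner_L2 :: "L2 \<Rightarrow> L2 \<Rightarrow> real" is "\<lambda>f g. LINT x|lborel. f x \<bullet> g x"
  by (rule integral_cong_AE) (auto simp: L2_eq_def sq_integrable_def)

lift_definition cinner_L2 :: "L2 \<Rightarrow> L2 \<Rightarrow> complex" is "\<lambda>f g. LINT x|lborel. cdot (f x) (g x)"
  by (rule integral_cong_AE) (auto simp: L2_eq_def sq_integrable_def intro!: measurable_cdot)

definition norm_L2 :: "L2 \<Rightarrow> real" where "norm_L2 u = sqrt (inner u u)"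
definition sgn_L2 :: "L2 \<Rightarrow> L2" where "sgn_L2 u = inverse (norm u) *\<^sub>R u"
definition dist_L2 :: "L2 \<Rightarrow> L2 \<Rightarrow> real" where "dist_L2 u v = norm (u - v)"
definition uniformity_L2 :: "(L2 \<times> L2) filter" where
  "uniformity_L2 = (INF e\<in>{0<..}. principal {(u, v). dist u v < e})"
definition open_L2 :: "L2 set \<Rightarrow> bool" where
  "open_L2 U \<longleftrightarrow> (\<forall>u\<in>U. \<forall>\<^sub>F (u', v) in uniformity. u' = u \<longrightarrow> v \<in> U)"

instance
proof
  fix a b c :: L2 and r s :: real and w z :: complex
  show "a + b + c = a + (b + c)"
    by transfer (auto simp: L2_eq_def sq_integrable_add add.assoc)
  show "a + b = b + a"
    by transfer (auto simp: L2_eq_def sq_integrable_add add.commute)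
  show "0 + a = a"
    by transfer (auto simp: L2_eq_def)
  show "- a + a = 0"
    by transfer (auto simp: L2_eq_def sq_integrable_zero)
  show "a - b = a + - b"
    by transfer (auto simp: L2_eq_def sq_integrable_diff)
  show "r *\<^sub>R (a + b) = r *\<^sub>R a + r *\<^sub>R b"
    by transfer (auto simp: L2_eq_def scaleR_add_right intro!: sq_integrable_add
      sq_integrable_bounded_linear[OF bounded_linear_scaleR_right])
  show "(r + s) *\<^sub>R a = r *\<^sub>R a + s *\<^sub>R a"
    by transfer (auto simp: L2_eq_def scaleR_add_left intro!: sq_integrable_add
      sq_integrable_bounded_linear[OF bounded_linear_scaleR_right])
  show "r *\<^sub>R s *\<^sub>R a = (r * s) *\<^sub>R a"
    by transfer (auto simp: L2_eq_def intro!: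
      sq_integrable_bounded_linear[OF bounded_linear_scaleR_right])
  show "1 *\<^sub>R a = a"
    by transfer (auto simp: L2_eq_def)
  show "dist a b = norm (a - b)" by (rule dist_L2_def)
  show "sgn a = inverse (norm a) *\<^sub>R a" by (rule sgn_L2_def)
  show "(uniformity :: (L2 \<times> L2) filter) = (INF e\<in>{0<..}. principal {(u, v). dist u v < e})"
    by (rule uniformity_L2_def)
  show "open U \<longleftrightarrow> (\<forall>u\<in>U. \<forall>\<^sub>F (u', v) in uniformity. u' = u \<longrightarrow> v \<in> U)" for U :: "L2 set"
    by (rule open_L2_def)
  show "a \<bullet> b = b \<bullet> a"
    by transfer (simp add: inner_commute)
  show "(a + b) \<bullet> c = a \<bullet> c + b \<bullet> c"
    by transfer (simp add: L2_eq_def inner_add_left integrable_inner)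
  show "r *\<^sub>R a \<bullet> b = r * (a \<bullet> b)"
    by transfer simp
  show "0 \<le> a \<bullet> a"
    by transfer simp
  show "a \<bullet> a = 0 \<longleftrightarrow> a = 0"
    by transfer (auto simp: L2_eq_def sq_integrable_zero integrable_inner
      integral_nonneg_eq_0_iff_AE)
  show "norm a = sqrt (a \<bullet> a)" by (rule norm_L2_def)
  show "w *\<^sub>C (a + b) = w *\<^sub>C a + w *\<^sub>C b"
    by transfer (auto simp: L2_eq_def vector_add_ldistrib intro!: sq_integrable_add
      sq_integrable_bounded_linear[OF bounded_linear_vector_scalar_mult])
  show "(w + z) *\<^sub>C a = w *\<^sub>C a + z *\<^sub>C a"
    by transfer (auto simp: L2_eq_def vector_sadd_rdistrib intro!: sq_integrable_add
      sq_integrable_bounded_linear[OF bounded_linear_vector_scalar_mult])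
  show "w *\<^sub>C z *\<^sub>C a = (w * z) *\<^sub>C a"
    by transfer (auto simp: L2_eq_def vector_smult_assoc intro!:
      sq_integrable_bounded_linear[OF bounded_linear_vector_scalar_mult])
  have R: "q *\<^sub>R d = complex_of_real q *s d" for q and d :: "complex^2"
    by (simp add: vec_eq_iff scaleR_conv_of_real[where 'a = complex])
  show "r *\<^sub>R a = complex_of_real r *\<^sub>C a"
    by transfer (auto simp: L2_eq_def R intro!:
      sq_integrable_bounded_linear[OF bounded_linear_vector_scalar_mult])
  have C: "cdot d e = cnj (cdot e d)" for d e
    by (simp add: cdot_def mult.commute)
  show "cinner a b = cnj (cinner b a)"
    by transfer (subst C, simp)
  have A: "cdot (d + d') e = cdot d e + cdot d' e" for d d' e
    by (simp add: cdot_def distrib_right sum.distrib)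
  show "cinner (a + b) c = cinner a c + cinner b c"
    by transfer (simp add: L2_eq_def A integrable_cdot)
  have S: "cdot (q *s d) e = q * cdot d e" for q d e
    by (simp add: cdot_def sum_distrib_left mult.assoc)
  show "cinner (w *\<^sub>C a) b = w * cinner a b"
    by transfer (simp add: S)
  show "a \<bullet> b = Re (cinner a b)"
    by transfer (simp add: L2_eq_def Re_cdot[symmetric] integrable_cdot)
qed

end


section \<open>The imaginary Airy-Dirac operator\<close>

text \<open>Real-valued test functions suffice to define the weak derivative of a complex-valued function,
  since the defining identity is linear in the test function.\<close>

definition test_function :: "(real \<Rightarrow> real) \<Rightarrow> bool" where
  "test_function \<phi> \<longleftrightarrow>
    (\<forall>n x. (deriv ^^ n) \<phi> differentiable (at x)) \<and> compact (closure {x. \<phi> x \<noteq> 0})"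

lemma test_function_measurable:
  assumes "test_function \<phi>"
  shows "\<phi> \<in> borel_measurable borel" "deriv \<phi> \<in> borel_measurable borel"
proof -
  have d: "(deriv ^^ n) \<phi> \<in> borel_measurable borel" for n
    using assms unfolding test_function_def
    by (intro borel_measurable_continuous_onI continuous_at_imp_continuous_on)
      (auto intro: differentiable_imp_continuous_within)
  show "\<phi> \<in> borel_measurable borel" "deriv \<phi> \<in> borel_measurable borel"
    using d[of 0] d[of 1] by simp_all
qed

lift_definition weak_derivative :: "L2 \<Rightarrow> L2 \<Rightarrow> bool" is
  "\<lambda>f g. \<forall>\<phi>. test_function \<phi> \<longrightarrow>
     (LINT x|lborel. deriv \<phi> x *\<^sub>R f x) = - (LINT x|lborel. \<phi> x *\<^sub>R g x)"
proof -
  fix f f' g g' assume eq: "L2_eq f f'" "L2_eq g g'"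
  have "(LINT x|lborel. deriv \<phi> x *\<^sub>R f x) = (LINT x|lborel. deriv \<phi> x *\<^sub>R f' x) \<and>
      (LINT x|lborel. \<phi> x *\<^sub>R g x) = (LINT x|lborel. \<phi> x *\<^sub>R g' x)" if "test_function \<phi>" for \<phi>
    using test_function_measurable[OF that] eq
    by (auto simp: L2_eq_def sq_integrable_def intro!: integral_cong_AE)
  then show "(\<forall>\<phi>. test_function \<phi> \<longrightarrow>
        (LINT x|lborel. deriv \<phi> x *\<^sub>R f x) = - (LINT x|lborel. \<phi> x *\<^sub>R g x)) \<longleftrightarrow>
      (\<forall>\<phi>. test_function \<phi> \<longrightarrow>
        (LINT x|lborel. deriv \<phi> x *\<^sub>R f' x) = - (LINT x|lborel. \<phi> x *\<^sub>R g' x))"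
    by auto
qed

definition H1 :: "L2 set" where
  "H1 = {u. \<exists>v. weak_derivative u v}"

definition deriv_L2 :: "L2 \<Rightarrow> L2" where
  "deriv_L2 u = (THE v. weak_derivative u v)"

lemma L2_eq_mult_x:
  assumes "L2_eq f g"
  shows "sq_integrable (\<lambda>x. x *\<^sub>R f x) \<longleftrightarrow> sq_integrable (\<lambda>x. x *\<^sub>R g x)"
proof -
  have "integrable lborel (\<lambda>x. (norm (x *\<^sub>R f x))\<^sup>2) \<longleftrightarrow>
      integrable lborel (\<lambda>x. (norm (x *\<^sub>R g x))\<^sup>2)"
    using assms by (intro integrable_cong_AE) (auto simp: L2_eq_def sq_integrable_def)
  then show ?thesis using assms by (auto simp: L2_eq_def sq_integrable_def)
qed

lift_definition in_Dom_x :: "L2 \<Rightarrow> bool" is "\<lambda>f. sq_integrable (\<lambda>x. x *\<^sub>R f x)"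
  by (rule L2_eq_mult_x)

lift_definition mult_x :: "L2 \<Rightarrow> L2" is
  "\<lambda>f. if sq_integrable (\<lambda>x. x *\<^sub>R f x) then (\<lambda>x. x *\<^sub>R f x) else (\<lambda>_. 0)"
proof -
  fix f g assume eq: "L2_eq f g"
  show "L2_eq (if sq_integrable (\<lambda>x. x *\<^sub>R f x) then (\<lambda>x. x *\<^sub>R f x) else (\<lambda>_. 0))
              (if sq_integrable (\<lambda>x. x *\<^sub>R g x) then (\<lambda>x. x *\<^sub>R g x) else (\<lambda>_. 0))"
    using L2_eq_mult_x[OF eq] eq by (auto simp: L2_eq_def sq_integrable_zero)
qed

definition sigma1 :: "complex^2^2" where
  "sigma1 = vector [vector [0, 1], vector [1, 0]]"

definition sigma3 :: "complex^2^2" where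
  "sigma3 = vector [vector [1, 0], vector [0, -1]]"

definition airy_dirac_dom :: "L2 set" where
  "airy_dirac_dom = H1 \<inter> {u. in_Dom_x u}"

definition airy_dirac :: "real \<Rightarrow> L2 \<Rightarrow> L2" where
  "airy_dirac m u =
    - (\<i> *\<^sub>C matrix_L2 sigma1 (deriv_L2 u)) + complex_of_real m *\<^sub>C matrix_L2 sigma3 u
    + \<i> *\<^sub>C mult_x u"

end

theory Submission
  imports Defs "HOL-Probability.Probability"
begin

text \<open>In the eigenbasis of \<open>\<sigma>\<^sub>1\<close> the operator is \<open>A = ((\<i>\<surd>2 a\<^sup>*, m), (m, \<i>\<surd>2 a))\<close> with the creation and
  annihilation operators \<open>a\<^sup>*\<close>, \<open>a\<close> of the harmonic oscillator.  In the Hermite basis it is therefore a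
  direct sum of two-dimensional blocks, each a multiple of a unitary matrix, so that it maps an
  orthonormal basis to multiples \<open>\<mu>\<^sub>j\<close> of another one; this is its singular value decomposition and
  gives the compact inverse.  The identity
  \<open>\<parallel>A u\<parallel>\<^sup>2 = \<parallel>u'\<parallel>\<^sup>2 + \<parallel>x u\<parallel>\<^sup>2 + m\<^sup>2 \<parallel>u\<parallel>\<^sup>2 + \<langle>\<sigma>\<^sub>1 u, u\<rangle>\<close> on Hermite functions makes \<open>A\<close> closed on its
  domain.

  Since translations remove the imaginary part of the spectral parameter, the resolvent estimate
  only concerns real \<open>\<lambda>\<close>.  The Fourier transform, a diagonal unitary in the Hermite basis, turns
  \<open>A - \<lambda>\<close> into \<open>- d/dx + x \<sigma>\<^sub>1 + m \<sigma>\<^sub>3 - \<lambda>\<close>, for which the multiplier \<open>exp \<theta> (m x \<sigma>\<^sub>1 + \<sigma>\<^sub>3)\<close>, with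
  \<open>\<theta>\<close> close to \<open>2 \<lambda> x\<close> for \<open>\<bar>x\<bar>\<close> up to a multiple of \<open>\<bar>\<lambda>\<bar>\<close> and bounded by a multiple of \<open>\<lambda>\<^sup>2\<close>,
  yields \<open>\<parallel>(A - \<lambda>) u\<parallel> \<ge> \<beta> exp (- \<kappa> \<lambda>\<^sup>2) \<parallel>u\<parallel>\<close>.  Near \<open>\<lambda> = 0\<close> a second order perturbation
  argument provides the constant \<open>m\<close> instead of \<open>\<beta>\<close>.\<close>


section \<open>Complex inner product spaces\<close>

text \<open>Identities between \<open>mult_x\<close>, \<open>deriv_L2\<close> and the Pauli matrices
  are checked on the span of the Hermite spinors, which all of them leave invariant, so that
  compositions raise no domain questions. The full domain is reached through the inverse: the series
  \<open>K\<close> satisfies \<open>K (airy s m u) = u\<close> for every \<open>u\<close> of the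
  maximal domain, hence \<open>u\<close> is a limit of core elements in the graph norm. The
  logarithmic bound dictates the constants. The inverse has norm 1/m, so a bound by c (Re
  \<lambda>)^2 alone fails at \<lambda> = 0 when m < 1; this explains
  \<open>max 0 (ln (1 / m))\<close>. For m <= 1 nothing beyond ln (1/m) may be lost at 0, so there
  the lower bound m may degrade only to second order in \<lambda>. The energy estimate, whose
  constant \<beta> comes from crude inequalities, is reserved for \<lambda> away from 0. The
  multiplier turns v' = (x \<sigma>1 + m \<sigma>3 - \<lambda>) v - g into a gain of order m (1 +
  x^2). This gain does not dominate the spectral term while |x| is below a multiple of |\<lambda>|;
  the weight exp \<theta> cancels that term there and causes the loss exp (- \<kappa>
  \<lambda>^2).\<close>

lemma vector_space_scaleC: "vector_space ((*\<^sub>C) :: complex \<Rightarrow> 'a::complex_inner_space \<Rightarrow> 'a)"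
  by unfold_locales
    (auto simp: scaleC_add_right scaleC_add_left scaleC_scaleC scaleR_scaleC[of 1, simplified, symmetric])

context
begin

interpretation cvs: vector_space "(*\<^sub>C) :: complex \<Rightarrow> 'a::complex_inner_space \<Rightarrow> 'a"
  by (rule vector_space_scaleC)

lemma scaleC_zero_right [simp]: "a *\<^sub>C (0::'a::complex_inner_space) = 0"
  and scaleC_zero_left [simp]: "0 *\<^sub>C (x::'a) = 0"
  and scaleC_one [simp]: "1 *\<^sub>C (x::'a) = x"
  and scaleC_minus_left: "(- a) *\<^sub>C (x::'a) = - (a *\<^sub>C x)"
  and scaleC_minus_right: "a *\<^sub>C (- (x::'a)) = - (a *\<^sub>C x)"
  and scaleC_diff_left: "(a - b) *\<^sub>C (x::'a) = a *\<^sub>C x - b *\<^sub>C x"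
  and scaleC_diff_right: "a *\<^sub>C ((x::'a) - y) = a *\<^sub>C x - a *\<^sub>C y"
  and scaleC_eq_0_iff [simp]: "a *\<^sub>C (x::'a) = 0 \<longleftrightarrow> a = 0 \<or> x = 0"
  by (simp_all add: cvs.scale_left_diff_distrib cvs.scale_right_diff_distrib)

end

declare scaleC_scaleC [simp]

lemma cinner_add_right: "cinner (x::'a::complex_inner_space) (y + z) = cinner x y + cinner x z"
  by (metis cinner_commute cinner_add_left complex_cnj_add)

lemma cinner_scaleC_right: "cinner (x::'a::complex_inner_space) (a *\<^sub>C y) = cnj a * cinner x y"
  by (metis cinner_commute cinner_scaleC_left complex_cnj_mult)

lemma cinner_zero [simp]:
  "cinner (0::'a::complex_inner_space) x = 0" "cinner (x::'a::complex_inner_space) 0 = 0"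
  using cinner_scaleC_left[of 0 x x] cinner_scaleC_right[of x 0 x] by simp_all

lemma cinner_minus [simp]:
  "cinner (- (x::'a::complex_inner_space)) y = - cinner x y"
  "cinner (x::'a::complex_inner_space) (- y) = - cinner x y"
  using cinner_scaleC_left[of "-1" x y] cinner_scaleC_right[of x "-1" y]
  by (simp_all add: scaleC_minus_left)

lemma cinner_diff:
  "cinner ((x::'a::complex_inner_space) - y) z = cinner x z - cinner y z"
  "cinner (x::'a::complex_inner_space) (y - z) = cinner x y - cinner x z"
  using cinner_add_left[of x "-y" z] cinner_add_right[of x y "-z"] by simp_all

lemma cinner_sum_left: "cinner (\<Sum>i\<in>A. g i :: 'a::complex_inner_space) y = (\<Sum>i\<in>A. cinner (g i) y)"
  by (induction A rule: infinite_finite_induct) (auto simp: cinner_add_left)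

lemmas cinner_simps = cinner_add_left cinner_add_right cinner_scaleC_left cinner_scaleC_right
  cinner_diff

lemma cinner_self: "cinner x x = complex_of_real ((norm (x::'a::complex_inner_space))\<^sup>2)"
  using cinner_commute[of x x]
  by (auto simp: complex_eq_iff power2_norm_eq_inner inner_Re_cinner)

lemma norm_scaleC: "norm (a *\<^sub>C (x::'a::complex_inner_space)) = cmod a * norm x"
proof -
  have "complex_of_real ((norm (a *\<^sub>C x))\<^sup>2) = (a * cnj a) * cinner x x"
    unfolding cinner_self[symmetric] by (simp add: cinner_simps)
  also have "\<dots> = complex_of_real ((cmod a * norm x)\<^sup>2)"
    by (simp add: cinner_self complex_norm_square[symmetric] power_mult_distrib)
  finally have "(norm (a *\<^sub>C x))\<^sup>2 = (cmod a * norm x)\<^sup>2"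
    unfolding of_real_eq_iff .
  then show ?thesis
    by (metis mult_nonneg_nonneg norm_ge_zero power2_eq_imp_eq)
qed

text \<open>Multiplying \<open>x\<close> by the unimodular number \<open>a\<close> makes the complex
  inner product real and non-negative; the real Cauchy-Schwarz inequality then applies.\<close>

lemma norm_cinner_le: "cmod (cinner (x::'a::complex_inner_space) y) \<le> norm x * norm y"
proof (cases "cinner x y = 0")
  case False
  define c where "c = cinner x y"
  define a where "a = cnj c / cmod c"
  have "cinner (a *\<^sub>C x) y = of_real (cmod c)"
    using False by (simp add: cinner_simps a_def c_def[symmetric] complex_norm_square[symmetric]
        power2_eq_square mult.commute)
  then have "cmod c = inner (a *\<^sub>C x) y"
    by (simp add: inner_Re_cinner)
  also have "\<dots> \<le> norm (a *\<^sub>C x) * norm y"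
    by (rule norm_cauchy_schwarz)
  also have "norm (a *\<^sub>C x) = norm x"
    using False by (simp add: norm_scaleC a_def c_def norm_divide)
  finally show ?thesis by (simp add: c_def)
qed auto

lemma bounded_bilinear_cinner:
  "bounded_bilinear (cinner :: 'a::complex_inner_space \<Rightarrow> 'a \<Rightarrow> complex)"
  by (rule bounded_bilinear.intro)
    (auto simp: cinner_simps scaleR_scaleC scaleR_conv_of_real intro!: exI[of _ 1] norm_cinner_le)

lemmas tendsto_cinner = bounded_bilinear.tendsto[OF bounded_bilinear_cinner]

lemma bounded_linear_scaleC: "bounded_linear (\<lambda>x::'a::complex_inner_space. a *\<^sub>C x)"
  by (rule bounded_linear_intro[where K = "cmod a"])
    (auto simp: scaleC_add_right scaleR_scaleC norm_scaleC mult.commute)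

lemma bounded_linear_scaleC_left: "bounded_linear (\<lambda>a. a *\<^sub>C (x::'a::complex_inner_space))"
  by (rule bounded_linear_intro[where K = "norm x"])
    (auto simp: scaleC_add_left scaleR_scaleC norm_scaleC scaleR_conv_of_real)

lemma tendsto_scaleC:
  "(g \<longlongrightarrow> (l::'a::complex_inner_space)) F \<Longrightarrow> ((\<lambda>x. a *\<^sub>C g x) \<longlongrightarrow> a *\<^sub>C l) F"
  by (rule bounded_linear.tendsto[OF bounded_linear_scaleC])

lemma bounded_clinearI:
  fixes T :: "'a::complex_inner_space \<Rightarrow> 'a"
  assumes "\<And>x y. T (x + y) = T x + T y" "\<And>c x. T (c *\<^sub>C x) = c *\<^sub>C T x"
    and "\<And>x. norm (T x) \<le> K * norm x"
  shows "bounded_clinear T"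
  unfolding bounded_clinear_def
  by (intro conjI bounded_linear_intro[where K = K]) (auto simp: assms scaleR_scaleC mult.commute)

lemma norm_add_square:
  "(norm (x + y))\<^sup>2 = (norm x)\<^sup>2 + 2 * Re (cinner x y) + (norm (y::'a::complex_inner_space))\<^sup>2"
  by (simp add: power2_norm_eq_inner inner_simps inner_commute inner_Re_cinner[symmetric])

section \<open>Orthonormal bases and diagonal operators\<close>

text \<open>Completeness is encoded as a trivial orthogonal complement, the form in which it is
  obtained for the Hermite functions. It makes comparison of coefficients (\<open>onb_eqI\<close>)
  the standard way to identify two vectors.\<close>

definition onb :: "(nat \<Rightarrow> 'a::complex_inner_space) \<Rightarrow> bool" where
  "onb e \<longleftrightarrow> (\<forall>i j. cinner (e i) (e j) = (if i = j then 1 else 0)) \<and>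
     (\<forall>u. (\<forall>j. cinner u (e j) = 0) \<longrightarrow> u = 0)"

lemma onb_cinner: "onb e \<Longrightarrow> cinner (e i) (e j) = (if i = j then 1 else 0)"
  by (simp add: onb_def)

lemma onb_norm [simp]: "onb e \<Longrightarrow> norm (e i) = 1"
  using cinner_self[of "e i"] onb_cinner[of e i i]
  by (metis norm_ge_zero of_real_1 of_real_eq_iff one_power2 power2_eq_imp_eq zero_le_one)

lemma onb_eqI:
  assumes "onb e" "\<And>j. cinner u (e j) = cinner v (e j)"
  shows "u = v"
proof -
  have "cinner (u - v) (e j) = 0" for j using assms(2) by (simp add: cinner_diff)
  then have "u - v = 0" using assms(1) unfolding onb_def by blast
  then show ?thesis by simp
qed

lemma onb_cinner_sum:
  assumes "onb e" "finite A"
  shows "cinner (\<Sum>j\<in>A. c j *\<^sub>C e j) (e k) = (if k \<in> A then c k else 0)"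
proof -
  have "cinner (\<Sum>j\<in>A. c j *\<^sub>C e j) (e k) = (\<Sum>j\<in>A. if j = k then c k else 0)"
    unfolding cinner_sum_left
    by (rule sum.cong) (auto simp: cinner_simps onb_cinner[OF assms(1)])
  then show ?thesis using assms(2) by simp
qed

lemma onb_norm_sum:
  assumes "onb e" "finite A"
  shows "(norm (\<Sum>j\<in>A. c j *\<^sub>C e j))\<^sup>2 = (\<Sum>j\<in>A. (cmod (c j))\<^sup>2)"
proof -
  let ?S = "\<Sum>j\<in>A. c j *\<^sub>C e j"
  have "cinner ?S ?S = (\<Sum>j\<in>A. c j * cinner (e j) ?S)"
    by (subst cinner_sum_left) (simp add: cinner_simps)
  also have "\<dots> = (\<Sum>j\<in>A. c j * cnj (c j))"
    by (intro sum.cong refl) (subst cinner_commute, simp add: onb_cinner_sum[OF assms])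
  also have "\<dots> = complex_of_real (\<Sum>j\<in>A. (cmod (c j))\<^sup>2)"
    by (simp add: complex_norm_square[symmetric])
  finally show ?thesis
    unfolding cinner_self of_real_eq_iff .
qed

text \<open>The partial sum is orthogonal to the remainder, so Pythagoras applies.\<close>

lemma onb_bessel:
  assumes "onb e"
  shows "(\<Sum>j<n. (cmod (cinner u (e j)))\<^sup>2) \<le> (norm u)\<^sup>2"
proof -
  let ?S = "\<Sum>j<n. cinner u (e j) *\<^sub>C e j"
  have "cinner ?S (u - ?S) = (\<Sum>j<n. cinner u (e j) * cinner (e j) (u - ?S))"
    by (subst cinner_sum_left) (simp only: cinner_scaleC_left)
  also have "\<dots> = 0"
    by (intro sum.neutral ballI)
      (subst cinner_commute, simp add: cinner_diff onb_cinner_sum[OF assms])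
  finally have "(norm u)\<^sup>2 = (norm ?S)\<^sup>2 + (norm (u - ?S))\<^sup>2"
    using norm_add_square[of ?S "u - ?S"] by simp
  then show ?thesis using onb_norm_sum[OF assms, of "{..<n}"] by simp
qed

lemma onb_square_summable:
  assumes "onb e"
  shows "summable (\<lambda>j. (cmod (cinner u (e j)))\<^sup>2)"
  by (rule summableI_nonneg_bounded[OF _ onb_bessel[OF assms]]) auto

text \<open>By Pythagoras the squared norm of a block of the series is a block of the scalar series,
  so the Cauchy criterion for \<epsilon>^2 there gives the one for \<epsilon> here.\<close>

lemma onb_summable:
  fixes e :: "nat \<Rightarrow> 'a::{complex_inner_space, banach}"
  assumes "onb e" "summable (\<lambda>j. (cmod (c j))\<^sup>2)"
  shows "summable (\<lambda>j. c j *\<^sub>C e j)"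
  unfolding summable_Cauchy
proof (intro allI impI)
  fix \<epsilon> :: real assume "\<epsilon> > 0"
  then obtain N where N: "\<And>m n. m \<ge> N \<Longrightarrow> norm (\<Sum>j=m..<n. (cmod (c j))\<^sup>2) < \<epsilon>\<^sup>2"
    using assms(2) unfolding summable_Cauchy by (metis zero_less_power)
  have "norm (\<Sum>j=m..<n. c j *\<^sub>C e j) < \<epsilon>" if "m \<ge> N" for m n
  proof -
    have "(norm (\<Sum>j=m..<n. c j *\<^sub>C e j))\<^sup>2 < \<epsilon>\<^sup>2"
      using N[OF that, of n] by (simp add: onb_norm_sum[OF assms(1)])
    then show ?thesis using \<open>\<epsilon> > 0\<close> by (simp add: power2_less_imp_less)
  qed
  then show "\<exists>N. \<forall>m\<ge>N. \<forall>n. norm (\<Sum>j=m..<n. c j *\<^sub>C e j) < \<epsilon>" by blast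
qed

lemma onb_cinner_suminf:
  fixes e :: "nat \<Rightarrow> 'a::{complex_inner_space, banach}"
  assumes "onb e" "summable (\<lambda>j. (cmod (c j))\<^sup>2)"
  shows "cinner (\<Sum>j. c j *\<^sub>C e j) (e k) = c k"
proof -
  have "(\<lambda>n. cinner (\<Sum>j<n. c j *\<^sub>C e j) (e k)) \<longlonglongrightarrow> cinner (\<Sum>j. c j *\<^sub>C e j) (e k)"
    by (intro tendsto_cinner summable_LIMSEQ onb_summable assms tendsto_const)
  moreover have "(\<lambda>n. cinner (\<Sum>j<n. c j *\<^sub>C e j) (e k)) \<longlonglongrightarrow> c k"
    by (rule tendsto_eventually, rule eventually_sequentiallyI[of "Suc k"])
      (simp add: onb_cinner_sum[OF assms(1)])
  ultimately show ?thesis by (rule LIMSEQ_unique)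
qed

lemma onb_expansion:
  fixes e :: "nat \<Rightarrow> 'a::{complex_inner_space, banach}"
  assumes "onb e"
  shows "(\<lambda>j. cinner u (e j) *\<^sub>C e j) sums u"
proof -
  note s = onb_square_summable[OF assms, of u]
  have "(\<Sum>j. cinner u (e j) *\<^sub>C e j) = u"
    by (rule onb_eqI[OF assms]) (rule onb_cinner_suminf[OF assms s])
  then show ?thesis using onb_summable[OF assms s] by (metis summable_sums)
qed

lemma onb_expansion_LIMSEQ:
  fixes e :: "nat \<Rightarrow> 'a::{complex_inner_space, banach}"
  assumes "onb e"
  shows "(\<lambda>n. \<Sum>j<n. cinner u (e j) *\<^sub>C e j) \<longlonglongrightarrow> u"
  using onb_expansion[OF assms] by (simp add: sums_def)

lemma onb_parseval:
  fixes e :: "nat \<Rightarrow> 'a::{complex_inner_space, banach}"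
  assumes "onb e"
  shows "(\<lambda>j. (cmod (cinner u (e j)))\<^sup>2) sums (norm u)\<^sup>2"
  using tendsto_power[OF tendsto_norm[OF onb_expansion_LIMSEQ[OF assms, of u]], of 2]
  by (simp add: onb_norm_sum[OF assms] sums_def)

text \<open>The operator that sends \<open>f j\<close> to \<open>s j\<close> times
  \<open>e j\<close>, a singular value decomposition when \<open>s\<close> is non-negative. Both the
  inverse of the Airy-Dirac operator and the Fourier transform are of this form.\<close>

definition diag_op :: "(nat \<Rightarrow> complex) \<Rightarrow> (nat \<Rightarrow> 'a::{complex_inner_space, banach}) \<Rightarrow>
    (nat \<Rightarrow> 'a) \<Rightarrow> 'a \<Rightarrow> 'a" where
  "diag_op s e f y = (\<Sum>j. (s j * cinner y (f j)) *\<^sub>C e j)"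

lemma diag_op_summable:
  assumes "onb f" "\<And>j. cmod (s j) \<le> M"
  shows "summable (\<lambda>j. (cmod (s j * cinner y (f j)))\<^sup>2)"
proof (rule summable_comparison_test')
  show "summable (\<lambda>j. M\<^sup>2 * (cmod (cinner y (f j)))\<^sup>2)"
    by (intro summable_mult onb_square_summable assms)
  show "norm ((cmod (s n * cinner y (f n)))\<^sup>2) \<le> M\<^sup>2 * (cmod (cinner y (f n)))\<^sup>2" if "n \<ge> 0" for n
    using power_mono[OF assms(2)[of n], of 2]
    by (auto simp: norm_mult power_mult_distrib intro!: mult_right_mono)
qed

context
  fixes e f :: "nat \<Rightarrow> 'a::{complex_inner_space, banach}" and s :: "nat \<Rightarrow> complex" and M :: real
  assumes e: "onb e" and f: "onb f" and s: "\<And>j. cmod (s j) \<le> M"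
begin

lemma diag_op_sums: "(\<lambda>j. (s j * cinner y (f j)) *\<^sub>C e j) sums diag_op s e f y"
  unfolding diag_op_def by (intro summable_sums onb_summable e diag_op_summable[OF f s])

lemma cinner_diag_op: "cinner (diag_op s e f y) (e k) = s k * cinner y (f k)"
  unfolding diag_op_def by (intro onb_cinner_suminf e diag_op_summable[OF f s])

lemma diag_op_norm_le: "norm (diag_op s e f y) \<le> M * norm y"
proof -
  have M: "M \<ge> 0" using s[of 0] norm_ge_zero order_trans by blast
  have "(norm (diag_op s e f y))\<^sup>2 \<le> M\<^sup>2 * (norm y)\<^sup>2"
  proof (rule sums_le[OF _ onb_parseval[OF e] sums_mult[OF onb_parseval[OF f]]])
    fix n
    show "(cmod (cinner (diag_op s e f y) (e n)))\<^sup>2 \<le> M\<^sup>2 * (cmod (cinner y (f n)))\<^sup>2"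
      using power_mono[OF s[of n], of 2]
      by (auto simp: cinner_diag_op norm_mult power_mult_distrib intro!: mult_right_mono)
  qed
  then have "(norm (diag_op s e f y))\<^sup>2 \<le> (M * norm y)\<^sup>2"
    by (simp add: power_mult_distrib)
  then show ?thesis using M by (auto intro: power2_le_imp_le)
qed

lemma diag_op_bounded_clinear: "bounded_clinear (diag_op s e f)"
proof (rule bounded_clinearI)
  show "diag_op s e f (x + y) = diag_op s e f x + diag_op s e f y" for x y
    by (rule onb_eqI[OF e]) (simp add: cinner_diag_op cinner_simps algebra_simps)
  show "diag_op s e f (c *\<^sub>C x) = c *\<^sub>C diag_op s e f x" for c x
    by (rule onb_eqI[OF e]) (simp add: cinner_diag_op cinner_simps algebra_simps)
qed (rule diag_op_norm_le)

lemma diag_op_basis: "diag_op s e f (f j) = s j *\<^sub>C e j"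
  by (rule onb_eqI[OF e]) (auto simp: cinner_diag_op cinner_simps onb_cinner[OF e] onb_cinner[OF f])

text \<open>Both inner products are expanded into series whose terms agree: passing to the adjoint
  exchanges the two bases and conjugates the coefficients.\<close>

lemma cinner_diag_op_adjoint: "cinner (diag_op s e f u) v = cinner u (diag_op (\<lambda>j. cnj (s j)) f e v)"
proof -
  have t: "\<And>j. cmod (cnj (s j)) \<le> M" using s by simp
  have "(\<lambda>j. cinner ((s j * cinner u (f j)) *\<^sub>C e j) v) sums cinner (diag_op s e f u) v"
    by (rule bounded_linear.sums[OF bounded_bilinear.bounded_linear_left[OF bounded_bilinear_cinner]
          diag_op_sums])
  moreover
  have "(\<lambda>n. \<Sum>j<n. (cnj (s j) * cinner v (e j)) *\<^sub>C f j) \<longlonglongrightarrow> diag_op (\<lambda>j. cnj (s j)) f e v"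
    unfolding diag_op_def
    by (intro summable_LIMSEQ onb_summable f diag_op_summable[OF e t])
  then have "(\<lambda>j. cinner u ((cnj (s j) * cinner v (e j)) *\<^sub>C f j)) sums
      cinner u (diag_op (\<lambda>j. cnj (s j)) f e v)"
    by (intro bounded_linear.sums[OF bounded_bilinear.bounded_linear_right[OF bounded_bilinear_cinner]])
      (simp add: sums_def)
  moreover have "cinner ((s j * cinner u (f j)) *\<^sub>C e j) v =
      cinner u ((cnj (s j) * cinner v (e j)) *\<^sub>C f j)" for j
    using cinner_commute[of v "e j"] by (simp add: cinner_simps)
  ultimately show ?thesis by (simp add: sums_unique2)
qed

end

section \<open>Adjoints, compactness and singular values of diagonal operators\<close>

lemma adjoint_op_eqI:
  fixes T :: "'a::{complex_inner_space, banach} \<Rightarrow> 'a"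
  assumes "onb e" "\<And>j. e j \<in> D" "\<And>u. u \<in> D \<Longrightarrow> cinner (T u) v = cinner u w"
  shows "adjoint_op D T v = w"
  unfolding adjoint_op_def
proof (rule the_equality)
  fix w' assume w': "\<forall>u\<in>D. cinner (T u) v = cinner u w'"
  show "w' = w"
    by (rule onb_eqI[OF assms(1)]) (metis assms(2,3) cinner_commute w')
qed (use assms in auto)

text \<open>A set approximated uniformly by compact sets is totally bounded. One third of \<epsilon>
  each is spent on leaving the closure, on reaching the compact set and on its finite net.\<close>

lemma compact_closure_approx:
  fixes S :: "'a::banach set"
  assumes "\<And>\<epsilon>. \<epsilon> > 0 \<Longrightarrow> \<exists>C. compact C \<and> (\<forall>x\<in>S. \<exists>y\<in>C. dist x y < \<epsilon>)"
  shows "compact (closure S)"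
  unfolding compact_eq_totally_bounded
proof (intro conjI allI impI)
  show "Topological_Spaces.complete (closure S)" by (simp add: complete_eq_closed)
  fix \<epsilon> :: real assume \<epsilon>: "\<epsilon> > 0"
  obtain C where C: "compact C" "\<And>x. x \<in> S \<Longrightarrow> \<exists>y\<in>C. dist x y < \<epsilon>/3"
    using assms[of "\<epsilon>/3"] \<epsilon> by auto
  obtain k where k: "finite k" "C \<subseteq> (\<Union>x\<in>k. ball x (\<epsilon>/3))"
    using C(1) \<epsilon> unfolding compact_eq_totally_bounded by (meson divide_pos_pos zero_less_numeral)
  have "closure S \<subseteq> (\<Union>x\<in>k. ball x \<epsilon>)"
  proof
    fix z assume "z \<in> closure S"
    then obtain x where x: "x \<in> S" "dist x z < \<epsilon>/3"
      using \<epsilon> unfolding closure_approachable by (meson divide_pos_pos zero_less_numeral)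
    obtain y where y: "y \<in> C" "dist x y < \<epsilon>/3" using C(2)[OF x(1)] by auto
    then obtain w where w: "w \<in> k" "dist w y < \<epsilon>/3" using k(2) by auto
    have "dist w z < \<epsilon>"
      using dist_triangle[of w z y] dist_triangle[of y z x] x(2) y(2) w(2) by (simp add: dist_commute)
    with w(1) show "z \<in> (\<Union>x\<in>k. ball x \<epsilon>)" by auto
  qed
  with k(1) show "\<exists>k. finite k \<and> closure S \<subseteq> (\<Union>x\<in>k. ball x \<epsilon>)" by blast
qed

text \<open>Each step of the induction adds, in the sense of Minkowski sums, a continuous image of a
  closed disc.\<close>

lemma compact_linear_combinations:
  fixes e :: "nat \<Rightarrow> 'a::complex_inner_space"
  shows "compact {\<Sum>j<n. c j *\<^sub>C e j |c. \<forall>j. cmod (c j) \<le> M}"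
proof (induction n)
  case 0
  have "{\<Sum>j<0. c j *\<^sub>C e j |c. \<forall>j. cmod (c j) \<le> M} \<subseteq> {0}" by auto
  then show ?case by (meson finite.emptyI finite_imp_compact finite_insert finite_subset)
next
  case (Suc n)
  let ?A = "{\<Sum>j<n. c j *\<^sub>C e j |c. \<forall>j. cmod (c j) \<le> M}" and ?B = "(\<lambda>c. c *\<^sub>C e n) ` cball 0 M"
  have "compact ?B"
    by (intro compact_continuous_image linear_continuous_on bounded_linear_scaleC_left compact_cball)
  then have "compact {x + y |x y. x \<in> ?A \<and> y \<in> ?B}"
    by (rule compact_sums[OF Suc.IH])
  moreover have "{x + y |x y. x \<in> ?A \<and> y \<in> ?B} = {\<Sum>j<Suc n. c j *\<^sub>C e j |c. \<forall>j. cmod (c j) \<le> M}"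
  proof (intro equalityI subsetI)
    fix z assume "z \<in> {x + y |x y. x \<in> ?A \<and> y \<in> ?B}"
    then obtain c d where cd: "\<forall>j. cmod (c j) \<le> M" "cmod d \<le> M"
      "z = (\<Sum>j<n. c j *\<^sub>C e j) + d *\<^sub>C e n" by auto
    have "z = (\<Sum>j<Suc n. (c(n := d)) j *\<^sub>C e j)" using cd by simp
    then show "z \<in> {\<Sum>j<Suc n. c j *\<^sub>C e j |c. \<forall>j. cmod (c j) \<le> M}"
      using cd by (intro CollectI exI[of _ "c(n := d)"]) auto
  next
    fix z assume "z \<in> {\<Sum>j<Suc n. c j *\<^sub>C e j |c. \<forall>j. cmod (c j) \<le> M}"
    then obtain c where "\<forall>j. cmod (c j) \<le> M" "z = (\<Sum>j<n. c j *\<^sub>C e j) + c n *\<^sub>C e n" by auto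
    then show "z \<in> {x + y |x y. x \<in> ?A \<and> y \<in> ?B}"
      by (intro CollectI exI[of _ "\<Sum>j<n. c j *\<^sub>C e j"] exI[of _ "c n *\<^sub>C e n"]) auto
  qed
  ultimately show ?case by simp
qed

lemma diag_op_compact:
  fixes e f :: "nat \<Rightarrow> 'a::{complex_inner_space, banach}"
  assumes e: "onb e" and f: "onb f" and s: "s \<longlonglongrightarrow> (0::complex)"
  shows "compact_op (diag_op s e f)"
proof -
  obtain M where M: "\<And>j. cmod (s j) \<le> M"
    using convergent_imp_Bseq[OF convergentI[OF s]] by (auto simp: Bseq_def)
  have "compact (closure (diag_op s e f ` cball 0 1))"
  proof (rule compact_closure_approx)
    fix \<epsilon> :: real assume \<epsilon>: "\<epsilon> > 0"
    then obtain n where n: "\<And>j. j \<ge> n \<Longrightarrow> cmod (s j) \<le> \<epsilon>/2"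
      using LIMSEQ_D[OF s, of "\<epsilon>/2"] by (auto intro: less_imp_le)
    \<comment> \<open>The tail is again a diagonal operator, of norm at most \<epsilon>/2; the head
      maps the unit ball into the compact set \<open>?C\<close> of combinations with bounded
      coefficients.\<close>
    define t where "t j = (if j < n then 0 else s j)" for j
    have t: "cmod (t j) \<le> \<epsilon>/2" for j using n \<epsilon> by (auto simp: t_def)
    let ?C = "{\<Sum>j<n. c j *\<^sub>C e j |c. \<forall>j. cmod (c j) \<le> M}"
    have "\<exists>y\<in>?C. dist (diag_op s e f x) y < \<epsilon>" if "norm x \<le> 1" for x
    proof
      let ?y = "\<Sum>j<n. (s j * cinner x (f j)) *\<^sub>C e j"
      have "cmod (s j * cinner x (f j)) \<le> M * 1" for j
        unfolding norm_mult using M norm_cinner_le[of x "f j"] that f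
        by (intro mult_mono) (auto intro: order_trans[OF norm_ge_zero M])
      then show "?y \<in> ?C" by (intro CollectI exI[of _ "\<lambda>j. s j * cinner x (f j)"]) auto
      have "diag_op s e f x - ?y = diag_op t e f x"
        by (rule onb_eqI[OF e])
          (auto simp: cinner_diff cinner_diag_op[OF e f M] cinner_diag_op[OF e f t]
            onb_cinner_sum[OF e] t_def)
      then have "dist (diag_op s e f x) ?y \<le> \<epsilon>/2 * norm x"
        unfolding dist_norm using diag_op_norm_le[OF e f t, where y = x] by simp
      also have "\<dots> \<le> \<epsilon>/2 * 1" using that \<epsilon> by (intro mult_left_mono) auto
      finally show "dist (diag_op s e f x) ?y < \<epsilon>" using \<epsilon> by simp
    qed
    then show "\<exists>C. compact C \<and> (\<forall>x\<in>diag_op s e f ` cball 0 1. \<exists>y\<in>C. dist x y < \<epsilon>)"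
      by (intro exI[of _ ?C] conjI compact_linear_combinations) auto
  qed
  then show ?thesis
    unfolding compact_op_def using diag_op_bounded_clinear[OF e f, of s M] M by blast
qed

text \<open>The bound is attained at \<open>f 0\<close>, whose coefficient is the largest
  one.\<close>

lemma diag_op_onorm:
  fixes e f :: "nat \<Rightarrow> 'a::{complex_inner_space, banach}"
  assumes e: "onb e" and f: "onb f" and s: "\<And>j::nat. cmod (s j) \<le> cmod (s 0)"
  shows "onorm (diag_op s e f) = cmod (s 0)"
proof (rule antisym)
  show "onorm (diag_op s e f) \<le> cmod (s 0)"
    by (rule onorm_bound) (use diag_op_norm_le[OF e f s] in auto)
  have "norm (diag_op s e f (f 0)) \<le> onorm (diag_op s e f) * norm (f 0)"
    using diag_op_bounded_clinear[OF e f, of s "cmod (s 0)"] s by (intro onorm) (auto simp: bounded_clinear_def)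
  then show "cmod (s 0) \<le> onorm (diag_op s e f)"
    using diag_op_basis[OF e f, of s "cmod (s 0)" 0] s e f by (simp add: norm_scaleC)
qed

lemma diag_op_singular_values:
  fixes e f :: "nat \<Rightarrow> 'a::{complex_inner_space, banach}"
  assumes e: "onb e" and f: "onb f" and s: "s \<longlonglongrightarrow> (0::real)" "decseq s"
  shows "singular_values (diag_op (\<lambda>j. complex_of_real (s j)) e f) s"
proof -
  interpret cvs: vector_space "(*\<^sub>C) :: complex \<Rightarrow> 'a \<Rightarrow> 'a" by (rule vector_space_scaleC)
  let ?T = "diag_op (\<lambda>j. complex_of_real (s j)) e f"
  let ?S = "diag_op (\<lambda>j. complex_of_real (s j)) f e"
  have pos: "0 \<le> s j" for j using decseq_ge[OF s(2,1)] .
  have b: "cmod (complex_of_real (s j)) \<le> s 0" for j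
    using pos decseqD[OF s(2), of 0 j] by simp
  have adj: "adjoint_op UNIV ?T v = ?S v" for v
    by (rule adjoint_op_eqI[OF e]) (use cinner_diag_op_adjoint[OF e f b] in auto)
  have *: "finite {j. s j = \<mu>} \<and> card {j. s j = \<mu>} =
      vector_space.dim (*\<^sub>C) {v. adjoint_op UNIV ?T (?T v) = complex_of_real (\<mu>\<^sup>2) *\<^sub>C v}"
    if \<mu>: "\<mu> > 0" for \<mu>
  proof
    let ?J = "{j. s j = \<mu>}"
    let ?E = "{v. adjoint_op UNIV ?T (?T v) = complex_of_real (\<mu>\<^sup>2) *\<^sub>C v}"
    obtain N where N: "\<And>j. j \<ge> N \<Longrightarrow> s j < \<mu>"
      using order_tendstoD(2)[OF s(1) \<mu>] by (auto simp: eventually_sequentially)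
    have "?J \<subseteq> {..<N}" using N by (force simp: not_le[symmetric])
    then show fin: "finite ?J" by (rule finite_subset) simp
    have inj: "inj_on f ?J"
      by (intro inj_onI) (metis f onb_cinner zero_neq_one)
    \<comment> \<open>In coordinates with respect to \<open>f\<close> the eigenvalue equation says
      that (s j)^2 - \<mu>^2 annihilates the \<open>j\<close>-th coefficient. Since
      \<open>s j\<close> and \<mu> are non-negative, equality of squares is equality, and the
      eigenspace is the span of the \<open>f j\<close> with \<open>s j = \<mu>\<close>.\<close>
    have E: "v \<in> ?E \<longleftrightarrow> (\<forall>j. s j \<noteq> \<mu> \<longrightarrow> cinner v (f j) = 0)" for v
    proof -
      have "v \<in> ?E \<longleftrightarrow> (\<forall>j. cinner (?S (?T v)) (f j) = cinner (complex_of_real (\<mu>\<^sup>2) *\<^sub>C v) (f j))"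
        unfolding adj using onb_eqI[OF f] by auto
      also have "\<dots> \<longleftrightarrow> (\<forall>j. complex_of_real ((s j)\<^sup>2 - \<mu>\<^sup>2) * cinner v (f j) = 0)"
        by (simp add: cinner_diag_op[OF e f b] cinner_diag_op[OF f e b] cinner_simps
            algebra_simps power2_eq_square)
      also have "\<dots> \<longleftrightarrow> (\<forall>j. s j \<noteq> \<mu> \<longrightarrow> cinner v (f j) = 0)"
        using pos \<mu> by (auto simp: power2_eq_iff_nonneg less_imp_le simp flip: of_real_power)
      finally show ?thesis .
    qed
    have "cvs.dim ?E = card (f ` ?J)"
    proof (rule cvs.dim_unique[OF _ _ _ refl])
      show "f ` ?J \<subseteq> ?E" unfolding subset_iff E by (auto simp: onb_cinner[OF f])
      show "?E \<subseteq> cvs.span (f ` ?J)"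
      proof
        fix v assume "v \<in> ?E"
        then have "v = (\<Sum>j\<in>?J. cinner v (f j) *\<^sub>C f j)"
          unfolding E by (intro onb_eqI[OF f]) (auto simp: onb_cinner_sum[OF f fin])
        also have "\<dots> \<in> cvs.span (f ` ?J)"
          by (intro cvs.span_sum cvs.span_scale cvs.span_base) auto
        finally show "v \<in> cvs.span (f ` ?J)" .
      qed
      show "cvs.independent (f ` ?J)"
      proof (rule cvs.independent_if_scalars_zero)
        fix g x assume 0: "(\<Sum>x\<in>f ` ?J. g x *\<^sub>C x) = 0" and "x \<in> f ` ?J"
        then obtain k where k: "k \<in> ?J" "x = f k" by auto
        have "cinner (\<Sum>j\<in>?J. g (f j) *\<^sub>C f j) (f k) = 0"
          using 0 by (simp add: sum.reindex[OF inj])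
        then show "g x = 0" using k by (simp add: onb_cinner_sum[OF f fin])
      qed (use fin in auto)
    qed
    then show "card ?J = cvs.dim ?E" using card_image[OF inj] by simp
  qed
  have "compact_op ?T"
    using s(1) by (intro diag_op_compact e f) (simp add: tendsto_of_real_iff[of s 0, simplified])
  with * s(2) pos show ?thesis unfolding singular_values_def by blast
qed

section \<open>Smooth functions and cutoffs\<close>

text \<open>The regularity half of \<open>test_function\<close>, isolated because Hermite functions
  are smooth but not compactly supported.\<close>

definition smooth :: "(real \<Rightarrow> real) \<Rightarrow> bool" where
  "smooth f \<longleftrightarrow> (\<forall>n x. (deriv ^^ n) f differentiable (at x))"

lemma test_function_alt: "test_function \<phi> \<longleftrightarrow> smooth \<phi> \<and> compact (closure {x. \<phi> x \<noteq> 0})"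
  by (simp add: test_function_def smooth_def)

lemma smooth_DERIV: "smooth f \<Longrightarrow> (f has_real_derivative deriv f x) (at x)"
  unfolding smooth_def
  by (metis DERIV_deriv_iff_real_differentiable funpow_0)

lemma smooth_deriv: "smooth f \<Longrightarrow> smooth (deriv f)"
  unfolding smooth_def by (metis comp_apply funpow_Suc_right)

lemma smooth_isCont: "smooth f \<Longrightarrow> isCont f x"
  using smooth_DERIV DERIV_isCont by blast

lemma smooth_continuous_on: "smooth f \<Longrightarrow> continuous_on A f"
  by (simp add: continuous_at_imp_continuous_on smooth_isCont)

text \<open>If every member of a class has a derivative in the class, then all iterated derivatives
  exist. Smoothness is thus shown by exhibiting a class closed under differentiation, without
  formulas for higher derivatives.\<close>

lemma smooth_coinduct:
  assumes "P f"
    and "\<And>f. P f \<Longrightarrow> \<exists>f'. P f' \<and> (\<forall>x. (f has_real_derivative f' x) (at x))"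
  shows "smooth f"
proof -
  have d: "P (deriv g) \<and> (\<forall>x. g differentiable (at x))" if g: "P g" for g
  proof -
    obtain g' where g': "P g'" "\<And>x. (g has_real_derivative g' x) (at x)"
      using assms(2)[OF g] by blast
    have "deriv g = g'" using g'(2) by (intro ext DERIV_imp_deriv)
    then show ?thesis using g' real_differentiable_def by blast
  qed
  have "P ((deriv ^^ n) f)" for n
    by (induction n) (use assms(1) d in auto)
  then show ?thesis unfolding smooth_def using d by blast
qed

text \<open>Finite sums of products of smooth functions: the Leibniz rule stays inside this class,
  whereas single products do not.\<close>

inductive smooth_products :: "(real \<Rightarrow> real) \<Rightarrow> bool" where
  times: "smooth f \<Longrightarrow> smooth g \<Longrightarrow> smooth_products (\<lambda>x. f x * g x)"
| plus: "smooth_products f \<Longrightarrow> smooth_products g \<Longrightarrow> smooth_products (\<lambda>x. f x + g x)"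

lemma smooth_mult:
  assumes "smooth f" "smooth g"
  shows "smooth (\<lambda>x. f x * g x)"
proof (rule smooth_coinduct[where P = smooth_products])
  show "smooth_products (\<lambda>x. f x * g x)" by (rule smooth_products.times[OF assms])
  fix h :: "real \<Rightarrow> real"
  assume "smooth_products h"
  then show "\<exists>h'. smooth_products h' \<and> (\<forall>x. (h has_real_derivative h' x) (at x))"
  proof induction
    case (times f g)
    show ?case
    proof (intro exI conjI allI)
      show "smooth_products (\<lambda>x. deriv f x * g x + f x * deriv g x)"
        using times by (intro smooth_products.intros smooth_deriv)
      show "((\<lambda>x. f x * g x) has_real_derivative deriv f x * g x + f x * deriv g x) (at x)" for x
        using times by (auto intro!: derivative_eq_intros smooth_DERIV)
    qed
  next
    case (plus f g)
    then obtain f' g' where "smooth_products f'" "\<forall>x. (f has_real_derivative f' x) (at x)"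
      "smooth_products g'" "\<forall>x. (g has_real_derivative g' x) (at x)" by blast
    then show ?case
      by (intro exI[of _ "\<lambda>x. f' x + g' x"] conjI allI smooth_products.plus DERIV_add) auto
  qed
qed

lemma smooth_affine:
  assumes "smooth f"
  shows "smooth (\<lambda>x. f (a * x + b))"
\<comment> \<open>The factor \<open>c\<close> collects the powers of \<open>a\<close> produced by
  the chain rule.\<close>
proof (rule smooth_coinduct[where P = "\<lambda>h. \<exists>f c. smooth f \<and> h = (\<lambda>x. c * f (a * x + b))"])
  show "\<exists>g c. smooth g \<and> (\<lambda>x. f (a * x + b)) = (\<lambda>x. c * g (a * x + b))"
    using assms by (intro exI[of _ f] exI[of _ 1]) auto
  fix h :: "real \<Rightarrow> real"
  assume "\<exists>f c. smooth f \<and> h = (\<lambda>x. c * f (a * x + b))"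
  then obtain f c where f: "smooth f" "h = (\<lambda>x. c * f (a * x + b))" by blast
  have "(h has_real_derivative (c * a) * deriv f (a * x + b)) (at x)" for x
    unfolding f(2)
    by (auto intro!: derivative_eq_intros DERIV_chain2[OF smooth_DERIV[OF f(1)]])
  then show "\<exists>f'. (\<exists>f c. smooth f \<and> f' = (\<lambda>x. c * f (a * x + b))) \<and>
      (\<forall>x. (h has_real_derivative f' x) (at x))"
    using smooth_deriv[OF f(1)] by blast
qed

section \<open>Gaussians, flat functions and a bump function\<close>

definition gauss :: "real \<Rightarrow> real" where "gauss x = exp (- x\<^sup>2 / 2)"

lemma gauss_pos [simp]: "gauss x > 0" by (simp add: gauss_def)

lemma DERIV_poly_gauss:
  "((\<lambda>x. poly p x * gauss x) has_real_derivative poly (pderiv p - [:0, 1:] * p) x * gauss x) (at x)"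
  unfolding gauss_def
  by (auto intro!: derivative_eq_intros simp: algebra_simps)

lemma smooth_poly_gauss: "smooth (\<lambda>x. poly p x * gauss x)"
  by (rule smooth_coinduct[where P = "\<lambda>f. \<exists>p. f = (\<lambda>x. poly p x * gauss x)"])
    (use DERIV_poly_gauss in blast)+

lemma tendsto_poly_exp: "((\<lambda>y::real. poly p y * exp (- y)) \<longlongrightarrow> 0) at_top"
proof -
  have "((\<lambda>y. \<Sum>i\<le>degree p. coeff p i * (y ^ i / exp y)) \<longlongrightarrow> (\<Sum>i\<le>degree p. coeff p i * 0)) at_top"
    by (intro tendsto_intros tendsto_power_div_exp_0)
  then show ?thesis
    by (simp add: poly_altdef sum_distrib_right exp_minus divide_inverse mult.assoc)
qed

text \<open>The polynomial in 1/t closes the family under differentiation: with s = 1/t, the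
  derivative for t > 0 is s^2 (p(s) - p'(s)) exp (-s).\<close>

definition flat_exp :: "real poly \<Rightarrow> real \<Rightarrow> real" where
  "flat_exp p t = (if t > 0 then poly p (1 / t) * exp (- (1 / t)) else 0)"

lemma DERIV_flat_exp:
  "(flat_exp p has_real_derivative flat_exp ([:0, 0, 1:] * (p - pderiv p)) t) (at t)"
proof -
  consider "t < 0" | "t > 0" | "t = 0" by linarith
  then show ?thesis
  proof cases
    case 1
    have "((\<lambda>_. 0) has_real_derivative 0) (at t)" by simp
    moreover have "\<forall>\<^sub>F x in nhds t. flat_exp p x = 0"
      using eventually_nhds_in_open[of "{..<0}" t] 1
      by (auto elim!: eventually_mono simp: flat_exp_def)
    ultimately show ?thesis
      using 1 by (subst DERIV_cong_ev[OF refl _ refl]) (auto simp: flat_exp_def)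
  next
    case 2
    have "((\<lambda>x. poly p (1 / x) * exp (- (1 / x))) has_real_derivative
        flat_exp ([:0, 0, 1:] * (p - pderiv p)) t) (at t)"
      using 2 by (auto intro!: derivative_eq_intros
          simp: flat_exp_def field_simps power2_eq_square)
    moreover have "\<forall>\<^sub>F x in nhds t. flat_exp p x = poly p (1 / x) * exp (- (1 / x))"
      using eventually_nhds_in_open[of "{0<..}" t] 2
      by (auto elim!: eventually_mono simp: flat_exp_def)
    ultimately show ?thesis
      by (subst DERIV_cong_ev[OF refl _ refl])
  next
    case 3
    have "((\<lambda>h. flat_exp p h / h) \<longlongrightarrow> 0) (at_left 0)"
      by (rule tendsto_eventually) (auto simp: eventually_at_left_field flat_exp_def intro!: exI[of _ "-1"])
    moreover have "((\<lambda>h. flat_exp p h / h) \<longlongrightarrow> 0) (at_right 0)"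
    proof -
      \<comment> \<open>With s = 1/h the difference quotient at 0 is s p(s) exp (-s), which tends to
        0 as s grows.\<close>
      have "((\<lambda>h. poly ([:0, 1:] * p) (inverse h) * exp (- inverse h)) \<longlongrightarrow> 0) (at_right (0::real))"
        by (rule filterlim_compose[OF tendsto_poly_exp filterlim_inverse_at_top_right])
      then show ?thesis
        by (rule Lim_transform_eventually)
          (auto simp: eventually_at_right_field flat_exp_def field_simps intro!: exI[of _ 1])
    qed
    ultimately have "((\<lambda>h. flat_exp p h / h) \<longlongrightarrow> 0) (at 0)"
      by (simp add: filterlim_split_at)
    then show ?thesis
      using 3 by (simp add: DERIV_def flat_exp_def)
  qed
qed

lemma smooth_flat_exp: "smooth (flat_exp p)"
  by (rule smooth_coinduct[where P = "\<lambda>f. \<exists>p. f = flat_exp p"]) (use DERIV_flat_exp in blast)+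

text \<open>Each flat factor equals exp (-1) at the origin; the prefactor normalises the value there
  to 1.\<close>

definition bump :: "real \<Rightarrow> real" where
  "bump x = exp 2 * (flat_exp 1 (1 + x) * flat_exp 1 (1 - x))"

lemma bump_zero [simp]: "bump 0 = 1"
  by (simp add: bump_def flat_exp_def exp_add[symmetric])

lemma bump_support: "bump x \<noteq> 0 \<Longrightarrow> \<bar>x\<bar> < 1"
  by (auto simp: bump_def flat_exp_def split: if_splits)

lemma smooth_const: "smooth (\<lambda>_. c)"
  by (rule smooth_coinduct[where P = "\<lambda>f. \<exists>c. f = (\<lambda>_. c)"]) (auto intro!: exI[of _ "\<lambda>_. 0"])

lemma smooth_bump: "smooth bump"
proof -
  have "smooth (\<lambda>x. exp 2 * (flat_exp 1 (1 * x + 1) * flat_exp 1 ((-1) * x + 1)))"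
    by (intro smooth_mult smooth_const smooth_affine smooth_flat_exp)
  then show ?thesis by (simp add: bump_def[abs_def] add.commute)
qed

lemma compact_support_bounded:
  fixes f :: "real \<Rightarrow> real"
  assumes "continuous_on UNIV f" "\<And>x. \<bar>x\<bar> > 1 \<Longrightarrow> f x = 0"
  shows "\<exists>M. \<forall>x. \<bar>f x\<bar> \<le> M"
proof -
  have "compact (f ` {-1..1})"
    using assms(1) by (intro compact_continuous_image continuous_on_subset[OF assms(1)]) auto
  then obtain M where M: "\<And>x. x \<in> {-1..1} \<Longrightarrow> \<bar>f x\<bar> \<le> M"
    by (metis (no_types, lifting) bounded_iff compact_imp_bounded imageI real_norm_def)
  have "\<bar>f x\<bar> \<le> max M 0" for x
    using M[of x] assms(2)[of x] by (cases "x \<in> {-1..1}") (auto simp: abs_if split: if_splits)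
  then show ?thesis by blast
qed

lemma bump_bounded: "\<exists>M. \<forall>x. \<bar>bump x\<bar> \<le> M \<and> \<bar>deriv bump x\<bar> \<le> M"
proof -
  have z: "bump y = 0" if "\<bar>y\<bar> > 1" for y
    using bump_support[of y] that by force
  have "deriv bump x = 0" if "\<bar>x\<bar> > 1" for x
  proof -
    have "\<forall>\<^sub>F y in nhds x. bump y = 0"
      using that
      by (intro eventually_mono[OF eventually_nhds_in_open[of "- {-1..1}" x]])
        (auto intro!: z simp: abs_if split: if_splits)
    then have "deriv bump x = deriv (\<lambda>_. 0) x" by (intro deriv_cong_ev) auto
    then show ?thesis by simp
  qed
  then obtain M1 where "\<forall>x. \<bar>deriv bump x\<bar> \<le> M1"
    using compact_support_bounded[OF smooth_continuous_on[OF smooth_deriv[OF smooth_bump]]] by blast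
  moreover obtain M2 where "\<forall>x. \<bar>bump x\<bar> \<le> M2"
    using compact_support_bounded[OF smooth_continuous_on[OF smooth_bump]] z by blast
  ultimately show ?thesis
    by (intro exI[of _ "max M1 M2"]) (simp add: le_max_iff_disj)
qed

section \<open>Cutoffs that approximate a smooth function by test functions\<close>

definition cutoff :: "nat \<Rightarrow> (real \<Rightarrow> real) \<Rightarrow> real \<Rightarrow> real" where
  "cutoff k f x = bump (x / real (Suc k)) * f x"

lemma test_function_cutoff:
  assumes "smooth f"
  shows "test_function (cutoff k f)"
proof -
  have "smooth (\<lambda>x. bump ((1 / real (Suc k)) * x + 0) * f x)"
    by (intro smooth_mult smooth_affine smooth_bump assms)
  then have "smooth (cutoff k f)" by (simp add: cutoff_def[abs_def])
  moreover have "{x. cutoff k f x \<noteq> 0} \<subseteq> {- real (Suc k)..real (Suc k)}"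
  proof
    fix x assume "x \<in> {x. cutoff k f x \<noteq> 0}"
    then have "\<bar>x / real (Suc k)\<bar> < 1" using bump_support[of "x / real (Suc k)"] by (simp add: cutoff_def)
    then show "x \<in> {- real (Suc k)..real (Suc k)}" 
      by (simp add: abs_divide divide_less_eq abs_less_iff)
  qed
  then have "bounded {x. cutoff k f x \<noteq> 0}" using bounded_subset bounded_closed_interval by blast
  ultimately show ?thesis by (simp add: test_function_alt compact_closure)
qed

lemma deriv_cutoff:
  assumes "smooth f"
  shows "deriv (cutoff k f) x =
    deriv bump (x / real (Suc k)) / real (Suc k) * f x + bump (x / real (Suc k)) * deriv f x"
  unfolding cutoff_def
  by (rule DERIV_imp_deriv)
    (auto intro!: derivative_eq_intros DERIV_chain2[OF smooth_DERIV[OF smooth_bump]]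
      smooth_DERIV[OF assms] simp del: of_nat_Suc)

lemma inverse_Suc_LIMSEQ: "(\<lambda>k. x / real (Suc k)) \<longlonglongrightarrow> 0"
  using tendsto_mult[OF tendsto_const[of x] LIMSEQ_inverse_real_of_nat] by (simp add: field_simps)

lemma cutoff_LIMSEQ:
  assumes "smooth f"
  shows "(\<lambda>k. cutoff k f x) \<longlonglongrightarrow> f x" "(\<lambda>k. deriv (cutoff k f) x) \<longlonglongrightarrow> deriv f x"
proof -
  have b: "(\<lambda>k. bump (x / real (Suc k))) \<longlonglongrightarrow> bump 0"
    "(\<lambda>k. deriv bump (x / real (Suc k))) \<longlonglongrightarrow> deriv bump 0"
    by (rule isCont_tendsto_compose[OF smooth_isCont inverse_Suc_LIMSEQ], simp add: smooth_bump smooth_deriv)+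
  show "(\<lambda>k. cutoff k f x) \<longlonglongrightarrow> f x"
    using tendsto_mult[OF b(1) tendsto_const[of "f x"]] by (simp add: cutoff_def)
  have "(\<lambda>k. deriv bump (x / real (Suc k)) * (1 / real (Suc k)) * f x +
      bump (x / real (Suc k)) * deriv f x) \<longlonglongrightarrow> deriv bump 0 * 0 * f x + bump 0 * deriv f x"
    by (intro tendsto_intros b inverse_Suc_LIMSEQ)
  then show "(\<lambda>k. deriv (cutoff k f) x) \<longlonglongrightarrow> deriv f x"
    by (simp add: deriv_cutoff[OF assms])
qed

text \<open>One constant serves all scales because rescaling multiplies the derivative of the bump
  by 1/(k+1), at most 1. This is the majorant for the dominated convergence in
  \<open>weak_derivative_smooth\<close>.\<close>

lemma cutoff_bounded:
  "\<exists>M. \<forall>f k x. smooth f \<longrightarrow> \<bar>cutoff k f x\<bar> \<le> M * (\<bar>f x\<bar> + \<bar>deriv f x\<bar>) \<and>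
     \<bar>deriv (cutoff k f) x\<bar> \<le> M * (\<bar>f x\<bar> + \<bar>deriv f x\<bar>)"
proof -
  obtain M where M: "\<And>x. \<bar>bump x\<bar> \<le> M" "\<And>x. \<bar>deriv bump x\<bar> \<le> M" using bump_bounded by blast
  have M0: "M \<ge> 0" using M(1)[of 0] by simp
  have "\<bar>cutoff k f x\<bar> \<le> M * (\<bar>f x\<bar> + \<bar>deriv f x\<bar>) \<and>
     \<bar>deriv (cutoff k f) x\<bar> \<le> M * (\<bar>f x\<bar> + \<bar>deriv f x\<bar>)" if f: "smooth f" for f k x
  proof
    have "\<bar>cutoff k f x\<bar> \<le> M * \<bar>f x\<bar>"
      unfolding cutoff_def abs_mult by (intro mult_right_mono M) auto
    also have "\<dots> \<le> M * (\<bar>f x\<bar> + \<bar>deriv f x\<bar>)" using M0 by (intro mult_left_mono) auto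
    finally show "\<bar>cutoff k f x\<bar> \<le> M * (\<bar>f x\<bar> + \<bar>deriv f x\<bar>)" .
    have "\<bar>deriv bump (x / real (Suc k)) / real (Suc k)\<bar> \<le> M / 1"
      unfolding abs_divide using M0 M(2) by (intro frac_le) auto
    then have "\<bar>deriv bump (x / real (Suc k)) / real (Suc k) * f x\<bar> +
        \<bar>bump (x / real (Suc k)) * deriv f x\<bar> \<le> M * \<bar>f x\<bar> + M * \<bar>deriv f x\<bar>"
      unfolding abs_mult by (intro add_mono mult_right_mono M) auto
    then show "\<bar>deriv (cutoff k f) x\<bar> \<le> M * (\<bar>f x\<bar> + \<bar>deriv f x\<bar>)"
      unfolding deriv_cutoff[OF f] distrib_left using abs_triangle_ineq order_trans by blast
  qed
  then show ?thesis by blast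
qed

section \<open>The Hilbert space of square-integrable spinors\<close>

lemma L2_eq_refl: "sq_integrable f \<Longrightarrow> L2_eq f f"
  by (simp add: L2_eq_def)

lemma L2_cases:
  obtains f where "sq_integrable f" "u = abs_L2 f"
proof
  show "u = abs_L2 (rep_L2 u)" by (simp add: Quotient3_abs_rep[OF Quotient3_L2])
  show "sq_integrable (rep_L2 u)"
    using Quotient3_rep_reflp[OF Quotient3_L2, of u] by (simp add: L2_eq_def)
qed

lemma abs_L2_eq_iff:
  assumes "sq_integrable f" "sq_integrable g"
  shows "abs_L2 f = abs_L2 g \<longleftrightarrow> (AE x in lborel. f x = g x)"
  using Quotient3_rel[OF Quotient3_L2, of f g] assms by (simp add: L2_eq_def)

lemma abs_L2_algebra:
  assumes "sq_integrable f" "sq_integrable g"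
  shows "abs_L2 f + abs_L2 g = abs_L2 (\<lambda>x. f x + g x)"
    and "abs_L2 f - abs_L2 g = abs_L2 (\<lambda>x. f x - g x)"
    and "cinner (abs_L2 f) (abs_L2 g) = (LINT x|lborel. cdot (f x) (g x))"
    and "inner (abs_L2 f) (abs_L2 g) = (LINT x|lborel. f x \<bullet> g x)"
  using assms[THEN L2_eq_refl]
  by (simp_all add: plus_L2.abs_eq minus_L2.abs_eq cinner_L2.abs_eq inner_L2.abs_eq)

lemma abs_L2_unary:
  assumes "sq_integrable f"
  shows "c *\<^sub>C abs_L2 f = abs_L2 (\<lambda>x. c *s f x)"
    and "r *\<^sub>R abs_L2 f = abs_L2 (\<lambda>x. r *\<^sub>R f x)"
    and "matrix_L2 A (abs_L2 f) = abs_L2 (\<lambda>x. A *v f x)"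
  using assms[THEN L2_eq_refl]
  by (simp_all add: scaleC_L2.abs_eq scaleR_L2.abs_eq matrix_L2.abs_eq)

lemma norm_abs_L2:
  "sq_integrable f \<Longrightarrow> (norm (abs_L2 f))\<^sup>2 = (LINT x|lborel. (norm (f x))\<^sup>2)"
  by (simp add: power2_norm_eq_inner abs_L2_algebra)

lemma sq_integrable_measurable: "sq_integrable f \<Longrightarrow> f \<in> borel_measurable lborel"
  by (simp add: sq_integrable_def)

lemma norm_abs_L2_le:
  assumes "sq_integrable f" "sq_integrable g" "h \<in> borel_measurable lborel"
    and "\<And>x. norm (h x) \<le> norm (f x) + norm (g x)"
  shows "sq_integrable h" "(norm (abs_L2 h))\<^sup>2 \<le> 2 * ((norm (abs_L2 f))\<^sup>2 + (norm (abs_L2 g))\<^sup>2)"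
proof -
  show h: "sq_integrable h" using sq_integrable_bound[OF assms(1-3), of 1] assms(4) by simp
  have "(norm (h x))\<^sup>2 \<le> 2 * ((norm (f x))\<^sup>2 + (norm (g x))\<^sup>2)" for x
  proof -
    have "(norm (h x))\<^sup>2 \<le> (norm (f x) + norm (g x))\<^sup>2" using assms(4) by (intro power_mono) auto
    also have "\<dots> \<le> 2 * ((norm (f x))\<^sup>2 + (norm (g x))\<^sup>2)"
      using sum_squares_bound[of "norm (f x)" "norm (g x)"] by (simp add: power2_sum)
    finally show ?thesis .
  qed
  then have "(LINT x|lborel. (norm (h x))\<^sup>2) \<le>
      (LINT x|lborel. 2 * ((norm (f x))\<^sup>2 + (norm (g x))\<^sup>2))"
    using h assms(1,2) unfolding sq_integrable_def by (intro integral_mono) auto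
  then show "(norm (abs_L2 h))\<^sup>2 \<le> 2 * ((norm (abs_L2 f))\<^sup>2 + (norm (abs_L2 g))\<^sup>2)"
    using h assms(1,2) by (simp add: norm_abs_L2) (simp add: sq_integrable_def)
qed

lemma norm_axis: "norm (axis i (a::complex) :: complex^2) = norm a"
  by (simp add: norm_eq_sqrt_inner inner_axis_axis)

text \<open>Multiplication by a Gaussian maps \<open>L\<^sup>2\<close> into \<open>L\<^sup>1\<close>, so that almost everywhere convergence of a
  subsequence can be taken from \<open>L\<^sup>1\<close>.\<close>

lemma gauss_square: "(gauss x)\<^sup>2 = sqrt pi * normal_density 0 (1 / sqrt 2) x"
  by (auto simp: gauss_def normal_density_def exp_double[symmetric] power_divide
      real_sqrt_mult real_sqrt_divide field_simps exp_add[symmetric] power2_eq_square)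

lemma sq_integrable_gauss: "sq_integrable (\<lambda>x. gauss x *\<^sub>R axis 1 1)"
proof -
  have "integrable lborel (\<lambda>x. sqrt pi * normal_density 0 (1 / sqrt 2) x)"
    by (intro integrable_mult_right integrable_normal_density) auto
  then show ?thesis
    by (simp add: sq_integrable_def norm_axis power_mult_distrib gauss_square[symmetric])
      (simp add: gauss_def[abs_def])
qed

lemma integral_norm_gauss_le:
  assumes "sq_integrable f"
  shows "integrable lborel (\<lambda>x. gauss x *\<^sub>R f x)"
    "(LINT x|lborel. norm (gauss x *\<^sub>R f x)) \<le>
      norm (abs_L2 (\<lambda>x. gauss x *\<^sub>R axis 1 1)) * norm (abs_L2 f)"
proof -
  \<comment> \<open>Scalar functions are carried by the unit vector \<open>axis 1 1\<close>, so that
    the scalar Cauchy-Schwarz inequality becomes the one of \<open>L2\<close>.\<close>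
  let ?n = "\<lambda>x. norm (f x) *\<^sub>R (axis 1 1 :: complex^2)"
  note g = sq_integrable_gauss
  have g_meas: "gauss \<in> borel_measurable borel" by (simp add: gauss_def[abs_def])
  show "integrable lborel (\<lambda>x. gauss x *\<^sub>R f x)"
    using assms g_meas by (intro integrable_bound_sq[OF g assms])
      (auto simp: sq_integrable_def norm_axis)
  have n: "sq_integrable ?n"
    using assms by (intro sq_integrable_bound[OF assms assms, of _ 1])
      (auto simp: sq_integrable_def norm_axis)
  have "(LINT x|lborel. norm (gauss x *\<^sub>R f x)) = (LINT x|lborel. (gauss x *\<^sub>R axis 1 1) \<bullet> ?n x)"
    by (intro Bochner_Integration.integral_cong)
      (auto simp: inner_axis_axis abs_of_pos mult.commute)
  also have "\<dots> = inner (abs_L2 (\<lambda>x. gauss x *\<^sub>R axis 1 1)) (abs_L2 ?n)"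
    by (simp add: abs_L2_algebra g n)
  also have "\<dots> \<le> norm (abs_L2 (\<lambda>x. gauss x *\<^sub>R axis 1 1)) * norm (abs_L2 ?n)"
    by (rule norm_cauchy_schwarz)
  also have "norm (abs_L2 ?n) = norm (abs_L2 f)"
    by (rule power2_eq_imp_eq) (simp_all add: norm_abs_L2 n assms norm_axis)
  finally show "(LINT x|lborel. norm (gauss x *\<^sub>R f x)) \<le>
      norm (abs_L2 (\<lambda>x. gauss x *\<^sub>R axis 1 1)) * norm (abs_L2 f)" .
qed

section \<open>Completeness of \<open>L2\<close>\<close>

lemma L2_AE_subsequence:
  assumes sq: "\<And>n. sq_integrable (f n)" and C: "Cauchy (\<lambda>n. abs_L2 (f n))"
  obtains r :: "nat \<Rightarrow> nat" where "strict_mono r" "AE x in lborel. Cauchy (\<lambda>i. f (r i) x)"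
proof -
  define G where "G = norm (abs_L2 (\<lambda>x. gauss x *\<^sub>R axis 1 1)) + 1"
  have G: "G > 0" by (simp add: G_def add_nonneg_pos)
  have "\<exists>N. \<forall>i\<ge>N. \<forall>j\<ge>N. (LINT x|lborel. norm (gauss x *\<^sub>R f i x - gauss x *\<^sub>R f j x)) < \<epsilon>"
    if \<epsilon>: "\<epsilon> > 0" for \<epsilon>
  proof -
    obtain N where N: "\<And>i j. i \<ge> N \<Longrightarrow> j \<ge> N \<Longrightarrow> norm (abs_L2 (f i) - abs_L2 (f j)) < \<epsilon> / G"
      using CauchyD[OF C, of "\<epsilon> / G"] \<epsilon> G by auto
    have "(LINT x|lborel. norm (gauss x *\<^sub>R f i x - gauss x *\<^sub>R f j x)) < \<epsilon>"
      if "i \<ge> N" "j \<ge> N" for i j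
    proof -
      have "(LINT x|lborel. norm (gauss x *\<^sub>R (f i x - f j x))) \<le>
          norm (abs_L2 (\<lambda>x. gauss x *\<^sub>R axis 1 1)) * norm (abs_L2 (\<lambda>x. f i x - f j x))"
        by (intro integral_norm_gauss_le sq_integrable_diff sq)
      also have "\<dots> \<le> G * norm (abs_L2 (f i) - abs_L2 (f j))"
        unfolding G_def abs_L2_algebra(2)[OF sq sq] by (intro mult_right_mono) auto
      also have "\<dots> < \<epsilon>" using N[OF that] G by (simp add: field_simps)
      finally show ?thesis by (simp add: scaleR_diff_right)
    qed
    then show ?thesis by blast
  qed
  from cauchy_L1_AE_cauchy_subseq[OF integral_norm_gauss_le(1)[OF sq] this]
  obtain r where r: "strict_mono r" "AE x in lborel. Cauchy (\<lambda>i. gauss x *\<^sub>R f (r i) x)"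
    by blast
  have "Cauchy (\<lambda>i. f (r i) x)" if "Cauchy (\<lambda>i. gauss x *\<^sub>R f (r i) x)" for x
    using bounded_linear.Cauchy[OF bounded_linear_scaleR_right that, of "1 / gauss x"] gauss_pos[of x]
    by simp
  then have "AE x in lborel. Cauchy (\<lambda>i. f (r i) x)"
    using r(2) by (auto elim: AE_mp)
  then show ?thesis using that r(1) by blast
qed

text \<open>Riesz-Fischer: the pointwise limit along an almost everywhere convergent subsequence is
  the limit in norm, by Fatou's lemma for the squared differences.\<close>

lemma L2_complete:
  fixes X :: "nat \<Rightarrow> L2"
  assumes "Cauchy X"
  shows "convergent X"
proof -
  have "\<exists>f. sq_integrable f \<and> X n = abs_L2 f" for n by (meson L2_cases)
  then obtain f where f: "\<And>n. sq_integrable (f n)" "\<And>n. X n = abs_L2 (f n)" by metis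
  have X: "X = (\<lambda>n. abs_L2 (f n))" using f(2) by auto
  note [measurable] = f(1)[THEN sq_integrable_measurable]
  obtain r :: "nat \<Rightarrow> nat" where r: "strict_mono r" "AE x in lborel. Cauchy (\<lambda>i. f (r i) x)"
    using L2_AE_subsequence[of f] f(1) assms X by metis
  define g where "g x = lim (\<lambda>i. f (r i) x)" for x
  have g_meas [measurable]: "g \<in> borel_measurable lborel"
    unfolding g_def by (rule borel_measurable_lim_metric) simp
  have lim: "AE x in lborel. (\<lambda>i. f (r i) x) \<longlonglongrightarrow> g x"
    using r(2) by eventually_elim (simp add: g_def Cauchy_convergent_iff convergent_LIMSEQ_iff)
  have *: "\<exists>N. \<forall>n\<ge>N. sq_integrable (\<lambda>x. g x - f n x) \<and> (norm (abs_L2 (\<lambda>x. g x - f n x)))\<^sup>2 \<le> \<epsilon>\<^sup>2"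
    if \<epsilon>: "\<epsilon> > 0" for \<epsilon>
  proof -
    obtain N where N: "\<And>i j. i \<ge> N \<Longrightarrow> j \<ge> N \<Longrightarrow> norm (abs_L2 (f i) - abs_L2 (f j)) < \<epsilon>"
      using CauchyD[OF assms[unfolded X] \<epsilon>] by auto
    have "sq_integrable (\<lambda>x. g x - f n x) \<and> (norm (abs_L2 (\<lambda>x. g x - f n x)))\<^sup>2 \<le> \<epsilon>\<^sup>2"
      if n: "n \<ge> N" for n
    proof -
      have "(\<integral>\<^sup>+x. ennreal ((norm (g x - f n x))\<^sup>2) \<partial>lborel) =
          (\<integral>\<^sup>+x. liminf (\<lambda>i. ennreal ((norm (f (r i) x - f n x))\<^sup>2)) \<partial>lborel)"
      proof (rule nn_integral_cong_AE)
        show "AE x in lborel. ennreal ((norm (g x - f n x))\<^sup>2) =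
            liminf (\<lambda>i. ennreal ((norm (f (r i) x - f n x))\<^sup>2))"
          using lim
        proof eventually_elim
          case (elim x)
          have "(\<lambda>i. ennreal ((norm (f (r i) x - f n x))\<^sup>2)) \<longlonglongrightarrow> ennreal ((norm (g x - f n x))\<^sup>2)"
            by (intro tendsto_ennrealI tendsto_intros elim)
          from lim_imp_Liminf[OF _ this] show ?case by simp
        qed
      qed
      also have "\<dots> \<le> liminf (\<lambda>i. \<integral>\<^sup>+x. ennreal ((norm (f (r i) x - f n x))\<^sup>2) \<partial>lborel)"
        by (intro nn_integral_liminf) simp
      also have "\<dots> \<le> ennreal (\<epsilon>\<^sup>2)"
      proof (rule order_trans[OF Liminf_le_Limsup Limsup_bounded])
        show "\<forall>\<^sub>F i in sequentially. (\<integral>\<^sup>+x. ennreal ((norm (f (r i) x - f n x))\<^sup>2) \<partial>lborel) \<le> ennreal (\<epsilon>\<^sup>2)"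
        proof (rule eventually_sequentiallyI[of N])
          fix i assume "i \<ge> N"
          then have i: "r i \<ge> N" using seq_suble[OF r(1), of i] by simp
          have d: "sq_integrable (\<lambda>x. f (r i) x - f n x)" by (intro sq_integrable_diff f)
          have "(\<integral>\<^sup>+x. ennreal ((norm (f (r i) x - f n x))\<^sup>2) \<partial>lborel) =
              ennreal (LINT x|lborel. (norm (f (r i) x - f n x))\<^sup>2)"
            using d by (intro nn_integral_eq_integral) (auto simp: sq_integrable_def)
          also have "\<dots> = ennreal ((norm (abs_L2 (f (r i)) - abs_L2 (f n)))\<^sup>2)"
            by (simp add: abs_L2_algebra f norm_abs_L2[OF d])
          also have "\<dots> \<le> ennreal (\<epsilon>\<^sup>2)"
            using N[OF i n] by (intro ennreal_leI power_mono) auto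
          finally show "(\<integral>\<^sup>+x. ennreal ((norm (f (r i) x - f n x))\<^sup>2) \<partial>lborel) \<le> ennreal (\<epsilon>\<^sup>2)" .
        qed
      qed simp
      finally have le: "(\<integral>\<^sup>+x. ennreal ((norm (g x - f n x))\<^sup>2) \<partial>lborel) \<le> ennreal (\<epsilon>\<^sup>2)" .
      then have "integrable lborel (\<lambda>x. (norm (g x - f n x))\<^sup>2)"
        by (intro integrableI_bounded) (auto simp: le_less_trans[OF _ ennreal_less_top])
      then have sq: "sq_integrable (\<lambda>x. g x - f n x)" by (simp add: sq_integrable_def)
      have "ennreal (LINT x|lborel. (norm (g x - f n x))\<^sup>2) \<le> ennreal (\<epsilon>\<^sup>2)"
        using le sq by (subst nn_integral_eq_integral[symmetric]) (auto simp: sq_integrable_def)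
      with sq show ?thesis by (simp add: norm_abs_L2)
    qed
    then show ?thesis by blast
  qed
  obtain N where "sq_integrable (\<lambda>x. g x - f N x)" using *[of 1] by auto
  from sq_integrable_add[OF this f(1)[of N]] have g: "sq_integrable g" by simp
  have "X \<longlonglongrightarrow> abs_L2 g"
  proof (rule metric_LIMSEQ_I)
    fix \<epsilon> :: real assume "\<epsilon> > 0"
    then obtain N where N: "\<And>n. n \<ge> N \<Longrightarrow> (norm (abs_L2 (\<lambda>x. g x - f n x)))\<^sup>2 \<le> (\<epsilon>/2)\<^sup>2"
      using *[of "\<epsilon>/2"] by auto
    have "dist (X n) (abs_L2 g) < \<epsilon>" if "n \<ge> N" for n
    proof -
      have "norm (abs_L2 g - X n) \<le> \<epsilon>/2"
        using power2_le_imp_le[OF N[OF that]] \<open>\<epsilon> > 0\<close> by (simp add: f(2) abs_L2_algebra g f(1))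
      then show ?thesis using \<open>\<epsilon> > 0\<close> by (simp add: dist_norm norm_minus_commute)
    qed
    then show "\<exists>N. \<forall>n\<ge>N. dist (X n) (abs_L2 g) < \<epsilon>" by blast
  qed
  then show ?thesis by (rule convergentI)
qed

instance L2 :: banach
  by intro_classes (rule L2_complete)

subsection \<open>Products of scalar functions and constant spinors\<close>

definition sq_int :: "(real \<Rightarrow> real) \<Rightarrow> bool" where
  "sq_int f \<longleftrightarrow> f \<in> borel_measurable lborel \<and> integrable lborel (\<lambda>x. (f x)\<^sup>2)"

text \<open>Elementary tensors of a real scalar function and a constant spinor; test functions and
  Hermite functions enter \<open>L2\<close> in this form.\<close>

definition tensor :: "(real \<Rightarrow> real) \<Rightarrow> complex^2 \<Rightarrow> L2" where
  "tensor f a = abs_L2 (\<lambda>x. f x *\<^sub>R a)"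

lemma sq_integrable_tensor: "sq_int f \<Longrightarrow> sq_integrable (\<lambda>x. f x *\<^sub>R a)"
  by (auto simp: sq_int_def sq_integrable_def power_mult_distrib)

lemma cdot_simps:
  "cdot (r *\<^sub>R a) b = complex_of_real r * cdot a b" "cdot a (r *\<^sub>R b) = complex_of_real r * cdot a b"
  "cdot (c *s a) b = c * cdot a b"
  by (simp_all add: cdot_def sum_distrib_left 
      scaleR_conv_of_real[where 'a = complex] mult_ac)

lemma cinner_tensor:
  assumes "sq_integrable u" "sq_int f"
  shows "cinner (abs_L2 u) (tensor f a) = (LINT x|lborel. complex_of_real (f x) * cdot (u x) a)"
  unfolding tensor_def abs_L2_algebra(3)[OF assms(1) sq_integrable_tensor[OF assms(2)]]
  by (simp add: cdot_simps)

lemma sq_int_integrable_mult: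
  assumes "sq_int f" "sq_int g" shows "integrable lborel (\<lambda>x. f x * g x)"
  by (rule integrable_bound_sq[OF sq_integrable_tensor[OF assms(1), of "axis 1 1"]
        sq_integrable_tensor[OF assms(2), of "axis 1 1"]])
    (use assms in \<open>auto simp: sq_int_def norm_axis abs_mult\<close>)

lemma cinner_tensor_tensor:
  assumes "sq_int f" "sq_int g"
  shows "cinner (tensor f a) (tensor g b) = complex_of_real (LINT x|lborel. f x * g x) * cdot a b"
proof -
  have "cinner (tensor f a) (tensor g b) =
      (LINT x|lborel. complex_of_real (f x * g x) * cdot a b)"
    unfolding tensor_def[of f] cinner_tensor[OF sq_integrable_tensor[OF assms(1)] assms(2)]
    by (simp add: cdot_simps mult_ac)
  then show ?thesis by (simp only: integral_mult_left_zero integral_complex_of_real)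
qed

lemma norm_tensor:
  assumes "sq_int f"
  shows "(norm (tensor f a))\<^sup>2 = (LINT x|lborel. (f x)\<^sup>2) * (norm a)\<^sup>2"
  unfolding tensor_def norm_abs_L2[OF sq_integrable_tensor[OF assms]]
  by (simp add: power_mult_distrib)

lemma scaleR_smult_commute: "c *s (r *\<^sub>R a) = r *\<^sub>R (c *s (a::complex^2))"
  by (simp add: vec_eq_iff)

lemma matrix_vector_mult_scaleR_complex: "A *v (r *\<^sub>R a) = r *\<^sub>R ((A::complex^2^2) *v a)"
  by (rule linear_scale[OF bounded_linear.linear[OF bounded_linear_matrix_vector_mult]])

lemma tensor_add_right: "sq_int f \<Longrightarrow> tensor f (a + b) = tensor f a + tensor f b"
  and tensor_scaleC: "sq_int f \<Longrightarrow> tensor f (c *s a) = c *\<^sub>C tensor f a"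
  and tensor_matrix: "sq_int f \<Longrightarrow> matrix_L2 A (tensor f a) = tensor f (A *v a)"
  and tensor_scaleR_left: "sq_int f \<Longrightarrow> tensor (\<lambda>x. r * f x) a = r *\<^sub>R tensor f a"
  and tensor_add_left:
    "sq_int f \<Longrightarrow> sq_int g \<Longrightarrow> tensor (\<lambda>x. f x + g x) a = tensor f a + tensor g a"
  and tensor_diff_left:
    "sq_int f \<Longrightarrow> sq_int g \<Longrightarrow> tensor (\<lambda>x. f x - g x) a = tensor f a - tensor g a"
  using sq_integrable_tensor[of f] sq_integrable_tensor[of g]
  by (simp_all add: tensor_def abs_L2_algebra abs_L2_unary scaleR_smult_commute scaleR_add_right
      scaleR_left_distrib scaleR_left_diff_distrib matrix_vector_mult_scaleR_complex)

section \<open>Weak derivatives, multiplication by the coordinate, matrices and translations\<close>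

lemma integral_derivative_eq_0:
  fixes F :: "real \<Rightarrow> 'a::euclidean_space"
  assumes "\<And>x. (F has_vector_derivative f x) (at x)" "\<And>x. isCont f x" "integrable lborel f"
    and "(F \<longlongrightarrow> 0) at_top" "(F \<longlongrightarrow> 0) at_bot"
  shows "(LINT x|lborel. f x) = 0"
proof -
  have "(LBINT x=-\<infinity>..\<infinity>. f x) = 0 - 0"
  proof (rule interval_integral_FTC_integrable)
    show "((F \<circ> real_of_ereal) \<longlongrightarrow> 0) (at_right (- \<infinity>))"
      using assms(5) by (simp add: at_right_MInf filterlim_filtermap)
    show "((F \<circ> real_of_ereal) \<longlongrightarrow> 0) (at_left \<infinity>)"
      using assms(4) by (simp add: at_left_PInf filterlim_filtermap)
    show "set_integrable lborel (einterval (- \<infinity>) \<infinity>) f"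
      using assms(3) by (simp add: set_integrable_def)
  qed (use assms in auto)
  then show ?thesis
    by (simp add: interval_lebesgue_integral_def set_lebesgue_integral_def)
qed

lemma sq_intI_compact:
  assumes "continuous_on UNIV f" "compact K" "\<And>x. x \<notin> K \<Longrightarrow> f x = 0"
  shows "sq_int f"
proof -
  have "integrable lborel (\<lambda>x. indicator K x *\<^sub>R (f x)\<^sup>2)"
    by (rule borel_integrable_compact[OF assms(2) continuous_on_power[OF continuous_on_subset[OF assms(1)]]])
      simp
  moreover have "(\<lambda>x. indicator K x *\<^sub>R (f x)\<^sup>2) = (\<lambda>x. (f x)\<^sup>2)"
    using assms(3) by (auto simp: fun_eq_iff indicator_def)
  ultimately show ?thesis
    using borel_measurable_continuous_onI[OF assms(1)] by (simp add: sq_int_def)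
qed

lemma test_function_sq_int:
  assumes "test_function \<phi>"
  shows "sq_int \<phi>" "sq_int (deriv \<phi>)" "\<exists>r. \<forall>x. \<bar>x\<bar> > r \<longrightarrow> \<phi> x = 0"
proof -
  let ?K = "closure {x. \<phi> x \<noteq> 0}"
  have s: "smooth \<phi>" and K: "compact ?K" using assms by (simp_all add: test_function_alt)
  have 0: "\<phi> x = 0" if "x \<notin> ?K" for x using that closure_subset[of "{x. \<phi> x \<noteq> 0}"] by blast
  show "sq_int \<phi>" by (rule sq_intI_compact[OF smooth_continuous_on[OF s] K 0])
  have "deriv \<phi> x = 0" if "x \<notin> ?K" for x
  proof -
    have "\<forall>\<^sub>F y in nhds x. \<phi> y = 0"
      using that by (intro eventually_mono[OF eventually_nhds_in_open[of "- ?K"]]) (auto intro!: 0)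
    then have "deriv \<phi> x = deriv (\<lambda>_. 0) x" by (intro deriv_cong_ev) auto
    then show ?thesis by simp
  qed
  then show "sq_int (deriv \<phi>)"
    by (rule sq_intI_compact[OF smooth_continuous_on[OF smooth_deriv[OF s]] K])
  obtain r where r: "\<And>x. x \<in> ?K \<Longrightarrow> \<bar>x\<bar> \<le> r"
    using compact_imp_bounded[OF K] by (auto simp: bounded_iff)
  have "\<phi> x = 0" if "\<bar>x\<bar> > r" for x
    using 0[of x] r[of x] that by linarith
  then show "\<exists>r. \<forall>x. \<bar>x\<bar> > r \<longrightarrow> \<phi> x = 0" by blast
qed

lemma bounded_linear_cdot_left: "bounded_linear (\<lambda>v. cdot v a)"
  by (rule bounded_linear_intro[where K = "norm a"])
    (auto simp: norm_cdot_le cdot_simps scaleR_conv_of_real[where 'a = complex],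
      simp add: cdot_def distrib_right sum.distrib)

lemma cdot_eqI:
  assumes "\<And>a. cdot v a = cdot w a" shows "v = w"
proof -
  have "cdot v (axis i 1) = v $ i" for v i
    by (simp add: cdot_def axis_def if_distrib[of cnj] if_distrib[of "\<lambda>x. _ * x"] cong: if_cong)
  then show ?thesis using assms by (metis vec_eq_iff)
qed

lemma cdot_eq_iff: "v = w \<longleftrightarrow> (\<forall>a. cdot v a = cdot w a)"
  using cdot_eqI by blast

lemma cinner_tensor_eq_cdot:
  assumes "sq_integrable f" "sq_int \<phi>"
  shows "cinner (abs_L2 f) (tensor \<phi> a) = cdot (LINT x|lborel. \<phi> x *\<^sub>R f x) a"
proof -
  have "integrable lborel (\<lambda>x. \<phi> x *\<^sub>R f x)"
    by (rule integrable_bound_sq[OF sq_integrable_tensor[OF assms(2), of "axis 1 1"] assms(1)])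
      (use assms in \<open>auto simp: sq_int_def sq_integrable_def norm_axis\<close>)
  from integral_bounded_linear[OF bounded_linear_cdot_left this, of a] show ?thesis
    by (simp add: cinner_tensor[OF assms] cdot_simps)
qed

text \<open>Pairing the vector identity with every constant spinor \<open>a\<close> turns it into
  scalar identities for \<open>cinner\<close>; linearity and closedness of the weak derivative are
  then those of the inner product.\<close>

lemma weak_derivative_iff:
  "weak_derivative u v \<longleftrightarrow> (\<forall>\<phi> a. test_function \<phi> \<longrightarrow>
     cinner u (tensor (deriv \<phi>) a) = - cinner v (tensor \<phi> a))"
proof -
  obtain f where f: "sq_integrable f" "u = abs_L2 f" by (rule L2_cases)
  obtain g where g: "sq_integrable g" "v = abs_L2 g" by (rule L2_cases)
  have m: "- cdot v a = cdot (- v) a" for v a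
    by (simp add: cdot_def sum_negf)
  have "weak_derivative u v \<longleftrightarrow> (\<forall>\<phi>. test_function \<phi> \<longrightarrow>
      (LINT x|lborel. deriv \<phi> x *\<^sub>R f x) = - (LINT x|lborel. \<phi> x *\<^sub>R g x))"
    using L2_eq_refl[OF f(1)] L2_eq_refl[OF g(1)] by (simp add: f(2) g(2) weak_derivative.abs_eq)
  also have "\<dots> \<longleftrightarrow> (\<forall>\<phi>. test_function \<phi> \<longrightarrow> (\<forall>a.
      cdot (LINT x|lborel. deriv \<phi> x *\<^sub>R f x) a = - cdot (LINT x|lborel. \<phi> x *\<^sub>R g x) a))"
    unfolding m cdot_eq_iff[symmetric] ..
  also have "\<dots> \<longleftrightarrow> (\<forall>\<phi> a. test_function \<phi> \<longrightarrow>
     cinner u (tensor (deriv \<phi>) a) = - cinner v (tensor \<phi> a))"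
    unfolding f(2) g(2)
    using cinner_tensor_eq_cdot[OF f(1)] cinner_tensor_eq_cdot[OF g(1)] test_function_sq_int by auto
  finally show ?thesis .
qed

lemma weak_derivative_add:
  "weak_derivative u v \<Longrightarrow> weak_derivative u' v' \<Longrightarrow> weak_derivative (u + u') (v + v')"
  by (simp add: weak_derivative_iff cinner_simps)

lemma weak_derivative_scaleC: "weak_derivative u v \<Longrightarrow> weak_derivative (c *\<^sub>C u) (c *\<^sub>C v)"
  by (simp add: weak_derivative_iff cinner_simps)

lemma weak_derivative_LIMSEQ:
  assumes "\<And>n. weak_derivative (U n) (V n)" "U \<longlonglongrightarrow> u" "V \<longlonglongrightarrow> v"
  shows "weak_derivative u v"
  unfolding weak_derivative_iff
proof (intro allI impI)
  fix \<phi> a assume \<phi>: "test_function \<phi>"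
  show "cinner u (tensor (deriv \<phi>) a) = - cinner v (tensor \<phi> a)"
  proof (rule LIMSEQ_unique)
    show "(\<lambda>n. cinner (U n) (tensor (deriv \<phi>) a)) \<longlonglongrightarrow> cinner u (tensor (deriv \<phi>) a)"
      by (intro tendsto_cinner assms tendsto_const)
    have "(\<lambda>n. - cinner (V n) (tensor \<phi> a)) \<longlonglongrightarrow> - cinner v (tensor \<phi> a)"
      by (intro tendsto_minus tendsto_cinner assms tendsto_const)
    then show "(\<lambda>n. cinner (U n) (tensor (deriv \<phi>) a)) \<longlonglongrightarrow> - cinner v (tensor \<phi> a)"
      using assms(1) \<phi> by (simp add: weak_derivative_iff)
  qed
qed

text \<open>Dominated convergence for the squared difference; both functions are bounded by
  \<open>h\<close>, whence the majorant 4 h^2.\<close>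

lemma tensor_LIMSEQ:
  assumes h: "sq_int h" and f: "f \<in> borel_measurable lborel"
    and g: "\<And>k. g k \<in> borel_measurable lborel"
    and le: "\<And>k x. \<bar>g k x\<bar> \<le> h x" and lim: "\<And>x. (\<lambda>k. g k x) \<longlonglongrightarrow> f x"
  shows "(\<lambda>k. tensor (g k) a) \<longlonglongrightarrow> tensor f a"
proof -
  have le': "\<bar>f x\<bar> \<le> h x" for x
    by (rule LIMSEQ_le_const2[OF tendsto_rabs[OF lim]]) (use le in auto)
  have h0: "h x \<ge> 0" for x using le'[of x] by linarith
  have bd: "sq_int q" if "q \<in> borel_measurable lborel" "\<And>x. \<bar>q x\<bar> \<le> h x" for q
  proof -
    have "(q x)\<^sup>2 \<le> (h x)\<^sup>2" for x using that(2)[of x] h0[of x] by (simp add: abs_le_square_iff[symmetric])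
    then have "integrable lborel (\<lambda>x. (q x)\<^sup>2)"
      using h that(1) by (intro Bochner_Integration.integrable_bound[where g = "\<lambda>x. (q x)\<^sup>2"
            and f = "\<lambda>x. (h x)\<^sup>2"]) (auto simp: sq_int_def)
    with that(1) show ?thesis by (simp add: sq_int_def)
  qed
  have F: "sq_int f" and G: "\<And>k. sq_int (g k)" using bd f g le le' by auto
  have "(\<lambda>k. LINT x|lborel. (g k x - f x)\<^sup>2) \<longlonglongrightarrow> (LINT x|(lborel :: real measure). 0)"
  proof (rule integral_dominated_convergence[where w = "\<lambda>x. 4 * (h x)\<^sup>2"])
    show "AE x in lborel. (\<lambda>k. (g k x - f x)\<^sup>2) \<longlonglongrightarrow> 0"
    proof (rule AE_I2)
      fix x
      have "(\<lambda>k. (g k x - f x)\<^sup>2) \<longlonglongrightarrow> (f x - f x)\<^sup>2" by (intro tendsto_intros lim)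
      then show "(\<lambda>k. (g k x - f x)\<^sup>2) \<longlonglongrightarrow> 0" by simp
    qed
    show "AE x in lborel. norm ((g k x - f x)\<^sup>2) \<le> 4 * (h x)\<^sup>2" for k
    proof (rule AE_I2)
      fix x
      have "\<bar>g k x - f x\<bar> \<le> \<bar>2 * h x\<bar>" using le[of k x] le'[of x] by linarith
      from abs_le_square_iff[THEN iffD1, OF this]
      show "norm ((g k x - f x)\<^sup>2) \<le> 4 * (h x)\<^sup>2" by (simp add: power_mult_distrib)
    qed
  qed (use h f g in \<open>auto simp: sq_int_def\<close>)
  then have "(\<lambda>k. (LINT x|lborel. (g k x - f x)\<^sup>2) * (norm a)\<^sup>2) \<longlonglongrightarrow> 0 * (norm a)\<^sup>2"
    by (intro tendsto_mult tendsto_const) simp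
  moreover have "(norm (tensor (g k) a - tensor f a))\<^sup>2 =
      (LINT x|lborel. (g k x - f x)\<^sup>2) * (norm a)\<^sup>2" for k
  proof -
    have "integrable lborel (\<lambda>x. (g k x - f x)\<^sup>2)"
    proof (rule Bochner_Integration.integrable_bound[where f = "\<lambda>x. 4 * (h x)\<^sup>2"])
      have "norm ((g k x - f x)\<^sup>2) \<le> norm (4 * (h x)\<^sup>2)" for x
      proof -
        have "\<bar>g k x - f x\<bar> \<le> \<bar>2 * h x\<bar>" using le[of k x] le'[of x] by linarith
        from abs_le_square_iff[THEN iffD1, OF this] show ?thesis by (simp add: power_mult_distrib)
      qed
      then show "AE x in lborel. norm ((g k x - f x)\<^sup>2) \<le> norm (4 * (h x)\<^sup>2)" by simp
    qed (use h f g in \<open>auto simp: sq_int_def\<close>)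
    then have "sq_int (\<lambda>x. g k x - f x)" using f g by (simp add: sq_int_def)
    then show ?thesis using norm_tensor by (simp add: tensor_diff_left[OF G F, symmetric])
  qed
  ultimately have "(\<lambda>k. (norm (tensor (g k) a - tensor f a))\<^sup>2) \<longlonglongrightarrow> 0" by simp
  from tendsto_real_sqrt[OF this] show ?thesis
    by (simp add: tendsto_norm_zero_iff LIM_zero_iff)
qed

lemma sq_int_abs_add:
  assumes "sq_int f" "sq_int g" shows "sq_int (\<lambda>x. M * (\<bar>f x\<bar> + \<bar>g x\<bar>))"
proof -
  have "sq_integrable (\<lambda>x. (M * (\<bar>f x\<bar> + \<bar>g x\<bar>)) *\<^sub>R axis 1 1)"
    using assms
    by (intro sq_integrable_bound[OF sq_integrable_tensor[OF assms(1), of "axis 1 1"]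
          sq_integrable_tensor[OF assms(2), of "axis 1 1"], of _ "\<bar>M\<bar>"])
      (auto simp: sq_int_def norm_axis abs_mult)
  moreover have "(\<lambda>x. M * (\<bar>f x\<bar> + \<bar>g x\<bar>)) \<in> borel_measurable lborel"
    using assms by (auto simp: sq_int_def)
  ultimately show ?thesis
    by (simp add: sq_int_def sq_integrable_def norm_axis power_mult_distrib)
qed

lemma smooth_measurable: "smooth f \<Longrightarrow> f \<in> borel_measurable lborel"
  using borel_measurable_continuous_onI[OF smooth_continuous_on] by simp

lemma test_function_smooth: "test_function f \<Longrightarrow> smooth f"
  by (simp add: test_function_alt)

text \<open>Cutoffs enlarge the admissible test functions to smooth square-integrable ones with
  square-integrable derivative, in particular to Hermite functions.\<close>

lemma weak_derivative_smooth:
  assumes "weak_derivative u v" "smooth f" "sq_int f" "sq_int (deriv f)"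
  shows "cinner u (tensor (deriv f) a) = - cinner v (tensor f a)"
proof -
  obtain M where M: "\<And>k x. \<bar>cutoff k f x\<bar> \<le> M * (\<bar>f x\<bar> + \<bar>deriv f x\<bar>)"
    "\<And>k x. \<bar>deriv (cutoff k f) x\<bar> \<le> M * (\<bar>f x\<bar> + \<bar>deriv f x\<bar>)"
    using cutoff_bounded assms(2) by blast
  note h = sq_int_abs_add[OF assms(3,4), of M]
  note t = test_function_cutoff[OF assms(2), THEN test_function_smooth]
  have 1: "(\<lambda>k. tensor (cutoff k f) a) \<longlonglongrightarrow> tensor f a"
    by (rule tensor_LIMSEQ[OF h _ _ M(1) cutoff_LIMSEQ(1)[OF assms(2)]])
      (intro smooth_measurable assms t)+
  have 2: "(\<lambda>k. tensor (deriv (cutoff k f)) a) \<longlonglongrightarrow> tensor (deriv f) a"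
    by (rule tensor_LIMSEQ[OF h _ _ M(2) cutoff_LIMSEQ(2)[OF assms(2)]])
      (intro smooth_measurable smooth_deriv assms t)+
  show ?thesis
  proof (rule LIMSEQ_unique)
    show "(\<lambda>k. cinner u (tensor (deriv (cutoff k f)) a)) \<longlonglongrightarrow> cinner u (tensor (deriv f) a)"
      by (intro tendsto_cinner tendsto_const 2)
    have "(\<lambda>k. - cinner v (tensor (cutoff k f) a)) \<longlonglongrightarrow> - cinner v (tensor f a)"
      by (intro tendsto_minus tendsto_cinner tendsto_const 1)
    then show "(\<lambda>k. cinner u (tensor (deriv (cutoff k f)) a)) \<longlonglongrightarrow> - cinner v (tensor f a)"
      using assms(1) test_function_cutoff[OF assms(2)] by (simp add: weak_derivative_iff)
  qed
qed

text \<open>Classical integration by parts; the boundary terms vanish because \<phi> has compact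
  support.\<close>

lemma weak_derivative_tensor:
  assumes "smooth f" "sq_int f" "sq_int (deriv f)"
  shows "weak_derivative (tensor f a) (tensor (deriv f) a)"
  unfolding weak_derivative_iff
proof (intro allI impI)
  fix \<phi> b assume \<phi>: "test_function \<phi>"
  note s = test_function_smooth[OF \<phi>] and q = test_function_sq_int[OF \<phi>]
  obtain r where r: "\<And>x. \<bar>x\<bar> > r \<Longrightarrow> \<phi> x = 0" using q(3) by blast
  have i: "integrable lborel (\<lambda>x. f x * deriv \<phi> x)" "integrable lborel (\<lambda>x. deriv f x * \<phi> x)"
    by (intro sq_int_integrable_mult assms q)+
  have "(LINT x|lborel. f x * deriv \<phi> x + deriv f x * \<phi> x) = 0"
  proof (rule integral_derivative_eq_0[where F = "\<lambda>x. f x * \<phi> x"])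
    show "((\<lambda>x. f x * \<phi> x) has_vector_derivative f x * deriv \<phi> x + deriv f x * \<phi> x) (at x)" for x
      unfolding has_real_derivative_iff_has_vector_derivative[symmetric]
      by (auto intro!: derivative_eq_intros smooth_DERIV assms s)
    show "isCont (\<lambda>x. f x * deriv \<phi> x + deriv f x * \<phi> x) x" for x
      by (intro continuous_intros smooth_isCont smooth_deriv assms s)
    show "((\<lambda>x. f x * \<phi> x) \<longlongrightarrow> 0) at_top"
      by (rule tendsto_eventually, rule eventually_mono[OF eventually_gt_at_top[of "\<bar>r\<bar>"]])
        (use r in auto)
    show "((\<lambda>x. f x * \<phi> x) \<longlongrightarrow> 0) at_bot"
      by (rule tendsto_eventually, rule eventually_mono[OF eventually_gt_at_bot[of "-\<bar>r\<bar>"]])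
        (use r in auto)
  qed (use i in auto)
  then have *: "(LINT x|lborel. f x * deriv \<phi> x) = - (LINT x|lborel. deriv f x * \<phi> x)"
    using i by (simp add: eq_neg_iff_add_eq_0)
  show "cinner (tensor f a) (tensor (deriv \<phi>) b) = - cinner (tensor (deriv f) a) (tensor \<phi> b)"
    by (simp add: cinner_tensor_tensor assms q *)
qed

subsection \<open>Multiplication by the coordinate\<close>

lemma mult_x_abs:
  assumes "sq_integrable f" "sq_integrable (\<lambda>x. x *\<^sub>R f x)"
  shows "in_Dom_x (abs_L2 f)" "mult_x (abs_L2 f) = abs_L2 (\<lambda>x. x *\<^sub>R f x)"
  using assms L2_eq_refl[OF assms(1)] by (simp_all add: in_Dom_x.abs_eq mult_x.abs_eq)

lemma in_Dom_x_cases: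
  assumes "in_Dom_x u"
  obtains f where "sq_integrable f" "sq_integrable (\<lambda>x. x *\<^sub>R f x)" "u = abs_L2 f"
    "mult_x u = abs_L2 (\<lambda>x. x *\<^sub>R f x)"
proof -
  obtain f where f: "sq_integrable f" "u = abs_L2 f" by (rule L2_cases)
  then have "sq_integrable (\<lambda>x. x *\<^sub>R f x)"
    using assms L2_eq_refl[OF f(1)] by (simp add: in_Dom_x.abs_eq)
  with f mult_x_abs[OF f(1) this] that show ?thesis by blast
qed

lemma mult_x_add:
  assumes "in_Dom_x u" "in_Dom_x v"
  shows "in_Dom_x (u + v)" "mult_x (u + v) = mult_x u + mult_x v"
proof -
  obtain f where f: "sq_integrable f" "sq_integrable (\<lambda>x. x *\<^sub>R f x)" "u = abs_L2 f"
    "mult_x u = abs_L2 (\<lambda>x. x *\<^sub>R f x)" using assms(1) by (rule in_Dom_x_cases)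
  obtain g where g: "sq_integrable g" "sq_integrable (\<lambda>x. x *\<^sub>R g x)" "v = abs_L2 g"
    "mult_x v = abs_L2 (\<lambda>x. x *\<^sub>R g x)" using assms(2) by (rule in_Dom_x_cases)
  have "sq_integrable (\<lambda>x. x *\<^sub>R (f x + g x))"
    using sq_integrable_add[OF f(2) g(2)] by (simp add: scaleR_add_right)
  from mult_x_abs[OF sq_integrable_add[OF f(1) g(1)] this]
  show "in_Dom_x (u + v)" "mult_x (u + v) = mult_x u + mult_x v"
    using f g by (simp_all add: abs_L2_algebra scaleR_add_right)
qed

lemma mult_x_scaleC:
  assumes "in_Dom_x u"
  shows "in_Dom_x (c *\<^sub>C u)" "mult_x (c *\<^sub>C u) = c *\<^sub>C mult_x u"
proof -
  obtain f where f: "sq_integrable f" "sq_integrable (\<lambda>x. x *\<^sub>R f x)" "u = abs_L2 f"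
    "mult_x u = abs_L2 (\<lambda>x. x *\<^sub>R f x)" using assms(1) by (rule in_Dom_x_cases)
  have c: "sq_integrable (\<lambda>x. c *s f x)" "sq_integrable (\<lambda>x. x *\<^sub>R (c *s f x))"
    using f(1,2)[THEN sq_integrable_bounded_linear[OF bounded_linear_vector_scalar_mult], of c]
    by (simp_all add: scaleR_smult_commute)
  from mult_x_abs[OF this] show "in_Dom_x (c *\<^sub>C u)" "mult_x (c *\<^sub>C u) = c *\<^sub>C mult_x u"
    using f by (simp_all add: abs_L2_unary scaleR_smult_commute)
qed

lemma mult_x_tensor:
  assumes "sq_int f" "sq_int (\<lambda>x. x * f x)"
  shows "in_Dom_x (tensor f a)" "mult_x (tensor f a) = tensor (\<lambda>x. x * f x) a"
  using mult_x_abs[of "\<lambda>x. f x *\<^sub>R a"] sq_integrable_tensor[OF assms(1), of a]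
    sq_integrable_tensor[OF assms(2), of a]
  by (simp_all add: tensor_def)

lemma cinner_mult_x_tensor:
  assumes "in_Dom_x u" "sq_int f" "sq_int (\<lambda>x. x * f x)"
  shows "cinner (mult_x u) (tensor f a) = cinner u (tensor (\<lambda>x. x * f x) a)"
proof -
  obtain g where g: "sq_integrable g" "sq_integrable (\<lambda>x. x *\<^sub>R g x)" "u = abs_L2 g"
    "mult_x u = abs_L2 (\<lambda>x. x *\<^sub>R g x)" using assms(1) by (rule in_Dom_x_cases)
  show ?thesis
    unfolding g(4) unfolding g(3) cinner_tensor[OF g(2) assms(2)] cinner_tensor[OF g(1) assms(3)]
    by (simp add: cdot_simps mult_ac)
qed

text \<open>The weight \<open>1 / (1 + \<bar>x\<bar>)\<close> turns multiplication by \<open>x\<close> into a bounded operator.\<close>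

lemma mult_x_LIMSEQ:
  assumes "\<And>n. in_Dom_x (U n)" "U \<longlonglongrightarrow> u" "(\<lambda>n. mult_x (U n)) \<longlonglongrightarrow> v"
  shows "in_Dom_x u" "mult_x u = v"
proof -
  obtain f where f: "sq_integrable f" "u = abs_L2 f" by (rule L2_cases)
  obtain g where g: "sq_integrable g" "v = abs_L2 g" by (rule L2_cases)
  note [measurable] = f(1)[THEN sq_integrable_measurable] g(1)[THEN sq_integrable_measurable]
  define h where "h x = (1 / (1 + \<bar>x\<bar>)) *\<^sub>R (g x - x *\<^sub>R f x)" for x
  have h_meas: "h \<in> borel_measurable lborel" unfolding h_def by measurable
  have h: "sq_integrable h \<and>
      (norm (abs_L2 h))\<^sup>2 \<le> 2 * ((norm (v - mult_x (U n)))\<^sup>2 + (norm (U n - u))\<^sup>2)" for n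
  proof -
    obtain p where p: "sq_integrable p" "sq_integrable (\<lambda>x. x *\<^sub>R p x)" "U n = abs_L2 p"
      "mult_x (U n) = abs_L2 (\<lambda>x. x *\<^sub>R p x)" using assms(1) by (rule in_Dom_x_cases)
    have "norm (h x) \<le> norm (g x - x *\<^sub>R p x) + norm (p x - f x)" for x
    proof -
      have "h x = (1 / (1 + \<bar>x\<bar>)) *\<^sub>R (g x - x *\<^sub>R p x) + (x / (1 + \<bar>x\<bar>)) *\<^sub>R (p x - f x)"
        by (simp add: h_def algebra_simps)
      then have "norm (h x) \<le> \<bar>1 / (1 + \<bar>x\<bar>)\<bar> * norm (g x - x *\<^sub>R p x) +
          \<bar>x / (1 + \<bar>x\<bar>)\<bar> * norm (p x - f x)"
        by (metis norm_scaleR norm_triangle_ineq)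
      also have "\<dots> \<le> 1 * norm (g x - x *\<^sub>R p x) + 1 * norm (p x - f x)"
        by (intro add_mono mult_right_mono) (auto simp: abs_divide divide_le_eq)
      finally show ?thesis by simp
    qed
    from norm_abs_L2_le[OF sq_integrable_diff[OF g(1) p(2)] sq_integrable_diff[OF p(1) f(1)]
        h_meas this]
    show ?thesis unfolding p(4) unfolding p(3) by (simp add: f g p(1,2) abs_L2_algebra)
  qed
  \<comment> \<open>\<open>h\<close> does not depend on \<open>n\<close> while its bound tends to 0,
    so \<open>h\<close> vanishes almost everywhere.\<close>
  have "(\<lambda>n. 2 * ((norm (v - mult_x (U n)))\<^sup>2 + (norm (U n - u))\<^sup>2)) \<longlonglongrightarrow>
      2 * ((norm (v - v))\<^sup>2 + (norm (u - u))\<^sup>2)"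
    by (intro tendsto_intros assms)
  then have "(norm (abs_L2 h))\<^sup>2 \<le> 2 * ((norm (v - v))\<^sup>2 + (norm (u - u))\<^sup>2)"
    by (rule LIMSEQ_le_const) (use h in auto)
  then have "(norm (abs_L2 h))\<^sup>2 = 0" by simp
  then have "(LINT x|lborel. (norm (h x))\<^sup>2) = 0"
    by (metis norm_abs_L2 h)
  then have "AE x in lborel. (norm (h x))\<^sup>2 = 0"
    using h by (subst (asm) integral_nonneg_eq_0_iff_AE) (auto simp: sq_integrable_def)
  then have ae: "AE x in lborel. g x = x *\<^sub>R f x"
    by eventually_elim (auto simp: h_def add_nonneg_eq_0_iff)
  have "integrable lborel (\<lambda>x. (norm (x *\<^sub>R f x))\<^sup>2)"
    using g(1) ae by (subst integrable_cong_AE[where g = "\<lambda>x. (norm (g x))\<^sup>2"])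
      (auto simp: sq_integrable_def)
  then have x: "sq_integrable (\<lambda>x. x *\<^sub>R f x)" by (simp add: sq_integrable_def)
  show "in_Dom_x u" using mult_x_abs[OF f(1) x] f(2) by simp
  show "mult_x u = v"
    using mult_x_abs[OF f(1) x] f(2) g abs_L2_eq_iff[OF g(1) x] ae by simp
qed

subsection \<open>Matrices\<close>

lemma matrix_L2_add: "matrix_L2 A (u + v) = matrix_L2 A u + matrix_L2 A v"
proof -
  obtain f where f: "sq_integrable f" "u = abs_L2 f" by (rule L2_cases)
  obtain g where g: "sq_integrable g" "v = abs_L2 g" by (rule L2_cases)
  show ?thesis
    using f(1) g(1) sq_integrable_add[OF f(1) g(1)]
      sq_integrable_bounded_linear[OF bounded_linear_matrix_vector_mult f(1), of A]
      sq_integrable_bounded_linear[OF bounded_linear_matrix_vector_mult g(1), of A]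
    by (simp add: f(2) g(2) abs_L2_algebra abs_L2_unary matrix_vector_right_distrib)
qed

lemma matrix_L2_scaleC: "matrix_L2 A (c *\<^sub>C u) = c *\<^sub>C matrix_L2 A u"
proof -
  obtain f where f: "sq_integrable f" "u = abs_L2 f" by (rule L2_cases)
  have c: "A *v (c *s a) = c *s (A *v a)" for a :: "complex^2"
    by (simp add: vec_eq_iff matrix_vector_mult_def sum_distrib_left mult_ac)
  show ?thesis
    using f(1) sq_integrable_bounded_linear[OF bounded_linear_matrix_vector_mult f(1), of A]
      sq_integrable_bounded_linear[OF bounded_linear_vector_scalar_mult f(1), of c]
    by (simp add: f(2) abs_L2_unary c)
qed

lemma matrix_L2_mult: "matrix_L2 A (matrix_L2 B u) = matrix_L2 (A ** B) u"
proof -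
  obtain f where f: "sq_integrable f" "u = abs_L2 f" by (rule L2_cases)
  show ?thesis
    using f(1) sq_integrable_bounded_linear[OF bounded_linear_matrix_vector_mult f(1), of B]
    by (simp add: f(2) abs_L2_unary matrix_vector_mul_assoc)
qed

lemma cinner_matrix_L2:
  assumes "\<And>a b. cdot (A *v a) b = cdot a (A *v b)"
  shows "cinner (matrix_L2 A u) v = cinner u (matrix_L2 A v)"
proof -
  obtain f where f: "sq_integrable f" "u = abs_L2 f" by (rule L2_cases)
  obtain g where g: "sq_integrable g" "v = abs_L2 g" by (rule L2_cases)
  show ?thesis
    using f(1) g(1) sq_integrable_bounded_linear[OF bounded_linear_matrix_vector_mult f(1), of A]
      sq_integrable_bounded_linear[OF bounded_linear_matrix_vector_mult g(1), of A]
    by (simp add: f(2) g(2) abs_L2_algebra abs_L2_unary assms)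
qed

lemma matrix_L2_mat_1: "matrix_L2 (mat 1) u = u"
proof -
  obtain f where f: "sq_integrable f" "u = abs_L2 f" by (rule L2_cases)
  then show ?thesis by (simp add: abs_L2_unary)
qed

lemma matrix_L2_uminus: "matrix_L2 (- A) u = - matrix_L2 A u"
proof -
  obtain f where f: "sq_integrable f" "u = abs_L2 f" by (rule L2_cases)
  have "(- A) *v a = (-1) *s (A *v a)" for a
    by (simp add: vec_eq_iff matrix_vector_mult_def sum_negf)
  moreover have "- matrix_L2 A u = (-1) *\<^sub>C matrix_L2 A u" by (simp add: scaleC_minus_left)
  ultimately show ?thesis
    using f(1) sq_integrable_bounded_linear[OF bounded_linear_matrix_vector_mult f(1), of A]
    by (simp add: f(2) abs_L2_unary)
qed

lemma sigma1_mult: "sigma1 *v a = vector [a $ 2, a $ 1]"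
  and sigma3_mult: "sigma3 *v a = vector [a $ 1, - a $ 2]"
  by (simp_all add: vec_eq_iff forall_2 matrix_vector_mult_def sum_2 sigma1_def sigma3_def)

lemma cdot_2: "cdot a b = a $ 1 * cnj (b $ 1) + a $ 2 * cnj (b $ 2)"
  by (simp add: cdot_def sum_2)

abbreviation S1 :: "L2 \<Rightarrow> L2" where "S1 \<equiv> matrix_L2 sigma1"
abbreviation S3 :: "L2 \<Rightarrow> L2" where "S3 \<equiv> matrix_L2 sigma3"

lemma cinner_S1: "cinner (S1 u) v = cinner u (S1 v)"
  and cinner_S3: "cinner (S3 u) v = cinner u (S3 v)"
  by (rule cinner_matrix_L2, simp add: sigma1_mult sigma3_mult cdot_2)+

lemma S1_S1 [simp]: "S1 (S1 u) = u"
  and S3_S3 [simp]: "S3 (S3 u) = u"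
  and S1_S3: "S1 (S3 u) = - S3 (S1 u)"
proof -
  have "sigma1 ** sigma1 = mat 1" "sigma3 ** sigma3 = mat 1" "sigma1 ** sigma3 = - (sigma3 ** sigma1)"
    by (simp_all add: vec_eq_iff forall_2 matrix_matrix_mult_def sum_2 sigma1_def sigma3_def mat_def)
  then show "S1 (S1 u) = u" "S3 (S3 u) = u" "S1 (S3 u) = - S3 (S1 u)"
    by (simp_all add: matrix_L2_mult matrix_L2_mat_1 matrix_L2_uminus)
qed

lemma norm_S1 [simp]: "norm (S1 u) = norm u"
  and norm_S3 [simp]: "norm (S3 u) = norm u"
proof -
  have "cinner (S1 u) (S1 u) = cinner u u" "cinner (S3 u) (S3 u) = cinner u u"
    by (simp_all add: cinner_S1 cinner_S3)
  then show "norm (S1 u) = norm u" "norm (S3 u) = norm u"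
    unfolding cinner_self of_real_eq_iff by simp_all
qed

lemma bounded_linear_matrix_L2:
  "bounded_linear S1" "bounded_linear S3"
  by (rule bounded_linear_intro[where K = 1];
      simp add: matrix_L2_add scaleR_scaleC matrix_L2_scaleC)+

subsection \<open>Translations\<close>

lemma sq_integrable_translate: "sq_integrable f \<Longrightarrow> sq_integrable (\<lambda>x. f (x - b))"
  using lborel_integrable_real_affine[of "\<lambda>x. (norm (f x))\<^sup>2" 1 "-b"]
    measurable_compose[of "\<lambda>x. x - b" borel borel f borel]
  by (simp add: sq_integrable_def)

lemma integral_translate:
  fixes f :: "real \<Rightarrow> 'a::{banach, second_countable_topology}"
  shows "(LINT x|lborel. f (x - b)) = (LINT x|lborel. f x)"
  using lborel_integral_real_affine[of 1 f "-b"] by simp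

lift_definition translate :: "real \<Rightarrow> L2 \<Rightarrow> L2" is "\<lambda>b f x. f (x - b)"
proof -
  fix b and f g :: "real \<Rightarrow> complex^2" assume *: "L2_eq f g"
  then have [measurable]: "f \<in> borel_measurable lborel" "g \<in> borel_measurable lborel"
    by (simp_all add: L2_eq_def sq_integrable_def)
  have "AE x in lborel. f (-b + 1 * x) = g (-b + 1 * x)"
    using * by (intro AE_borel_affine) (auto simp: L2_eq_def)
  with * show "L2_eq (\<lambda>x. f (x - b)) (\<lambda>x. g (x - b))"
    by (simp add: L2_eq_def sq_integrable_translate)
qed

lemma translate_abs: "sq_integrable f \<Longrightarrow> translate b (abs_L2 f) = abs_L2 (\<lambda>x. f (x - b))"
  by (simp add: translate.abs_eq L2_eq_refl)

lemma translate_add: "translate b (u + v) = translate b u + translate b v"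
proof -
  obtain f where f: "sq_integrable f" "u = abs_L2 f" by (rule L2_cases)
  obtain g where g: "sq_integrable g" "v = abs_L2 g" by (rule L2_cases)
  show ?thesis using f(1) g(1) sq_integrable_add[OF f(1) g(1)]
    by (simp add: f(2) g(2) abs_L2_algebra translate_abs sq_integrable_translate)
qed

lemma translate_scaleC: "translate b (c *\<^sub>C u) = c *\<^sub>C translate b u"
proof -
  obtain f where f: "sq_integrable f" "u = abs_L2 f" by (rule L2_cases)
  show ?thesis
    using f(1) sq_integrable_bounded_linear[OF bounded_linear_vector_scalar_mult f(1), of c]
    by (simp add: f(2) abs_L2_unary translate_abs sq_integrable_translate)
qed

lemma translate_matrix: "translate b (matrix_L2 A u) = matrix_L2 A (translate b u)"
proof -
  obtain f where f: "sq_integrable f" "u = abs_L2 f" by (rule L2_cases)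
  show ?thesis
    using f(1) sq_integrable_bounded_linear[OF bounded_linear_matrix_vector_mult f(1), of A]
    by (simp add: f(2) abs_L2_unary translate_abs sq_integrable_translate)
qed

lemma translate_translate [simp]: "translate b (translate (- b) u) = u"
proof -
  obtain f where f: "sq_integrable f" "u = abs_L2 f" by (rule L2_cases)
  show ?thesis using sq_integrable_translate[OF f(1), of "- b"] f(1)
    by (simp add: f(2) translate_abs)
qed

lemma norm_translate [simp]: "norm (translate b u) = norm u"
proof -
  obtain f where f: "sq_integrable f" "u = abs_L2 f" by (rule L2_cases)
  have "(norm (translate b u))\<^sup>2 = (norm u)\<^sup>2"
    using integral_translate[of "\<lambda>x. (norm (f x))\<^sup>2" b]
    by (simp add: f translate_abs norm_abs_L2 sq_integrable_translate)
  then show ?thesis by simp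
qed

lemma cinner_translate_tensor:
  assumes "sq_int f" "sq_int (\<lambda>x. f (x + b))"
  shows "cinner (translate b u) (tensor f a) = cinner u (tensor (\<lambda>x. f (x + b)) a)"
proof -
  obtain g where g: "sq_integrable g" "u = abs_L2 g" by (rule L2_cases)
  show ?thesis
    using integral_translate[of "\<lambda>x. complex_of_real (f (x + b)) * cdot (g x) a" b]
    by (simp add: g translate_abs cinner_tensor sq_integrable_translate assms)
qed

text \<open>The translation is moved onto the test function, which remains a test function.\<close>

lemma weak_derivative_translate:
  assumes "weak_derivative u v"
  shows "weak_derivative (translate b u) (translate b v)"
  unfolding weak_derivative_iff
proof (intro allI impI)
  fix \<phi> a assume \<phi>: "test_function \<phi>"
  let ?\<psi> = "\<lambda>x. \<phi> (x + b)"
  have s: "smooth ?\<psi>" using smooth_affine[OF test_function_smooth[OF \<phi>], of 1 b] by simp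
  obtain r where r: "\<And>x. \<bar>x\<bar> > r \<Longrightarrow> \<phi> x = 0" using test_function_sq_int(3)[OF \<phi>] by blast
  have "{x. ?\<psi> x \<noteq> 0} \<subseteq> {-(r + \<bar>b\<bar>)..r + \<bar>b\<bar>}"
  proof
    fix x assume "x \<in> {x. ?\<psi> x \<noteq> 0}"
    then have "\<bar>x + b\<bar> \<le> r" using r[of "x + b"] by (auto simp: not_less[symmetric])
    then show "x \<in> {-(r + \<bar>b\<bar>)..r + \<bar>b\<bar>}" by auto
  qed
  then have \<psi>: "test_function ?\<psi>"
    using s bounded_subset[OF bounded_closed_interval] by (auto simp: test_function_alt compact_closure)
  have d: "deriv ?\<psi> = (\<lambda>x. deriv \<phi> (x + b))"
    by (intro ext DERIV_imp_deriv)
      (simp add: DERIV_shift[symmetric] smooth_DERIV[OF test_function_smooth[OF \<phi>]])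
  note q = test_function_sq_int[OF \<phi>] test_function_sq_int[OF \<psi>]
  show "cinner (translate b u) (tensor (deriv \<phi>) a) = - cinner (translate b v) (tensor \<phi> a)"
    using assms \<psi> q(5)
    by (simp add: cinner_translate_tensor q d[symmetric]) (simp add: weak_derivative_iff)
qed

text \<open>Write x = (x - b) + b. The additional multiple of the translated function is what later
  shifts the spectral parameter by an imaginary amount.\<close>

lemma mult_x_translate:
  assumes "in_Dom_x u"
  shows "in_Dom_x (translate b u)"
    "mult_x (translate b u) = translate b (mult_x u) + complex_of_real b *\<^sub>C translate b u"
proof -
  obtain f where f: "sq_integrable f" "sq_integrable (\<lambda>x. x *\<^sub>R f x)" "u = abs_L2 f"
    "mult_x u = abs_L2 (\<lambda>x. x *\<^sub>R f x)" using assms(1) by (rule in_Dom_x_cases)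
  note t = f(1,2)[THEN sq_integrable_translate, of b]
  have b: "sq_integrable (\<lambda>x. b *\<^sub>R f (x - b))"
    by (rule sq_integrable_bounded_linear[OF bounded_linear_scaleR_right t(1)])
  have eq: "(\<lambda>x. (x - b) *\<^sub>R f (x - b) + b *\<^sub>R f (x - b)) = (\<lambda>x. x *\<^sub>R f (x - b))"
    by (simp add: fun_eq_iff scaleR_add_left[symmetric])
  have x: "sq_integrable (\<lambda>x. x *\<^sub>R f (x - b))"
    using sq_integrable_add[OF t(2) b] by (simp only: eq)
  show "in_Dom_x (translate b u)"
    using mult_x_abs(1)[OF t(1) x] by (simp add: f translate_abs)
  have "mult_x (translate b u) = abs_L2 (\<lambda>x. x *\<^sub>R f (x - b))"
    using mult_x_abs(2)[OF t(1) x] by (simp add: f translate_abs)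
  also have "\<dots> = translate b (mult_x u) + b *\<^sub>R translate b u"
    unfolding f(4) unfolding f(3)
    using t b by (simp add: f(1,2) translate_abs abs_L2_unary abs_L2_algebra eq)
  finally show "mult_x (translate b u) = translate b (mult_x u) + complex_of_real b *\<^sub>C translate b u"
    by (simp add: scaleR_scaleC)
qed

section \<open>Hermite functions\<close>

definition pgauss :: "real poly \<Rightarrow> real \<Rightarrow> real" where
  "pgauss p x = poly p x * gauss x"

lemma smooth_pgauss: "smooth (pgauss p)"
  using smooth_poly_gauss[of p] by (simp add: pgauss_def[abs_def])

lemma deriv_pgauss: "deriv (pgauss p) = pgauss (pderiv p - [:0, 1:] * p)"
  unfolding pgauss_def[abs_def] by (intro ext DERIV_imp_deriv DERIV_poly_gauss)

lemma x_pgauss: "(\<lambda>x. x * pgauss p x) = pgauss ([:0, 1:] * p)"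
  by (simp add: pgauss_def fun_eq_iff)

lemma pgauss_algebra:
  "pgauss (p + q) = (\<lambda>x. pgauss p x + pgauss q x)" "pgauss (p - q) = (\<lambda>x. pgauss p x - pgauss q x)"
  "pgauss (smult c p) = (\<lambda>x. c * pgauss p x)"
  by (simp_all add: pgauss_def fun_eq_iff algebra_simps)

lemma integrable_poly_gauss_square: "integrable lborel (\<lambda>x. poly p x * (gauss x)\<^sup>2)"
proof -
  have "integrable lborel (\<lambda>x. \<Sum>i\<le>degree p.
      coeff p i * sqrt pi * (normal_density 0 (1 / sqrt 2) x * (x - 0) ^ i))"
    by (intro Bochner_Integration.integrable_sum integrable_mult_right integrable_normal_moment) simp
  moreover have "poly p x * (gauss x)\<^sup>2 = (\<Sum>i\<le>degree p.
      coeff p i * sqrt pi * (normal_density 0 (1 / sqrt 2) x * (x - 0) ^ i))" for x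
    by (simp add: gauss_square poly_altdef sum_distrib_right sum_distrib_left mult_ac)
  ultimately show ?thesis by simp
qed

lemma sq_int_pgauss: "sq_int (pgauss p)"
proof -
  have "(pgauss p x)\<^sup>2 = poly (p * p) x * (gauss x)\<^sup>2" for x
    by (simp add: pgauss_def power2_eq_square)
  then show ?thesis
    using integrable_poly_gauss_square[of "p * p"] smooth_measurable[OF smooth_pgauss]
    by (simp add: sq_int_def)
qed

text \<open>Normalised Hermite polynomials generated by the creation operator: x - d/dx acts on
  polynomials times the Gaussian as p -> 2 x p - p', and 1 / sqrt (2 (n + 1)) keeps the norm equal
  to 1. The initial constant is pi^(-1/4).\<close>

fun hermite_poly :: "nat \<Rightarrow> real poly" where
  "hermite_poly 0 = [:1 / sqrt (sqrt pi):]"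
| "hermite_poly (Suc n) =
     smult (1 / sqrt (2 * real (Suc n))) ([:0, 2:] * hermite_poly n - pderiv (hermite_poly n))"

definition hermite :: "nat \<Rightarrow> real \<Rightarrow> real" where
  "hermite n = pgauss (hermite_poly n)"

text \<open>The matrix elements of the ladder operators x + d/dx and x - d/dx in the Hermite basis.
  As \<open>hs 0\<close> vanishes, it always cancels the truncated index \<open>n - 1\<close> at
  \<open>n = 0\<close>.\<close>

definition hs :: "nat \<Rightarrow> real" where "hs n = sqrt (2 * real n)"

lemma hs_0 [simp]: "hs 0 = 0" and hs_mult_self: "hs n * hs n = 2 * real n"
  by (simp_all add: hs_def)

lemma hs_Suc_pos [simp]: "hs (Suc n) > 0" and hs_Suc_neq [simp]: "hs (Suc n) \<noteq> 0"
  by (simp_all add: hs_def)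

lemma hermite_poly_raise:
  "smult (hs (Suc n)) (hermite_poly (Suc n)) = [:0, 2:] * hermite_poly n - pderiv (hermite_poly n)"
  using hs_Suc_neq[of n] by (simp add: hs_def del: of_nat_Suc)

declare hermite_poly.simps(2) [simp del]

text \<open>Differentiating the raising relation yields an additional 2 from the product rule, and
  (hs n)^2 + 2 = (hs (n + 1))^2.\<close>

lemma hermite_poly_lower: "pderiv (hermite_poly n) = smult (hs n) (hermite_poly (n - 1))"
proof (induction n)
  case (Suc n)
  let ?p = "hermite_poly n" and ?q = "hermite_poly (n - 1)"
  have r: "smult (hs n) (smult (hs n) ?p) = smult (hs n) ([:0, 2:] * ?q - pderiv ?q)"
    by (cases n) (simp_all only: diff_Suc_1 hermite_poly_raise[symmetric], simp)
  have "smult (hs (Suc n)) (pderiv (hermite_poly (Suc n))) =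
      pderiv ([:0, 2:] * ?p - smult (hs n) ?q)"
    by (simp only: pderiv_smult[symmetric] hermite_poly_raise Suc.IH)
  also have "\<dots> = smult 2 ?p + [:0, 2:] * smult (hs n) ?q - smult (hs n) (pderiv ?q)"
    by (simp add: pderiv_diff pderiv_mult pderiv_smult Suc.IH pderiv_pCons mult.commute)
  also have "\<dots> = smult 2 ?p + smult (hs n) ([:0, 2:] * ?q - pderiv ?q)"
    by (simp add: smult_diff_right mult.commute)
  also have "\<dots> = smult (hs (Suc n) * hs (Suc n)) ?p"
    unfolding r[symmetric] by (simp add: hs_mult_self algebra_simps flip: smult_add_left)
  finally have "smult (hs (Suc n)) (pderiv (hermite_poly (Suc n)) - smult (hs (Suc n)) ?p) = 0"
    by (simp add: smult_diff_right)
  then show ?case by simp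
qed (simp add: pderiv_pCons)

text \<open>Half the sum of the raising and the lowering relation: the three-term
  recurrence.\<close>

lemma x_hermite_poly: "[:0, 1:] * hermite_poly n =
    smult (1/2) (smult (hs n) (hermite_poly (n - 1)) + smult (hs (Suc n)) (hermite_poly (Suc n)))"
  unfolding hermite_poly_raise hermite_poly_lower
  by (rule poly_eqI) (simp add: coeff_pCons split: nat.split)

lemma sq_int_hermite: "sq_int (hermite n)" and smooth_hermite: "smooth (hermite n)"
  by (simp_all add: hermite_def sq_int_pgauss smooth_pgauss)

lemma x_hermite:
  "(\<lambda>x. x * hermite n x) =
    (\<lambda>x. (1/2) * (hs n * hermite (n - 1) x + hs (Suc n) * hermite (Suc n) x))"
  unfolding hermite_def x_pgauss x_hermite_poly by (simp only: pgauss_algebra)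

lemma deriv_hermite:
  "deriv (hermite n) =
    (\<lambda>x. (1/2) * (hs n * hermite (n - 1) x - hs (Suc n) * hermite (Suc n) x))"
  unfolding hermite_def deriv_pgauss x_hermite_poly hermite_poly_lower
  by (simp add: pgauss_algebra fun_eq_iff algebra_simps)

text \<open>Read off from the weak derivative calculus by pairing two tensors with the same unit
  spinor.\<close>

lemma pgauss_parts:
  "(LINT x|lborel. pgauss p x * deriv (pgauss q) x) = - (LINT x|lborel. deriv (pgauss p) x * pgauss q x)"
proof -
  have d: "sq_int (deriv (pgauss r))" for r by (simp add: deriv_pgauss sq_int_pgauss)
  have "cinner (tensor (pgauss p) (axis 1 1)) (tensor (deriv (pgauss q)) (axis 1 1)) =
     - cinner (tensor (deriv (pgauss p)) (axis 1 1)) (tensor (pgauss q) (axis 1 1))"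
    by (intro weak_derivative_smooth weak_derivative_tensor smooth_pgauss sq_int_pgauss d)
  moreover have "cdot (axis 1 1) (axis 1 1) = 1" by (simp add: cdot_2 axis_def)
  ultimately show ?thesis
    by (simp add: cinner_tensor_tensor sq_int_pgauss d flip: of_real_minus)
qed

text \<open>The operators x - d/dx and x + d/dx are adjoint to each other: the creation operator
  acting on index \<open>k\<close> is moved to the annihilation operator acting on index
  \<open>n\<close>.\<close>

lemma hermite_ladder:
  "hs (Suc k) * (LINT x|lborel. hermite n x * hermite (Suc k) x) =
   hs n * (LINT x|lborel. hermite (n - 1) x * hermite k x)"
proof -
  have d: "sq_int (deriv (hermite n))" for n by (simp add: hermite_def deriv_pgauss sq_int_pgauss)
  have xh: "sq_int (\<lambda>x. x * hermite n x)" for n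
    by (simp add: hermite_def x_pgauss sq_int_pgauss)
  have 1: "hs (Suc k) * hermite (Suc k) x = x * hermite k x - deriv (hermite k) x" for x
    using fun_cong[OF x_hermite[of k], of x] fun_cong[OF deriv_hermite[of k], of x] by (simp add: algebra_simps)
  have 2: "hs n * hermite (n - 1) x = x * hermite n x + deriv (hermite n) x" for x
    using fun_cong[OF x_hermite[of n], of x] fun_cong[OF deriv_hermite[of n], of x] by (simp add: algebra_simps)
  have "hs (Suc k) * (LINT x|lborel. hermite n x * hermite (Suc k) x) =
      (LINT x|lborel. hermite n x * (x * hermite k x) - hermite n x * deriv (hermite k) x)"
  proof -
    have "hermite n x * (x * hermite k x) - hermite n x * deriv (hermite k) x =
        hs (Suc k) * (hermite n x * hermite (Suc k) x)" for x
      using arg_cong[OF 1[of x], of "\<lambda>y. hermite n x * y"] by (simp add: algebra_simps)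
    then show ?thesis by simp
  qed
  also have "\<dots> = (LINT x|lborel. hermite n x * (x * hermite k x)) -
      (LINT x|lborel. hermite n x * deriv (hermite k) x)"
    by (intro Bochner_Integration.integral_diff sq_int_integrable_mult sq_int_hermite xh d)
  also have "(LINT x|lborel. hermite n x * deriv (hermite k) x) =
      - (LINT x|lborel. deriv (hermite n) x * hermite k x)"
    unfolding hermite_def by (rule pgauss_parts)
  also have "(LINT x|lborel. hermite n x * (x * hermite k x)) -
      - (LINT x|lborel. deriv (hermite n) x * hermite k x) =
      (LINT x|lborel. (x * hermite n x) * hermite k x + deriv (hermite n) x * hermite k x)"
    by (subst Bochner_Integration.integral_add[OF sq_int_integrable_mult[OF xh sq_int_hermite]
          sq_int_integrable_mult[OF d sq_int_hermite]]) (simp add: mult_ac)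
  also have "\<dots> = hs n * (LINT x|lborel. hermite (n - 1) x * hermite k x)"
  proof -
    have "(x * hermite n x) * hermite k x + deriv (hermite n) x * hermite k x =
        hs n * (hermite (n - 1) x * hermite k x)" for x
      using arg_cong[OF 2[of x], of "\<lambda>y. y * hermite k x"] by (simp add: algebra_simps)
    then show ?thesis by simp
  qed
  finally show ?thesis .
qed

lemma hermite_orthonormal: "(LINT x|lborel. hermite n x * hermite k x) = (if n = k then 1 else 0)"
proof (induction k arbitrary: n)
  case 0
  show ?case
  proof (cases n)
    case 0
    have "(LINT x|lborel. hermite 0 x * hermite 0 x) =
        (LINT x|lborel. normal_density 0 (1 / sqrt 2) x)"
    proof (intro Bochner_Integration.integral_cong refl)
      fix x :: real
      have "hermite 0 x * hermite 0 x = (gauss x)\<^sup>2 / sqrt pi"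
        by (simp add: hermite_def pgauss_def power2_eq_square field_simps)
      then show "hermite 0 x * hermite 0 x = normal_density 0 (1 / sqrt 2) x"
        by (simp add: gauss_square)
    qed
    with 0 show ?thesis by (simp add: integral_normal_density)
  next
    case (Suc j)
    \<comment> \<open>Annihilating the ground state produces the factor \<open>hs 0\<close>, which
      is 0.\<close>
    have "hs (Suc j) * (LINT x|lborel. hermite 0 x * hermite (Suc j) x) = 0"
      using hermite_ladder[of j 0] by simp
    with Suc show ?thesis by (simp add: mult.commute)
  qed
next
  case (Suc k)
  have "hs (Suc k) * (LINT x|lborel. hermite n x * hermite (Suc k) x) =
      hs n * (if n - 1 = k then 1 else 0)"
    using hermite_ladder[of k n] Suc.IH by simp
  then show ?case
    using hs_Suc_neq[of k] by (cases n) (auto split: if_splits)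
qed

subsection \<open>Completeness\<close>

text \<open>Positive and negative part of \<open>w\<close>, divided by their common mass, are
  densities of probability measures with equal characteristic functions, so Levy's uniqueness
  theorem identifies them.\<close>

lemma fourier_unique:
  fixes w :: "real \<Rightarrow> real"
  assumes w: "integrable lborel w"
    and zero: "\<And>t. (LINT x|lborel. complex_of_real (w x) * iexp (t * x)) = 0"
  shows "AE x in lborel. w x = 0"
proof -
  define c where "c = (LINT x|lborel. max 0 (w x))"
  define M where "M s = density lborel (\<lambda>x. ennreal (max 0 (s * w x) / c))" for s :: real
  have [measurable]: "w \<in> borel_measurable borel" using w by auto
  have ip: "integrable lborel (\<lambda>x. max 0 (s * w x))" for s
    by (rule Bochner_Integration.integrable_bound[OF integrable_mult_right[OF w, of s]]) auto
  \<comment> \<open>At t = 0 the transform is the integral of \<open>w\<close>; hence both parts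
    have the same mass \<open>c\<close>.\<close>
  have "complex_of_real (LINT x|lborel. w x) = 0"
    using zero[of 0] by simp
  then have "(LINT x|lborel. w x) = 0" by (simp only: of_real_eq_0_iff)
  moreover have "(LINT x|lborel. w x) = (LINT x|lborel. max 0 (1 * w x) - max 0 (-1 * w x))"
    by (intro Bochner_Integration.integral_cong) auto
  ultimately have c': "(LINT x|lborel. max 0 (- w x)) = c"
    using ip[of 1] ip[of "-1"] by (simp add: c_def)
  show ?thesis
  proof (cases "c = 0")
    case True
    have "AE x in lborel. max 0 (w x) = 0" "AE x in lborel. max 0 (- w x) = 0"
      using True c' ip[of 1] ip[of "-1"]
      by (simp_all add: c_def integral_nonneg_eq_0_iff_AE)
    then show ?thesis by eventually_elim (auto simp: max_def split: if_splits)
  next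
    case False
    have "c \<ge> 0" unfolding c_def by (intro Bochner_Integration.integral_nonneg) simp
    with False have c: "c > 0" by simp
    have int: "(LINT x|lborel. max 0 (s * w x)) = c" if "s = 1 \<or> s = -1" for s
      using that c' by (auto simp: c_def)
    have rd: "real_distribution (M s)" if s: "s = 1 \<or> s = -1" for s
    proof (intro real_distribution.intro real_distribution_axioms.intro prob_spaceI)
      have "emeasure (M s) (space (M s)) = (\<integral>\<^sup>+x. ennreal (max 0 (s * w x) / c) \<partial>lborel)"
        by (simp add: M_def emeasure_density)
      also have "\<dots> = ennreal (LINT x|lborel. max 0 (s * w x) / c)"
        using c ip[of s] by (intro nn_integral_eq_integral) auto
      also have "\<dots> = 1" using int[OF s] c by simp
      finally show "emeasure (M s) (space (M s)) = 1" .
    qed (simp_all add: M_def)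
    have ch: "char (M s) t =
        (LINT x|lborel. complex_of_real (max 0 (s * w x) / c) * iexp (t * x))" for s t
      unfolding char_def M_def
      using c by (subst integral_density) (auto simp: scaleR_conv_of_real)
    have "char (M 1) t - char (M (-1)) t = 0" for t
    proof -
      have ie: "integrable lborel (\<lambda>x. complex_of_real (max 0 (s * w x) / c) * iexp (t * x))" for s
      proof (rule Bochner_Integration.integrable_bound[OF integrable_mult_right[OF ip[of s], of "1 / c"]])
        have "norm (complex_of_real (max 0 (s * w x) / c) * iexp (t * x)) \<le>
            norm (1 / c * max 0 (s * w x))" for x
          unfolding norm_mult norm_of_real norm_exp_i_times by (simp add: abs_mult)
        then show "AE x in lborel. norm (complex_of_real (max 0 (s * w x) / c) * iexp (t * x)) \<le>
            norm (1 / c * max 0 (s * w x))" by simp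
      qed simp
      have "char (M 1) t - char (M (-1)) t =
          (LINT x|lborel. complex_of_real (1 / c) * (complex_of_real (w x) * iexp (t * x)))"
        unfolding ch Bochner_Integration.integral_diff[OF ie ie, symmetric]
        by (intro Bochner_Integration.integral_cong refl)
          (auto simp: max_def algebra_simps diff_divide_distrib)
      then show ?thesis by (simp only: integral_mult_right_zero zero mult_zero_right)
    qed
    then have "M 1 = M (-1)"
      by (intro Levy_uniqueness rd) auto
    \<comment> \<open>The two parts agree almost everywhere, and at every point one of them is
      0.\<close>
    then have "AE x in lborel. ennreal (max 0 (1 * w x) / c) = ennreal (max 0 (-1 * w x) / c)"
      unfolding M_def by (intro sigma_finite_measure.density_unique[OF sigma_finite_lborel]) auto
    then show ?thesis
      by eventually_elim (use c in \<open>auto simp: max_def ennreal_eq_0_iff divide_le_0_iff split: if_splits\<close>)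
  qed
qed

text \<open>Half of the decay of the squared Gaussian pays for the exponential, through 2 |t x| <= 2
  t^2 + x^2 / 2. The result is the majorant for the exponential series in
  \<open>gauss_moments_zero\<close>.\<close>

lemma sq_int_exp_gauss: "sq_int (\<lambda>x. exp \<bar>t * x\<bar> * gauss x)"
proof -
  have "integrable lborel (\<lambda>x. (exp \<bar>t * x\<bar> * gauss x)\<^sup>2)"
  proof (rule Bochner_Integration.integrable_bound)
    show "integrable lborel (\<lambda>x. exp (2 * t\<^sup>2) * sqrt (2 * pi) * std_normal_density x)"
      by (intro integrable_mult_right integrable_normal_density) auto
    have "(exp \<bar>t * x\<bar> * gauss x)\<^sup>2 \<le> exp (2 * t\<^sup>2) * sqrt (2 * pi) * std_normal_density x" for x
    proof -
      have "2 * \<bar>t * x\<bar> \<le> 2 * t\<^sup>2 + x\<^sup>2 / 2"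
        using sum_squares_bound[of "2 * \<bar>t\<bar>" "\<bar>x\<bar>"] by (simp add: abs_mult power_mult_distrib)
      then have "2 * \<bar>t * x\<bar> - x\<^sup>2 \<le> 2 * t\<^sup>2 - x\<^sup>2 / 2" by simp
      then have "exp (2 * \<bar>t * x\<bar> - x\<^sup>2) \<le> exp (2 * t\<^sup>2 - x\<^sup>2 / 2)" by simp
      moreover have "(exp \<bar>t * x\<bar> * gauss x)\<^sup>2 = exp (2 * \<bar>t * x\<bar> - x\<^sup>2)"
        by (simp add: gauss_def power_mult_distrib exp_double[symmetric] exp_add[symmetric])
      moreover have "exp (2 * t\<^sup>2) * sqrt (2 * pi) * std_normal_density x = exp (2 * t\<^sup>2 - x\<^sup>2 / 2)"
        by (simp add: std_normal_density_def exp_add[symmetric])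
      ultimately show ?thesis by simp
    qed
    then show "AE x in lborel. norm ((exp \<bar>t * x\<bar> * gauss x)\<^sup>2) \<le>
        norm (exp (2 * t\<^sup>2) * sqrt (2 * pi) * std_normal_density x)"
      by (intro AE_I2) (simp add: abs_mult)
  qed (simp add: gauss_def[abs_def])
  then show ?thesis by (simp add: sq_int_def gauss_def[abs_def])
qed

text \<open>The Fourier transform of the Gaussian times \<open>r\<close> is expanded in the
  exponential series. Gaussian decay permits integration term by term, so vanishing moments force
  the transform to vanish.\<close>

lemma gauss_moments_zero:
  assumes r: "sq_int r" and zero: "\<And>k. (LINT x|lborel. (x ^ k * gauss x) * r x) = 0"
  shows "AE x in lborel. r x = 0"
proof -
  define w where "w x = gauss x * r x" for x
  have [measurable]: "r \<in> borel_measurable borel" "gauss \<in> borel_measurable borel"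
    using r by (auto simp: sq_int_def gauss_def[abs_def])
  have we: "integrable lborel (\<lambda>x. exp \<bar>t * x\<bar> * \<bar>w x\<bar>)" for t
    using integrable_abs[OF sq_int_integrable_mult[OF sq_int_exp_gauss[of t] r]]
    by (simp add: w_def abs_mult mult_ac abs_of_pos)
  have w: "integrable lborel w"
    using sq_int_integrable_mult[OF sq_int_pgauss[of 1] r] by (simp add: w_def[abs_def] pgauss_def)
  have "AE x in lborel. w x = 0"
  proof (rule fourier_unique[OF w])
    fix t :: real
    define S where "S n x = (\<Sum>k<n. complex_of_real (w x) * ((\<i> * complex_of_real (t * x)) ^ k /\<^sub>R fact k))"
      for n x
    have le: "norm (S n x) \<le> exp \<bar>t * x\<bar> * \<bar>w x\<bar>" for n x
    proof -
      have "norm (S n x) \<le> (\<Sum>k<n. \<bar>w x\<bar> * (\<bar>t * x\<bar> ^ k /\<^sub>R fact k))"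
        unfolding S_def by (rule sum_norm_le) (simp add: norm_mult norm_power abs_mult)
      also have "\<dots> = \<bar>w x\<bar> * (\<Sum>k<n. \<bar>t * x\<bar> ^ k /\<^sub>R fact k)"
        by (simp add: sum_distrib_left)
      also have "\<dots> \<le> \<bar>w x\<bar> * exp \<bar>t * x\<bar>"
        unfolding exp_def by (intro mult_left_mono sum_le_suminf summable_exp_generic) auto
      finally show ?thesis by (simp add: mult.commute)
    qed
    have k: "integrable lborel (\<lambda>x. (x ^ k * gauss x) * r x)" for k
    proof -
      have "sq_int (\<lambda>x. x ^ k * gauss x)"
        using sq_int_pgauss[of "monom 1 k"] by (simp add: pgauss_def[abs_def] poly_monom)
      then show ?thesis by (intro sq_int_integrable_mult r)
    qed
    have eq: "complex_of_real (w x) * ((\<i> * complex_of_real (t * x)) ^ k /\<^sub>R fact k) =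
        ((\<i> * t) ^ k / fact k) * complex_of_real ((x ^ k * gauss x) * r x)" for k x
      by (simp add: w_def power_mult_distrib scaleR_conv_of_real field_simps)
    have S: "integrable lborel (S n) \<and> (LINT x|lborel. S n x) = 0" for n
      unfolding S_def[abs_def] eq using k zero
      by (subst Bochner_Integration.integral_sum)
        (auto simp del: of_real_mult)
    have "(\<lambda>n. LINT x|lborel. S n x) \<longlonglongrightarrow> (LINT x|lborel. complex_of_real (w x) * iexp (t * x))"
    proof (rule integral_dominated_convergence[OF _ _ we[of t]])
      show "AE x in lborel. (\<lambda>n. S n x) \<longlonglongrightarrow> complex_of_real (w x) * iexp (t * x)"
      proof (rule AE_I2)
        fix x
        have "(\<lambda>k. (\<i> * complex_of_real (t * x)) ^ k /\<^sub>R fact k) sums iexp (t * x)"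
          by (rule exp_converges)
        from sums_mult[OF this, of "complex_of_real (w x)"]
        show "(\<lambda>n. S n x) \<longlonglongrightarrow> complex_of_real (w x) * iexp (t * x)"
          by (simp add: sums_def S_def)
      qed
    qed (use S le w S[THEN conjunct1, THEN borel_measurable_integrable] in \<open>auto intro!: AE_I2\<close>)
    then show "(LINT x|lborel. complex_of_real (w x) * iexp (t * x)) = 0"
      using S by (simp add: LIMSEQ_const_iff)
  qed
  then show ?thesis
    by eventually_elim (metis gauss_pos less_irrefl mult_eq_0_iff w_def)
qed

text \<open>The three-term recurrence absorbs each power of x, and \<open>hermite_poly 0\<close> is
  a non-zero constant; so orthogonality passes from Hermite functions to monomials times the
  Gaussian.\<close>

lemma hermite_span:
  assumes "\<And>n a. cinner u (tensor (hermite n) a) = 0"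
  shows "cinner u (tensor (pgauss (monom 1 k)) a) = 0"
proof -
  define Z where "Z = {p. cinner u (tensor (pgauss p) a) = 0}"
  have add: "p + q \<in> Z" if "p \<in> Z" "q \<in> Z" for p q
    using that by (simp add: Z_def pgauss_algebra tensor_add_left sq_int_pgauss cinner_simps)
  have smult: "smult c p \<in> Z" if "p \<in> Z" for p c
    using that by (simp add: Z_def pgauss_algebra tensor_scaleR_left sq_int_pgauss cinner_simps
        scaleR_scaleC)
  \<comment> \<open>All \<open>n\<close> are treated at once because multiplication by x moves the
    index both up and down.\<close>
  have "monom 1 k * hermite_poly n \<in> Z" for n
  proof (induction k arbitrary: n)
    case 0
    then show ?case using assms[of n] by (simp add: Z_def hermite_def monom_0)
  next
    case (Suc k)
    have "monom 1 (Suc k) * hermite_poly n = monom 1 k * ([:0, 1:] * hermite_poly n)"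
      by (simp add: monom_Suc)
    also have "\<dots> = smult (1/2) (smult (hs n) (monom 1 k * hermite_poly (n - 1)) +
        smult (hs (Suc n)) (monom 1 k * hermite_poly (Suc n)))"
      unfolding x_hermite_poly by (simp add: algebra_simps smult_add_right)
    also have "\<dots> \<in> Z" by (intro smult add Suc.IH)
    finally show ?case .
  qed
  from smult[OF this[of 0], of "sqrt (sqrt pi)"] have "monom 1 k \<in> Z"
    by (simp add: smult_smult)
  then show ?thesis by (simp add: Z_def)
qed

text \<open>For each constant spinor \<open>a\<close> the real function
  \<open>f x \<bullet> a\<close> has vanishing Gaussian moments; letting \<open>a\<close> run
  through the finite real basis of the spinor space gives \<open>f = 0\<close>.\<close>

lemma hermite_complete:
  assumes "\<And>n a. cinner u (tensor (hermite n) a) = 0"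
  shows "u = 0"
proof -
  obtain f where f: "sq_integrable f" "u = abs_L2 f" by (rule L2_cases)
  note [measurable] = sq_integrable_measurable[OF f(1)]
  have "AE x in lborel. f x \<bullet> a = 0" for a
  proof (rule gauss_moments_zero)
    have "integrable lborel (\<lambda>x. (f x \<bullet> a)\<^sup>2)"
    proof (rule Bochner_Integration.integrable_bound)
      show "integrable lborel (\<lambda>x. (norm a)\<^sup>2 * (norm (f x))\<^sup>2)"
        using f(1) by (simp add: sq_integrable_def)
      have "norm ((f x \<bullet> a)\<^sup>2) \<le> norm ((norm a)\<^sup>2 * (norm (f x))\<^sup>2)" for x
        using power_mono[OF Cauchy_Schwarz_ineq2[of "f x" a], of 2]
        by (simp add: power_mult_distrib mult.commute)
      then show "AE x in lborel. norm ((f x \<bullet> a)\<^sup>2) \<le> norm ((norm a)\<^sup>2 * (norm (f x))\<^sup>2)" by simp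
    qed simp
    then show "sq_int (\<lambda>x. f x \<bullet> a)" by (simp add: sq_int_def)
    fix k
    have q: "sq_int (pgauss (monom 1 k))" by (rule sq_int_pgauss)
    have "inner u (tensor (pgauss (monom 1 k)) a) = 0"
      using hermite_span[OF assms, of k a] by (simp add: inner_Re_cinner)
    then have "(LINT x|lborel. f x \<bullet> (pgauss (monom 1 k) x *\<^sub>R a)) = 0"
      by (simp add: f tensor_def abs_L2_algebra sq_integrable_tensor[OF q] del: inner_scaleR_right)
    then show "(LINT x|lborel. (x ^ k * gauss x) * (f x \<bullet> a)) = 0"
      by (simp add: pgauss_def poly_monom)
  qed
  then have "AE x in lborel. \<forall>a\<in>Basis. f x \<bullet> a = 0"
    by (intro AE_finite_allI) auto
  then have "AE x in lborel. f x = 0"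
    by eventually_elim (simp add: euclidean_all_zero_iff)
  then have "abs_L2 f = abs_L2 (\<lambda>_. 0)"
    by (simp add: abs_L2_eq_iff f(1) sq_integrable_zero)
  then show ?thesis by (simp add: f zero_L2_def)
qed

section \<open>The Hermite basis of spinors\<close>

lemma sq_int_x_hermite: "sq_int (\<lambda>x. x * hermite n x)"
  and sq_int_deriv_hermite: "sq_int (deriv (hermite n))"
  by (simp_all add: hermite_def x_pgauss deriv_pgauss sq_int_pgauss)

text \<open>Hermite functions are admissible in \<open>weak_derivative_smooth\<close> and total, so
  they determine the derivative. This justifies the definite description in
  \<open>deriv_L2\<close>.\<close>

lemma weak_derivative_unique:
  assumes "weak_derivative u v" "weak_derivative u w"
  shows "v = w"
proof -
  have "v - w = 0"
  proof (rule hermite_complete)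
    show "cinner (v - w) (tensor (hermite n) a) = 0" for n a
      using weak_derivative_smooth[OF assms(1) smooth_hermite sq_int_hermite sq_int_deriv_hermite, of n a]
        weak_derivative_smooth[OF assms(2) smooth_hermite sq_int_hermite sq_int_deriv_hermite, of n a]
      by (simp add: cinner_diff)
  qed
  then show ?thesis by simp
qed

lemma weak_derivativeD:
  assumes "weak_derivative u v" shows "u \<in> H1" "deriv_L2 u = v"
  using assms weak_derivative_unique unfolding H1_def deriv_L2_def by blast+

lemma weak_derivative_deriv_L2: "u \<in> H1 \<Longrightarrow> weak_derivative u (deriv_L2 u)"
  using weak_derivativeD(2) by (auto simp: H1_def)

lemma dom_H1: "u \<in> airy_dirac_dom \<Longrightarrow> u \<in> H1" and dom_x: "u \<in> airy_dirac_dom \<Longrightarrow> in_Dom_x u"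
  by (simp_all add: airy_dirac_dom_def)

lemma dom_add:
  assumes "u \<in> airy_dirac_dom" "v \<in> airy_dirac_dom"
  shows "u + v \<in> airy_dirac_dom" "deriv_L2 (u + v) = deriv_L2 u + deriv_L2 v" "mult_x (u + v) = mult_x u + mult_x v"
  using weak_derivativeD[OF weak_derivative_add[OF weak_derivative_deriv_L2 weak_derivative_deriv_L2]]
    mult_x_add assms by (simp_all add: airy_dirac_dom_def)

lemma dom_scaleC:
  assumes "u \<in> airy_dirac_dom"
  shows "c *\<^sub>C u \<in> airy_dirac_dom" "deriv_L2 (c *\<^sub>C u) = c *\<^sub>C deriv_L2 u" "mult_x (c *\<^sub>C u) = c *\<^sub>C mult_x u"
  using weak_derivativeD[OF weak_derivative_scaleC[OF weak_derivative_deriv_L2]]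
    mult_x_scaleC assms by (simp_all add: airy_dirac_dom_def)

text \<open>The eigenvectors of \<open>sigma1\<close>, for the eigenvalue \<open>1\<close> if \<open>b\<close> holds and \<open>-1\<close> otherwise.\<close>

definition spin :: "bool \<Rightarrow> complex^2" where
  "spin b = vector [complex_of_real (1 / sqrt 2), complex_of_real ((if b then 1 else -1) / sqrt 2)]"

lemma cdot_spin: "cdot (spin b) (spin c) = (if b = c then 1 else 0)"
proof -
  have "complex_of_real (1 / sqrt 2) * complex_of_real (1 / sqrt 2) = 1 / 2"
    by (simp flip: of_real_mult)
  then show ?thesis by (auto simp: cdot_2 spin_def)
qed

lemma spin_span: "a = ((a $ 1 + a $ 2) / complex_of_real (sqrt 2)) *s spin True +
    ((a $ 1 - a $ 2) / complex_of_real (sqrt 2)) *s spin False"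
proof -
  have "complex_of_real (sqrt 2) * complex_of_real (sqrt 2) = 2"
    by (simp flip: of_real_mult)
  then show ?thesis
    by (simp add: vec_eq_iff forall_2 spin_def field_simps)
qed

definition phi :: "bool \<Rightarrow> nat \<Rightarrow> L2" where "phi b n = tensor (hermite n) (spin b)"

lemma cinner_phi: "cinner (phi b n) (phi c k) = (if b = c \<and> n = k then 1 else 0)"
  by (simp add: phi_def cinner_tensor_tensor sq_int_hermite hermite_orthonormal cdot_spin)

lemma phi_complete:
  assumes "\<And>b n. cinner u (phi b n) = 0"
  shows "u = 0"
proof (rule hermite_complete)
  fix n a
  show "cinner u (tensor (hermite n) a) = 0"
    using assms[of True n] assms[of False n]
    by (subst spin_span[of a])
      (simp add: tensor_add_right tensor_scaleC sq_int_hermite cinner_simps phi_def)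
qed

lemma S1_phi: "S1 (phi b n) = (if b then 1 else -1) *\<^sub>C phi b n"
  and S3_phi: "S3 (phi b n) = phi (\<not> b) n"
proof -
  have "sigma1 *v spin b = (if b then 1 else -1) *s spin b" "sigma3 *v spin b = spin (\<not> b)"
    by (simp_all add: sigma1_mult sigma3_mult spin_def vec_eq_iff forall_2)
  then show "S1 (phi b n) = (if b then 1 else -1) *\<^sub>C phi b n" "S3 (phi b n) = phi (\<not> b) n"
    by (simp_all add: phi_def tensor_matrix sq_int_hermite flip: tensor_scaleC)
qed

lemma phi_dom: "phi b n \<in> airy_dirac_dom"
  and deriv_phi: "deriv_L2 (phi b n) =
    (1/2) *\<^sub>C (complex_of_real (hs n) *\<^sub>C phi b (n - 1) - complex_of_real (hs (Suc n)) *\<^sub>C phi b (Suc n))"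
  and mult_x_phi: "mult_x (phi b n) =
    (1/2) *\<^sub>C (complex_of_real (hs n) *\<^sub>C phi b (n - 1) + complex_of_real (hs (Suc n)) *\<^sub>C phi b (Suc n))"
proof -
  note w = weak_derivative_tensor[OF smooth_hermite sq_int_hermite sq_int_deriv_hermite, of n "spin b"]
  note x = mult_x_tensor[OF sq_int_hermite sq_int_x_hermite, of n "spin b"]
  show "phi b n \<in> airy_dirac_dom"
    using weak_derivativeD(1)[OF w] x(1) by (simp add: airy_dirac_dom_def phi_def)
  have s: "sq_int (\<lambda>x. c * hermite n x)" for c n
    using sq_int_pgauss[of "smult c (hermite_poly n)"] by (simp add: hermite_def pgauss_algebra)
  have s2: "sq_int (\<lambda>x. c * hermite n x - d * hermite k x)" "sq_int (\<lambda>x. c * hermite n x + d * hermite k x)"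
    for c d n k
    using sq_int_pgauss[of "smult c (hermite_poly n) - smult d (hermite_poly k)"]
      sq_int_pgauss[of "smult c (hermite_poly n) + smult d (hermite_poly k)"]
    by (simp_all add: hermite_def pgauss_algebra)
  have half: "(1/2::complex) = complex_of_real (1/2)" by simp
  show "deriv_L2 (phi b n) = (1/2) *\<^sub>C (complex_of_real (hs n) *\<^sub>C phi b (n - 1) -
      complex_of_real (hs (Suc n)) *\<^sub>C phi b (Suc n))"
    unfolding phi_def weak_derivativeD(2)[OF w] deriv_hermite half
    by (simp only: tensor_scaleR_left[OF s2(1)] tensor_diff_left[OF s s]
        tensor_scaleR_left[OF sq_int_hermite] scaleR_scaleC)
  show "mult_x (phi b n) = (1/2) *\<^sub>C (complex_of_real (hs n) *\<^sub>C phi b (n - 1) +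
      complex_of_real (hs (Suc n)) *\<^sub>C phi b (Suc n))"
    unfolding phi_def x(2) x_hermite half
    by (simp only: tensor_scaleR_left[OF s2(2)] tensor_add_left[OF s s]
        tensor_scaleR_left[OF sq_int_hermite] scaleR_scaleC)
qed

lemma ladder_phi:
  "mult_x (phi b n) + deriv_L2 (phi b n) = complex_of_real (hs n) *\<^sub>C phi b (n - 1)"
  "mult_x (phi b n) - deriv_L2 (phi b n) = complex_of_real (hs (Suc n)) *\<^sub>C phi b (Suc n)"
  unfolding mult_x_phi deriv_phi
  by (simp_all add: scaleC_add_right scaleC_diff_right scaleC_diff_left[symmetric]
      scaleC_add_left[symmetric] add_divide_distrib[symmetric])

text \<open>The algebraic span of the Hermite spinors. As an inductive set it lets an identity be
  verified on \<open>phi\<close> and propagated by linearity.\<close>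

inductive_set core :: "L2 set" where
  phi: "phi b n \<in> core"
| add: "u \<in> core \<Longrightarrow> v \<in> core \<Longrightarrow> u + v \<in> core"
| scaleC: "u \<in> core \<Longrightarrow> c *\<^sub>C u \<in> core"

lemma core_zero: "0 \<in> core"
  using core.scaleC[OF core.phi, of 0] by simp

lemma core_diff: "u \<in> core \<Longrightarrow> v \<in> core \<Longrightarrow> u - v \<in> core"
  using core.add[of u "(-1) *\<^sub>C v"] core.scaleC[of v "-1"] by (simp add: scaleC_minus_left)

lemma core_sum: "(\<And>i. i \<in> A \<Longrightarrow> g i \<in> core) \<Longrightarrow> sum g A \<in> core"
  by (induction A rule: infinite_finite_induct) (auto intro: core_zero core.add)

lemma core_dom: "u \<in> core \<Longrightarrow> u \<in> airy_dirac_dom"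
  by (induction rule: core.induct) (auto intro: phi_dom dom_add dom_scaleC)

lemma core_deriv: "u \<in> core \<Longrightarrow> deriv_L2 u \<in> core"
  and core_mult_x: "u \<in> core \<Longrightarrow> mult_x u \<in> core"
  and core_S1: "u \<in> core \<Longrightarrow> S1 u \<in> core"
  and core_S3: "u \<in> core \<Longrightarrow> S3 u \<in> core"
  by (induction rule: core.induct)
    (auto simp: deriv_phi mult_x_phi S1_phi S3_phi dom_add dom_scaleC core_dom matrix_L2_add
      matrix_L2_scaleC intro!: core.intros core_diff)

text \<open>Only \<open>v\<close> is confined to the core; \<open>u\<close> ranges over the whole
  maximal domain. This asymmetry later yields the coefficients of \<open>airy s m u\<close> for
  arbitrary \<open>u\<close>.\<close>

lemma cinner_deriv_core:
  assumes "u \<in> airy_dirac_dom" "v \<in> core"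
  shows "cinner (deriv_L2 u) v = - cinner u (deriv_L2 v)"
  using assms(2)
proof induction
  case (phi b n)
  show ?case
    using weak_derivative_smooth[OF weak_derivative_deriv_L2[OF dom_H1[OF assms(1)]] smooth_hermite
        sq_int_hermite sq_int_deriv_hermite, of n "spin b"]
      weak_derivativeD(2)[OF weak_derivative_tensor[OF smooth_hermite sq_int_hermite
          sq_int_deriv_hermite, of n "spin b"]]
    by (simp add: phi_def)
qed (auto simp: cinner_simps dom_add dom_scaleC core_dom)

lemma cinner_mult_x_core:
  assumes "u \<in> airy_dirac_dom" "v \<in> core"
  shows "cinner (mult_x u) v = cinner u (mult_x v)"
  using assms(2)
proof induction
  case (phi b n)
  show ?case
    using cinner_mult_x_tensor[OF dom_x[OF assms(1)] sq_int_hermite sq_int_x_hermite, of n "spin b"]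
      mult_x_tensor(2)[OF sq_int_hermite sq_int_x_hermite, of n "spin b"]
    by (simp add: phi_def)
qed (auto simp: cinner_simps dom_add dom_scaleC core_dom)

lemma hs_mult_self_complex: "complex_of_real (hs n) * complex_of_real (hs n) = 2 * of_nat n"
  using arg_cong[OF hs_mult_self[of n], of complex_of_real] by simp

text \<open>The canonical commutation relation, from the ladder operators: (X + D)(X - D) - (X -
  D)(X + D) = 2 (D X - X D), and on the \<open>n\<close>-th Hermite spinor the left-hand side is 2
  (n + 1) - 2 n = 2.\<close>

lemma core_commutator:
  assumes "u \<in> core"
  shows "deriv_L2 (mult_x u) - mult_x (deriv_L2 u) = u"
  using assms
proof induction
  case (phi b n)
  note [simp] = dom_add dom_scaleC phi_dom
  let ?D = deriv_L2 and ?X = mult_x and ?u = "phi b n"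
  have l: "?X w + ?D w = c *\<^sub>C (?X v + ?D v)" "?X w - ?D w = c *\<^sub>C (?X v - ?D v)"
    if "w = c *\<^sub>C v" "v \<in> airy_dirac_dom" for w c v
    using that by (simp_all add: scaleC_add_right scaleC_diff_right)
  have c: "?u \<in> core" by (rule core.phi)
  have d: "?X ?u \<in> airy_dirac_dom" "?D ?u \<in> airy_dirac_dom"
    using c by (auto intro: core_dom core_mult_x core_deriv)
  have ad: "?D (?X ?u + ?D ?u) = ?D (?X ?u) + ?D (?D ?u)" "?X (?X ?u + ?D ?u) = ?X (?X ?u) + ?X (?D ?u)"
    "?D (?X ?u - ?D ?u) = ?D (?X ?u) - ?D (?D ?u)" "?X (?X ?u - ?D ?u) = ?X (?X ?u) - ?X (?D ?u)"
    using dom_add[OF d] dom_add[OF d(1) dom_scaleC(1)[OF d(2), of "-1"]] dom_scaleC[OF d(2), of "-1"]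
    by (simp_all add: scaleC_minus_left)
  have 1: "?X (?X ?u - ?D ?u) + ?D (?X ?u - ?D ?u) = (2 * of_nat (Suc n)) *\<^sub>C ?u"
    using l(1)[OF ladder_phi(2) phi_dom, of b n] ladder_phi(1)[of b "Suc n"]
    by (simp only: scaleC_scaleC hs_mult_self_complex diff_Suc_1)
  have 2: "?X (?X ?u + ?D ?u) - ?D (?X ?u + ?D ?u) = (2 * of_nat n) *\<^sub>C ?u"
    using l(2)[OF ladder_phi(1) phi_dom, of b n] ladder_phi(2)[of b "n - 1"]
    by (cases n) (simp_all add: hs_mult_self_complex del: of_nat_Suc)
  have "2 *\<^sub>C (?D (?X ?u) - ?X (?D ?u)) =
      (?X (?X ?u - ?D ?u) + ?D (?X ?u - ?D ?u)) - (?X (?X ?u + ?D ?u) - ?D (?X ?u + ?D ?u))"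
    unfolding ad using scaleC_add_left[of 1 1 "?D (?X ?u) - ?X (?D ?u)"] by simp
  also have "\<dots> = (2 * of_nat (Suc n) - 2 * of_nat n) *\<^sub>C ?u"
    unfolding 1 2 scaleC_diff_left ..
  also have "\<dots> = 2 *\<^sub>C ?u" by simp
  finally have "(1/2) *\<^sub>C 2 *\<^sub>C (?D (?X ?u) - ?X (?D ?u)) = (1/2) *\<^sub>C 2 *\<^sub>C ?u" by simp
  then show ?case by simp
next
  case (add u v)
  then show ?case
    by (simp add: dom_add core_dom core_deriv core_mult_x algebra_simps)
next
  case (scaleC u c)
  then show ?case
    by (simp add: dom_scaleC core_dom core_deriv core_mult_x scaleC_diff_right[symmetric])
qed

section \<open>The operator and its formal adjoint\<close>

text \<open>For \<open>s = 1\<close> this is the imaginary Airy-Dirac operator, for \<open>s = -1\<close> its adjoint.\<close>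

definition airy :: "real \<Rightarrow> real \<Rightarrow> L2 \<Rightarrow> L2" where
  "airy s m u = - (\<i> *\<^sub>C S1 (deriv_L2 u)) + complex_of_real m *\<^sub>C S3 u +
     (complex_of_real s * \<i>) *\<^sub>C mult_x u"

lemma airy_1: "airy 1 m = airy_dirac m"
  by (simp add: airy_def airy_dirac_def fun_eq_iff)

lemma airy_add: "u \<in> airy_dirac_dom \<Longrightarrow> v \<in> airy_dirac_dom \<Longrightarrow> airy s m (u + v) = airy s m u + airy s m v"
  by (simp add: airy_def dom_add matrix_L2_add scaleC_add_right)

lemma airy_scaleC: "u \<in> airy_dirac_dom \<Longrightarrow> airy s m (c *\<^sub>C u) = c *\<^sub>C airy s m u"
  by (simp add: airy_def dom_scaleC matrix_L2_scaleC scaleC_add_right scaleC_diff_right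
      scaleC_minus_right mult_ac)

lemma dom_diff: "u \<in> airy_dirac_dom \<Longrightarrow> v \<in> airy_dirac_dom \<Longrightarrow> u - v \<in> airy_dirac_dom"
  using dom_add(1)[of u "(-1) *\<^sub>C v"] dom_scaleC(1)[of v "-1"] by (simp add: scaleC_minus_left)

lemma airy_diff: "u \<in> airy_dirac_dom \<Longrightarrow> v \<in> airy_dirac_dom \<Longrightarrow> airy s m (u - v) = airy s m u - airy s m v"
  using airy_add[of u "(-1) *\<^sub>C v" s m] airy_scaleC[of v s m "-1"] dom_scaleC(1)[of v "-1"]
  by (simp add: scaleC_minus_left)

lemma core_airy: "u \<in> core \<Longrightarrow> airy s m u \<in> core"
  unfolding airy_def
  by (metis core.add core.scaleC core_S1 core_S3 core_deriv core_mult_x scaleC_minus_left)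

lemma airy_sum:
  assumes "\<And>i. i \<in> A \<Longrightarrow> g i \<in> core"
  shows "airy s m (\<Sum>i\<in>A. c i *\<^sub>C g i) = (\<Sum>i\<in>A. c i *\<^sub>C airy s m (g i))"
  using assms
proof (induction A rule: infinite_finite_induct)
  case (insert x F)
  have "(\<Sum>i\<in>F. c i *\<^sub>C g i) \<in> core" using insert by (intro core_sum core.scaleC) auto
  then show ?case using insert by (simp add: airy_add airy_scaleC core_dom core.scaleC)
qed (use airy_scaleC[OF core_dom[OF core_zero], of s m 0] in auto)

lemma matrix_L2_diff: "matrix_L2 A (u - v) = matrix_L2 A u - matrix_L2 A v"
  using matrix_L2_add[of A u "- v"] matrix_L2_scaleC[of A "-1" v] by (simp add: scaleC_minus_left)

lemma core_S1_commute:
  "u \<in> core \<Longrightarrow> deriv_L2 (S1 u) = S1 (deriv_L2 u)" "u \<in> core \<Longrightarrow> mult_x (S1 u) = S1 (mult_x u)"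
  and core_S3_commute:
  "u \<in> core \<Longrightarrow> deriv_L2 (S3 u) = S3 (deriv_L2 u)" "u \<in> core \<Longrightarrow> mult_x (S3 u) = S3 (mult_x u)"
  by (induction rule: core.induct)
    (auto simp: S1_phi S3_phi deriv_phi mult_x_phi dom_add dom_scaleC core_dom core_S1 core_S3 phi_dom
      matrix_L2_add matrix_L2_diff matrix_L2_scaleC scaleC_diff_right scaleC_add_right scaleC_minus_left
      scaleC_minus_right mult_ac)

text \<open>The derivative is skew and so is the factor \<i>, which makes the first order term
  symmetric; the term \<i> x is skew and changes the sign of \<open>s\<close>.\<close>

lemma cinner_airy_core:
  assumes "u \<in> airy_dirac_dom" "v \<in> core"
  shows "cinner (airy s m u) v = cinner u (airy (- s) m v)"
proof -
  have "cinner (S1 (deriv_L2 u)) v = - cinner u (S1 (deriv_L2 v))"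
    using cinner_deriv_core[OF assms(1) core_S1[OF assms(2)]] assms(2)
    by (simp add: cinner_S1 core_S1_commute)
  then show ?thesis
    by (simp add: airy_def cinner_simps cinner_S3 cinner_mult_x_core[OF assms])
qed

text \<open>The form identity behind \<open>A\<^sup>* A = - \<partial>\<^sup>2 + x\<^sup>2 + m\<^sup>2 + \<sigma>\<^sub>1\<close>; the cross terms with the mass vanish
  because \<open>\<sigma>\<^sub>3\<close> anticommutes with \<open>\<sigma>\<^sub>1\<close>.\<close>

lemma norm_airy_core:
  assumes "u \<in> core" "s\<^sup>2 = 1"
  shows "(norm (airy s m u))\<^sup>2 = (norm (deriv_L2 u))\<^sup>2 + (norm (mult_x u))\<^sup>2 + m\<^sup>2 * (norm u)\<^sup>2 +
    s * Re (cinner (S1 u) u)"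
proof -
  let ?a = "deriv_L2 u" and ?b = "mult_x u"
  note [simp] = assms(1) core_dom core_S1 core_S3 core_deriv core_mult_x
  have conj: "Im z = 0" if "cnj z = z" for z using that by (simp add: complex_eq_iff)
  \<comment> \<open>Relative to the mass term the other two carry a factor \<i>, so the cross terms
    with the mass only involve imaginary parts of inner products that turn out to be real.\<close>
  have "cinner (S3 u) (S1 ?a) = cinner (S1 ?a) (S3 u)"
  proof -
    have "cinner (S3 u) (S1 ?a) = - cinner (S1 u) (S3 ?a)"
      by (simp add: cinner_S1[symmetric] S1_S3 cinner_S3)
    also have "\<dots> = cinner (S1 ?a) (S3 u)"
      using cinner_deriv_core[of "S1 u" "S3 u"] by (simp add: core_S1_commute core_S3_commute)
    finally show ?thesis .
  qed
  then have 1: "Im (cinner (S1 ?a) (S3 u)) = 0" by (intro conj) (simp add: cinner_commute[of "S3 u"])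
  have "cinner ?b (S3 u) = cinner (S3 u) ?b"
    using cinner_mult_x_core[of u "S3 u"] by (simp add: core_S3_commute cinner_S3)
  then have 2: "Im (cinner (S3 u) ?b) = 0" by (intro conj) (simp add: cinner_commute[of ?b])
  \<comment> \<open>The remaining cross term reduces to the commutator of derivative and coordinate
    and contributes the \<sigma>1 term.\<close>
  have "cinner (S1 ?a) ?b + cinner ?b (S1 ?a) = - cinner (S1 u) (deriv_L2 ?b) + cinner (S1 u) (mult_x ?a)"
    using cinner_deriv_core[of "S1 u" ?b] cinner_mult_x_core[of "S1 u" ?a]
    by (simp add: core_S1_commute cinner_S1)
  also have "\<dots> = - cinner (S1 u) u"
    using core_commutator[OF assms(1)] by (metis add.commute cinner_diff(2) diff_conv_add_uminus minus_diff_eq)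
  finally have "Re (cinner (S1 ?a) ?b + cinner ?b (S1 ?a)) = Re (- cinner (S1 u) u)" by simp
  then have 3: "2 * Re (cinner (S1 ?a) ?b) = - Re (cinner (S1 u) u)"
    by (simp add: cinner_commute[of ?b])
  have n: "norm (\<i> *\<^sub>C w) = norm w" "norm (complex_of_real r *\<^sub>C w) = \<bar>r\<bar> * norm w" for w :: L2 and r
    by (simp_all add: norm_scaleC)
  have s: "\<bar>s\<bar> = 1" using assms(2) by (simp add: abs_square_eq_1)
  show ?thesis
    unfolding airy_def norm_add_square
    using 1 2 3 s by (simp add: cinner_simps norm_scaleC norm_mult power_mult_distrib algebra_simps)
qed

lemma abs_cinner_S1_le: "\<bar>Re (cinner (S1 u) u)\<bar> \<le> (norm u)\<^sup>2"
  using order_trans[OF abs_Re_le_cmod norm_cinner_le[of "S1 u" u]] by (simp add: power2_eq_square)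

lemma norm_airy_core_ge:
  assumes "u \<in> core" "s\<^sup>2 = 1"
  shows "(norm (deriv_L2 u))\<^sup>2 + (norm (mult_x u))\<^sup>2 + m\<^sup>2 * (norm u)\<^sup>2 \<le> (norm (airy s m u))\<^sup>2 + (norm u)\<^sup>2"
proof -
  have "\<bar>s * Re (cinner (S1 u) u)\<bar> \<le> (norm u)\<^sup>2"
    using assms(2) abs_cinner_S1_le[of u] by (simp add: abs_mult abs_square_eq_1)
  then show ?thesis using norm_airy_core[OF assms, of m] by linarith
qed

text \<open>Applied to differences, the lower bound on the core makes derivatives and coordinate
  multiples Cauchy sequences; both operations are closed, and the bound itself survives the
  limit.\<close>

lemma airy_closed:
  assumes U: "\<And>n. U n \<in> core" "U \<longlonglongrightarrow> u" "(\<lambda>n. airy s m (U n)) \<longlonglongrightarrow> y" and s: "s\<^sup>2 = 1"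
  shows "u \<in> airy_dirac_dom" "airy s m u = y"
    "(norm (deriv_L2 u))\<^sup>2 + (norm (mult_x u))\<^sup>2 + m\<^sup>2 * (norm u)\<^sup>2 \<le> (norm (airy s m u))\<^sup>2 + (norm u)\<^sup>2"
proof -
  have d: "deriv_L2 (U i - U j) = deriv_L2 (U i) - deriv_L2 (U j)"
    "mult_x (U i - U j) = mult_x (U i) - mult_x (U j)" for i j
    using dom_add[OF core_dom[OF U(1)] core_dom[OF core.scaleC[OF U(1)]], of i "-1" j]
      dom_scaleC[OF core_dom[OF U(1)], of "-1" j] by (simp_all add: scaleC_minus_left)
  have C: "Cauchy (\<lambda>n. deriv_L2 (U n)) \<and> Cauchy (\<lambda>n. mult_x (U n))"
  proof -
    have *: "\<exists>N. \<forall>i\<ge>N. \<forall>j\<ge>N. norm (deriv_L2 (U i) - deriv_L2 (U j)) < \<epsilon> \<and>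
        norm (mult_x (U i) - mult_x (U j)) < \<epsilon>" if \<epsilon>: "\<epsilon> > 0" for \<epsilon>
    proof -
      obtain N1 where N1: "\<And>i j. i \<ge> N1 \<Longrightarrow> j \<ge> N1 \<Longrightarrow> norm (U i - U j) < \<epsilon> / 2"
        using CauchyD[OF LIMSEQ_imp_Cauchy[OF U(2)], of "\<epsilon> / 2"] \<epsilon> by auto
      obtain N2 where N2: "\<And>i j. i \<ge> N2 \<Longrightarrow> j \<ge> N2 \<Longrightarrow> norm (airy s m (U i) - airy s m (U j)) < \<epsilon> / 2"
        using CauchyD[OF LIMSEQ_imp_Cauchy[OF U(3)], of "\<epsilon> / 2"] \<epsilon> by auto
      have "norm (deriv_L2 (U i) - deriv_L2 (U j)) < \<epsilon> \<and> norm (mult_x (U i) - mult_x (U j)) < \<epsilon>"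
        if ij: "i \<ge> max N1 N2" "j \<ge> max N1 N2" for i j
      proof -
        have "(norm (U i - U j))\<^sup>2 < (\<epsilon> / 2)\<^sup>2" "(norm (airy s m (U i) - airy s m (U j)))\<^sup>2 < (\<epsilon> / 2)\<^sup>2"
          using ij N1[of i j] N2[of i j] by (auto intro!: power_strict_mono)
        moreover have "(norm (deriv_L2 (U i) - deriv_L2 (U j)))\<^sup>2 + (norm (mult_x (U i) - mult_x (U j)))\<^sup>2 +
            m\<^sup>2 * (norm (U i - U j))\<^sup>2 \<le> (norm (airy s m (U i) - airy s m (U j)))\<^sup>2 + (norm (U i - U j))\<^sup>2"
          using norm_airy_core_ge[OF core_diff[OF U(1) U(1)] s, of i j m]
          unfolding d airy_diff[OF core_dom[OF U(1)] core_dom[OF U(1)]] .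
        moreover have "m\<^sup>2 * (norm (U i - U j))\<^sup>2 \<ge> 0" by simp
        ultimately have "(norm (deriv_L2 (U i) - deriv_L2 (U j)))\<^sup>2 + (norm (mult_x (U i) - mult_x (U j)))\<^sup>2
            < 2 * (\<epsilon> / 2)\<^sup>2"
          by linarith
        also have "2 * (\<epsilon> / 2)\<^sup>2 \<le> \<epsilon>\<^sup>2" by (simp add: power2_eq_square)
        finally have "(norm (deriv_L2 (U i) - deriv_L2 (U j)))\<^sup>2 < \<epsilon>\<^sup>2"
          "(norm (mult_x (U i) - mult_x (U j)))\<^sup>2 < \<epsilon>\<^sup>2"
          by (smt (verit) zero_le_power2)+
        then show ?thesis using \<epsilon> by (auto dest: power2_less_imp_less)
      qed
      then show ?thesis by blast
    qed
    show ?thesis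
      unfolding Cauchy_iff using * by meson
  qed
  then obtain v w where v: "(\<lambda>n. deriv_L2 (U n)) \<longlonglongrightarrow> v" and w: "(\<lambda>n. mult_x (U n)) \<longlonglongrightarrow> w"
    by (metis Cauchy_convergent convergent_def)
  have "weak_derivative u v"
    by (rule weak_derivative_LIMSEQ[OF weak_derivative_deriv_L2[OF dom_H1[OF core_dom[OF U(1)]]] U(2) v])
  note v' = weak_derivativeD[OF this]
  note w' = mult_x_LIMSEQ[OF dom_x[OF core_dom[OF U(1)]] U(2) w]
  show "u \<in> airy_dirac_dom" using v' w' by (simp add: airy_dirac_dom_def)
  have "(\<lambda>n. airy s m (U n)) \<longlonglongrightarrow> airy s m u"
    unfolding airy_def v'(2) w'(2)
    by (intro tendsto_intros tendsto_scaleC v w U(2) bounded_linear.tendsto[OF bounded_linear_matrix_L2(1)]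
        bounded_linear.tendsto[OF bounded_linear_matrix_L2(2)])
  then show y: "airy s m u = y" using U(3) LIMSEQ_unique by blast
  show "(norm (deriv_L2 u))\<^sup>2 + (norm (mult_x u))\<^sup>2 + m\<^sup>2 * (norm u)\<^sup>2 \<le> (norm (airy s m u))\<^sup>2 + (norm u)\<^sup>2"
  proof (rule LIMSEQ_le)
    show "(\<lambda>n. (norm (deriv_L2 (U n)))\<^sup>2 + (norm (mult_x (U n)))\<^sup>2 + m\<^sup>2 * (norm (U n))\<^sup>2) \<longlonglongrightarrow>
        (norm (deriv_L2 u))\<^sup>2 + (norm (mult_x u))\<^sup>2 + m\<^sup>2 * (norm u)\<^sup>2"
      unfolding v'(2) w'(2) by (intro tendsto_intros v w U(2))
    show "(\<lambda>n. (norm (airy s m (U n)))\<^sup>2 + (norm (U n))\<^sup>2) \<longlonglongrightarrow> (norm (airy s m u))\<^sup>2 + (norm u)\<^sup>2"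
      unfolding y by (intro tendsto_intros U)
  qed (use norm_airy_core_ge[OF U(1) s] in auto)
qed

section \<open>Singular value decomposition\<close>

text \<open>A singular value decomposition inside the core. The bound \<delta> makes the inverse
  bounded, and the symmetry under exchanging \<open>e\<close>, \<open>f\<close> and the sign of
  \<open>s\<close> transfers every result to the adjoint.\<close>

definition diagonalised :: "real \<Rightarrow> real \<Rightarrow> (nat \<Rightarrow> real) \<Rightarrow> (nat \<Rightarrow> L2) \<Rightarrow> (nat \<Rightarrow> L2) \<Rightarrow> bool" where
  "diagonalised s m \<mu> e f \<longleftrightarrow> s\<^sup>2 = 1 \<and> onb e \<and> onb f \<and> range e \<subseteq> core \<and> range f \<subseteq> core \<and>
     (\<exists>\<delta>>0. \<forall>j. \<delta> \<le> \<mu> j) \<and>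
     (\<forall>j. airy s m (e j) = complex_of_real (\<mu> j) *\<^sub>C f j) \<and>
     (\<forall>j. airy (- s) m (f j) = complex_of_real (\<mu> j) *\<^sub>C e j)"

lemma diagonalised_sym: "diagonalised s m \<mu> e f \<Longrightarrow> diagonalised (- s) m \<mu> f e"
  by (auto simp: diagonalised_def)

context
  fixes s m \<mu> e f K
  assumes dg: "diagonalised s m \<mu> e f"
  defines "K \<equiv> diag_op (\<lambda>j. complex_of_real (1 / \<mu> j)) e f"
begin

lemma dg_onb: "onb e" "onb f" and dg_core: "e j \<in> core" "f j \<in> core" and dg_s: "s\<^sup>2 = 1"
  and dg_pos: "\<mu> j > 0" "\<mu> j \<noteq> 0"
  using dg unfolding diagonalised_def by (auto, (metis less_le_trans less_irrefl)+)

lemma dg_bound: "\<exists>M. \<forall>j. cmod (complex_of_real (1 / \<mu> j)) \<le> M"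
proof -
  obtain \<delta> where \<delta>: "\<delta> > 0" "\<And>j. \<delta> \<le> \<mu> j" using dg unfolding diagonalised_def by auto
  have "cmod (complex_of_real (1 / \<mu> j)) \<le> 1 / \<delta>" for j
    using frac_le[of 1 1 \<delta> "\<mu> j"] \<delta>(1) \<delta>(2)[of j] unfolding norm_of_real by simp
  then show ?thesis by blast
qed

lemma cinner_airy_basis:
  assumes "u \<in> airy_dirac_dom"
  shows "cinner (airy s m u) (f j) = complex_of_real (\<mu> j) * cinner u (e j)"
  using dg cinner_airy_core[OF assms dg_core(2), of s m j]
  by (simp add: diagonalised_def cinner_simps)

lemma cinner_K: "cinner (K y) (e k) = complex_of_real (1 / \<mu> k) * cinner y (f k)"
proof -
  obtain M where "\<And>j. cmod (complex_of_real (1 / \<mu> j)) \<le> M" using dg_bound by blast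
  from cinner_diag_op[OF dg_onb, of "\<lambda>j. complex_of_real (1 / \<mu> j)", OF this] show ?thesis
    unfolding K_def .
qed

text \<open>A left inverse on the whole domain: \<open>cinner_airy_basis\<close> gives the
  coefficients of the image of any \<open>u\<close>, not only of core elements.\<close>

lemma K_airy: "u \<in> airy_dirac_dom \<Longrightarrow> K (airy s m u) = u"
  by (rule onb_eqI[OF dg_onb(1)]) (simp add: cinner_K cinner_airy_basis dg_pos)

text \<open>The partial sums of the series for \<open>K y\<close> are core elements, and their
  images are the partial sums of the expansion of \<open>y\<close>; so \<open>K y\<close> is a graph
  limit of core elements.\<close>

lemma K_approx:
  defines "U \<equiv> \<lambda>y n. \<Sum>j<n. (complex_of_real (1 / \<mu> j) * cinner y (f j)) *\<^sub>C e j"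
  shows "U y n \<in> core" "U y \<longlonglongrightarrow> K y" "(\<lambda>n. airy s m (U y n)) \<longlonglongrightarrow> y"
proof -
  show "U y n \<in> core" unfolding U_def by (intro core_sum core.scaleC dg_core)
  show "U y \<longlonglongrightarrow> K y"
  proof -
    obtain M where "\<And>j. cmod (complex_of_real (1 / \<mu> j)) \<le> M" using dg_bound by blast
    from diag_op_sums[OF dg_onb, of "\<lambda>j. complex_of_real (1 / \<mu> j)", OF this] show ?thesis
      unfolding K_def U_def sums_def .
  qed
  have "airy s m (U y n) = (\<Sum>j<n. cinner y (f j) *\<^sub>C f j)" for n
    unfolding U_def airy_sum[OF dg_core(1)]
    using dg dg_pos by (intro sum.cong) (simp_all add: diagonalised_def)
  then show "(\<lambda>n. airy s m (U y n)) \<longlonglongrightarrow> y"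
    using onb_expansion_LIMSEQ[OF dg_onb(2), of y] by simp
qed

lemma K_dom: "K y \<in> airy_dirac_dom" and airy_K: "airy s m (K y) = y"
  using airy_closed[OF K_approx dg_s] by auto

lemma norm_airy_ge:
  assumes "u \<in> airy_dirac_dom"
  shows "(norm (deriv_L2 u))\<^sup>2 + (norm (mult_x u))\<^sup>2 + m\<^sup>2 * (norm u)\<^sup>2 \<le> (norm (airy s m u))\<^sup>2 + (norm u)\<^sup>2"
  using airy_closed(3)[OF K_approx dg_s, of "airy s m u"] K_airy[OF assms] by simp

lemma cinner_K_adjoint: "cinner (K u) v = cinner u (diag_op (\<lambda>j. complex_of_real (1 / \<mu> j)) f e v)"
proof -
  obtain M where "\<And>j. cmod (complex_of_real (1 / \<mu> j)) \<le> M" using dg_bound by blast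
  from cinner_diag_op_adjoint[OF dg_onb, of "\<lambda>j. complex_of_real (1 / \<mu> j)", OF this] show ?thesis
    unfolding K_def complex_cnj_complex_of_real .
qed

end

text \<open>With \<open>u\<close> and \<open>v\<close> written as images of the two inverses, the
  claim becomes the adjoint relation of bounded diagonal operators.\<close>

lemma cinner_airy:
  assumes "diagonalised s m \<mu> e f" "u \<in> airy_dirac_dom" "v \<in> airy_dirac_dom"
  shows "cinner (airy s m u) v = cinner u (airy (- s) m v)"
  using cinner_K_adjoint[OF assms(1), of "airy s m u" "airy (- s) m v"]
    K_airy[OF assms(1,2)] K_airy[OF diagonalised_sym[OF assms(1)] assms(3)] by simp

lemma adjoint_domain_airy:
  assumes "diagonalised s m \<mu> e f"
  shows "adjoint_domain airy_dirac_dom (airy s m) = airy_dirac_dom"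
proof (intro equalityI subsetI)
  fix v assume "v \<in> adjoint_domain airy_dirac_dom (airy s m)"
  then obtain w where w: "\<And>u. u \<in> airy_dirac_dom \<Longrightarrow> cinner (airy s m u) v = cinner u w"
    by (auto simp: adjoint_domain_def)
  let ?w = "diag_op (\<lambda>j. complex_of_real (1 / \<mu> j)) f e w"
  \<comment> \<open>Surjectivity enters: the test vector \<open>K (v - ?w)\<close> lies in the
    domain and its image is \<open>v - ?w\<close>. So \<open>v\<close> equals \<open>?w\<close>, the
    inverse of the formal adjoint applied to \<open>w\<close>.\<close>
  have "cinner (v - ?w) (v - ?w) = 0"
    using w[OF K_dom[OF assms], of "v - ?w"]
    unfolding airy_K[OF assms] cinner_K_adjoint[OF assms] cinner_diff(2)[of _ v] by simp
  then have "v = ?w" by (simp add: cinner_self)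
  then show "v \<in> airy_dirac_dom" using K_dom[OF diagonalised_sym[OF assms]] by metis
next
  fix v assume "v \<in> airy_dirac_dom"
  then show "v \<in> adjoint_domain airy_dirac_dom (airy s m)"
    using cinner_airy[OF assms] by (auto simp: adjoint_domain_def)
qed

lemma adjoint_op_airy:
  assumes "diagonalised s m \<mu> e f" "v \<in> airy_dirac_dom"
  shows "adjoint_op airy_dirac_dom (airy s m) v = airy (- s) m v"
  using cinner_airy[OF assms(1) _ assms(2)]
  by (intro adjoint_op_eqI[OF dg_onb(1)[OF assms(1)]] core_dom dg_core(1)[OF assms(1)])

subsection \<open>The bases\<close>

text \<open>The value m occurs once, at \<open>j = 0\<close>; each sqrt (m^2 + 2 k) with k >= 1
  occurs twice, at \<open>j = 2 * k - 1\<close> and \<open>j = 2 * k\<close>.\<close>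

definition mu :: "real \<Rightarrow> nat \<Rightarrow> real" where
  "mu m j = sqrt (m\<^sup>2 + 2 * real ((j + 1) div 2))"

text \<open>The two spins are interleaved so that the singular values do not decrease: spin -1 with
  Hermite index n has squared singular value m^2 + 2 n, spin +1 has m^2 + 2 (n + 1).\<close>

definition basis_e :: "nat \<Rightarrow> L2" where "basis_e j = phi (odd j) (j div 2)"

definition basis_f :: "real \<Rightarrow> nat \<Rightarrow> L2" where
  "basis_f m j = complex_of_real (1 / mu m j) *\<^sub>C airy 1 m (basis_e j)"

lemma airy_phi:
  "airy 1 m (phi True n) = (\<i> * complex_of_real (hs (Suc n))) *\<^sub>C phi True (Suc n) +
     complex_of_real m *\<^sub>C phi False n" (is ?A)
  "airy 1 m (phi False n) = (\<i> * complex_of_real (hs n)) *\<^sub>C phi False (n - 1) +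
     complex_of_real m *\<^sub>C phi True n" (is ?B)
  "airy (-1) m (phi True n) = (- \<i> * complex_of_real (hs n)) *\<^sub>C phi True (n - 1) +
     complex_of_real m *\<^sub>C phi False n" (is ?C)
  "airy (-1) m (phi False n) = (- \<i> * complex_of_real (hs (Suc n))) *\<^sub>C phi False (Suc n) +
     complex_of_real m *\<^sub>C phi True n" (is ?D)
proof -
  have l: "(\<i> * complex_of_real (hs n)) *\<^sub>C phi b (n - 1) = \<i> *\<^sub>C (mult_x (phi b n) + deriv_L2 (phi b n))"
    "(\<i> * complex_of_real (hs (Suc n))) *\<^sub>C phi b (Suc n) = \<i> *\<^sub>C (mult_x (phi b n) - deriv_L2 (phi b n))"
    for b
    unfolding ladder_phi by simp_all
  have S: "S1 (deriv_L2 (phi b n)) = (if b then 1 else -1) *\<^sub>C deriv_L2 (phi b n)" for b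
    using core_S1_commute(1)[OF core.phi, of b n] dom_scaleC[OF phi_dom] by (simp add: S1_phi)
  show ?A ?B ?C ?D
    unfolding airy_def mult_minus_left scaleC_minus_left l S S3_phi
    by (simp_all add: scaleC_minus_left scaleC_minus_right scaleC_add_right scaleC_diff_right)
qed

lemma mu_pos: "m > 0 \<Longrightarrow> mu m j > 0"
  by (simp add: mu_def add_pos_nonneg)

lemma airy_airy_basis_e: "airy (-1) m (airy 1 m (basis_e j)) = complex_of_real ((mu m j)\<^sup>2) *\<^sub>C basis_e j"
proof -
  have lin: "airy (-1) m (a *\<^sub>C phi b n + c *\<^sub>C phi d k) = a *\<^sub>C airy (-1) m (phi b n) + c *\<^sub>C airy (-1) m (phi d k)"
    for a b c d n k
    by (simp add: airy_add airy_scaleC phi_dom dom_scaleC)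
  \<comment> \<open>In its uses \<open>c\<close> is the mass, \<open>a\<close> is \<i> times a
    ladder coefficient and \<open>b = d = - a\<close>: the coefficient of \<open>y\<close> cancels
    and that of \<open>x\<close> is the squared singular value.\<close>
  have col: "a *\<^sub>C (b *\<^sub>C x + c *\<^sub>C y) + c *\<^sub>C (d *\<^sub>C y + c *\<^sub>C x) = (a * b + c * c) *\<^sub>C x + (a * c + c * d) *\<^sub>C y"
    for a b c d and x y :: L2
    by (simp add: scaleC_add_right scaleC_add_left algebra_simps)
  have p: "(\<i> * complex_of_real (hs n)) * (- \<i> * complex_of_real (hs n)) + complex_of_real m * complex_of_real m =
      complex_of_real (m\<^sup>2 + 2 * real n)" for n
    using hs_mult_self_complex[of n] by (simp add: power2_eq_square algebra_simps)
  have T: "airy (-1) m (airy 1 m (phi True n)) = complex_of_real (m\<^sup>2 + 2 * real (Suc n)) *\<^sub>C phi True n" for n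
    unfolding airy_phi(1) lin airy_phi(3,4) diff_Suc_1 col p by simp
  have F: "airy (-1) m (airy 1 m (phi False n)) = complex_of_real (m\<^sup>2 + 2 * real n) *\<^sub>C phi False n" for n
  proof (cases n)
    case 0
    then show ?thesis
      by (simp add: airy_phi airy_scaleC phi_dom power2_eq_square)
  next
    case (Suc k)
    show ?thesis
      unfolding Suc airy_phi(2) lin airy_phi(3,4) diff_Suc_1 col p by simp
  qed
  have mu2: "(mu m j)\<^sup>2 = m\<^sup>2 + 2 * real ((j + 1) div 2)" by (simp add: mu_def)
  show ?thesis
  proof (cases "odd j")
    case True
    then obtain k where k: "j = 2 * k + 1" by (rule oddE)
    show ?thesis unfolding mu2 using T[of k] by (simp add: basis_e_def k)
  next
    case False
    then obtain k where k: "j = 2 * k" by (auto elim: evenE)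
    show ?thesis unfolding mu2 using F[of k] by (simp add: basis_e_def k)
  qed
qed

lemma onb_basis_e: "onb basis_e"
  unfolding onb_def
proof (intro conjI allI impI)
  show "cinner (basis_e i) (basis_e j) = (if i = j then 1 else 0)" for i j
  proof -
    have "(odd i = odd j \<and> i div 2 = j div 2) = (i = j)"
      by (metis odd_two_times_div_two_succ even_two_times_div_two)
    then show ?thesis by (simp add: basis_e_def cinner_phi)
  qed
  fix u assume *: "\<forall>j. cinner u (basis_e j) = 0"
  have "phi b n = basis_e (2 * n + (if b then 1 else 0))" for b n
    by (simp add: basis_e_def)
  then show "u = 0" using * by (intro phi_complete) simp
qed

text \<open>Orthonormality is inherited from \<open>basis_e\<close> through the product of the
  formal adjoint with the operator. For completeness, \<open>phi True 0\<close> is a block of its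
  own, and \<open>phi True (Suc k)\<close>, \<open>phi False k\<close> are recovered from two images
  by inverting a 2 x 2 block.\<close>

lemma onb_basis_f:
  assumes "m > 0"
  shows "onb (basis_f m)"
  unfolding onb_def
proof (intro conjI allI impI)
  note p = mu_pos[OF assms]
  have ec: "basis_e j \<in> core" for j by (simp add: basis_e_def core.phi)
  show "cinner (basis_f m i) (basis_f m j) = (if i = j then 1 else 0)" for i j
  proof -
    have "cinner (airy 1 m (basis_e i)) (airy 1 m (basis_e j)) =
        complex_of_real ((mu m j)\<^sup>2) * cinner (basis_e i) (basis_e j)"
      using cinner_airy_core[OF core_dom[OF ec] core_airy[OF ec], of 1 m i 1 m j]
      by (simp add: airy_airy_basis_e cinner_simps)
    then show ?thesis
      using p[of j] onb_cinner[OF onb_basis_e, of i j]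
      by (auto simp: basis_f_def cinner_simps power2_eq_square)
  qed
  fix u assume *: "\<forall>j. cinner u (basis_f m j) = 0"
  have z: "cinner u (airy 1 m (basis_e j)) = 0" for j
  proof -
    have "airy 1 m (basis_e j) = complex_of_real (mu m j) *\<^sub>C basis_f m j"
      using p[of j] by (simp add: basis_f_def)
    then show ?thesis using * by (simp add: cinner_simps)
  qed
  have 0: "cinner u (phi True 0) = 0"
    using z[of 0] assms by (simp add: basis_e_def airy_phi cinner_simps)
  have step: "cinner u (phi True (Suc k)) = 0 \<and> cinner u (phi False k) = 0" for k
  proof -
    let ?p = "cinner u (phi True (Suc k))" and ?q = "cinner u (phi False k)"
      and ?s = "complex_of_real (hs (Suc k))" and ?m = "complex_of_real m"
    have 1: "- \<i> * ?s * ?p + ?m * ?q = 0"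
      using z[of "2 * k + 1"] by (simp add: basis_e_def airy_phi cinner_simps)
    have 2: "- \<i> * ?s * ?q + ?m * ?p = 0"
      using z[of "2 * Suc k"] by (simp add: basis_e_def airy_phi cinner_simps del: mult_Suc_right)
    \<comment> \<open>Elimination of \<open>?q\<close>; up to sign the factor on the left is the
      determinant of the block.\<close>
    have "(?m * ?m + ?s * ?s) * ?p = ?m * (- \<i> * ?s * ?q + ?m * ?p) + \<i> * ?s * (- \<i> * ?s * ?p + ?m * ?q)"
      by (simp add: algebra_simps)
    then have "(?m * ?m + ?s * ?s) * ?p = 0" unfolding 1 2 by simp
    moreover have "?m * ?m + ?s * ?s \<noteq> 0"
      using assms by (simp add: add_pos_nonneg less_imp_neq flip: of_real_mult of_real_add)
    ultimately have p: "?p = 0" by simp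
    with 1 assms show ?thesis by simp
  qed
  show "u = 0"
  proof (rule phi_complete)
    show "cinner u (phi b n) = 0" for b n
      using 0 step by (cases b; cases n) auto
  qed
qed

lemma diagonalised_airy:
  assumes "m > 0"
  shows "diagonalised 1 m (mu m) basis_e (basis_f m)"
  unfolding diagonalised_def
proof (intro conjI allI exI)
  have ec: "basis_e j \<in> core" for j by (simp add: basis_e_def core.phi)
  have fc: "basis_f m j \<in> core" for j unfolding basis_f_def by (intro core.scaleC core_airy ec)
  show "range basis_e \<subseteq> core" "range (basis_f m) \<subseteq> core" using ec fc by auto
  show "0 < m" by fact
  show "m \<le> mu m j" for j using assms by (simp add: mu_def real_le_rsqrt)
  show "airy 1 m (basis_e j) = complex_of_real (mu m j) *\<^sub>C basis_f m j" for j
    using mu_pos[OF assms, of j] by (simp add: basis_f_def)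
  show "airy (- 1) m (basis_f m j) = complex_of_real (mu m j) *\<^sub>C basis_e j" for j
    using mu_pos[OF assms, of j]
    by (simp add: basis_f_def airy_scaleC core_dom[OF core_airy[OF ec]] airy_airy_basis_e power2_eq_square)
qed (use onb_basis_e onb_basis_f[OF assms] in auto)

section \<open>Resolvent estimate for small spectral parameters\<close>

lemma norm_diff_square:
  "(norm (x - y))\<^sup>2 = (norm x)\<^sup>2 - 2 * Re (cinner x y) + (norm (y::'a::complex_inner_space))\<^sup>2"
  using norm_add_square[of x "- y"] by simp

context
  fixes m :: real
  assumes m: "m > 0"
begin

lemmas dg = diagonalised_airy[OF m]

lemma mu_0: "mu m 0 = m"
  using m by (simp add: mu_def)

lemma basis_f_0: "basis_f m 0 = phi True 0"
  using m by (simp add: basis_f_def mu_0 basis_e_def airy_phi)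

text \<open>The ground state \<open>basis_e 0\<close> is orthogonal to its image under the operator, so that the first
  order term in \<open>\<zeta>\<close> disappears.\<close>

lemma resolvent_estimate_small:
  obtains C where "C > 0"
    "\<And>\<zeta> u. u \<in> airy_dirac_dom \<Longrightarrow>
       (m\<^sup>2 - C * \<zeta>\<^sup>2) * (norm u)\<^sup>2 \<le> (norm (airy 1 m u - complex_of_real \<zeta> *\<^sub>C u))\<^sup>2"
proof -
  let ?A = "airy 1 m" and ?e = "basis_e 0" and ?f = "basis_f m 0"
  note e = onb_basis_e and f = onb_basis_f[OF m]
  \<comment> \<open>\<open>L\<close> bounds the two terms coupling the ground state to its
    complement: one with the image of \<open>?e\<close>, of norm m, and one with the adjoint applied
    to \<open>?e\<close>.\<close>
  define L where "L = m + norm (airy (-1) m ?e)"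
  have L: "L > 0" using m by (simp add: L_def add_pos_nonneg)
  \<comment> \<open>\<open>L^2\<close> comes from the coupling to the ground state, m^2 + 2, the
    square of \<open>mu m 1\<close>, from the terms inside its complement.\<close>
  define C where "C = L\<^sup>2 + (m\<^sup>2 + 2)"
  have "(m\<^sup>2 - C * \<zeta>\<^sup>2) * (norm u)\<^sup>2 \<le> (norm (?A u - complex_of_real \<zeta> *\<^sub>C u))\<^sup>2"
    if u: "u \<in> airy_dirac_dom" for \<zeta> u
  proof -
    define c where "c = cinner u ?e"
    define v where "v = u - c *\<^sub>C ?e"
    define a b where "a = norm (?A v)" and "b = norm v"
    have ec: "?e \<in> core" using dg_core(1)[OF dg] .
    have v: "v \<in> airy_dirac_dom" unfolding v_def by (intro dom_diff u dom_scaleC core_dom ec)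
    have uv: "u = c *\<^sub>C ?e + v" by (simp add: v_def)
    have ve: "cinner v ?e = 0" by (simp add: v_def c_def cinner_simps onb_cinner[OF e])
    have Ae: "?A ?e = complex_of_real m *\<^sub>C ?f"
      using dg by (simp add: diagonalised_def mu_0)
    have Au: "?A u = (c * complex_of_real m) *\<^sub>C ?f + ?A v"
      unfolding uv using v core_dom[OF ec] by (simp add: airy_add airy_scaleC dom_scaleC Ae)
    have vf: "cinner (?A v) ?f = 0"
      using cinner_airy_basis[OF dg v, of 0] ve by simp
    have fe: "cinner ?f ?e = 0"
      by (simp add: basis_f_0 basis_e_def cinner_phi)
    have nu: "(norm u)\<^sup>2 = (cmod c)\<^sup>2 + b\<^sup>2"
      unfolding uv norm_add_square b_def using ve e cinner_commute[of ?e v]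
      by (simp add: norm_scaleC cinner_simps)
    have nA: "(norm (?A u))\<^sup>2 = m\<^sup>2 * (cmod c)\<^sup>2 + a\<^sup>2"
      unfolding Au norm_add_square a_def using vf f cinner_commute[of ?f "?A v"] m
      by (simp add: norm_scaleC norm_mult cinner_simps power_mult_distrib)
    \<comment> \<open>Without a ground state component \<open>v\<close> only sees singular values
      from \<open>mu m 1\<close> on; this gap pays for the quadratic terms below.\<close>
    have ab: "(m\<^sup>2 + 2) * b\<^sup>2 \<le> a\<^sup>2"
      unfolding a_def b_def
    proof (rule sums_le[OF _ sums_mult[OF onb_parseval[OF e]] onb_parseval[OF f]])
      fix n
      show "(m\<^sup>2 + 2) * (cmod (cinner v (basis_e n)))\<^sup>2 \<le> (cmod (cinner (?A v) (basis_f m n)))\<^sup>2"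
      proof (cases "n = 0")
        case False
        then have "1 \<le> (n + 1) div 2" by simp
        then have "1 \<le> real ((n + 1) div 2)" by linarith
        then have "m\<^sup>2 + 2 \<le> (mu m n)\<^sup>2" by (simp add: mu_def)
        then show ?thesis
          unfolding cinner_airy_basis[OF dg v] norm_mult power_mult_distrib
          by (intro mult_right_mono) auto
      qed (simp add: ve)
    qed
    have "cinner (?A u) u = c * complex_of_real m * cinner ?f v + cnj c * cinner (?A v) ?e + cinner (?A v) v"
    proof -
      have "cinner w u = cnj c * cinner w ?e + cinner w v" for w
        using arg_cong[OF uv, of "cinner w"] by (simp add: cinner_simps)
      then show ?thesis unfolding Au by (simp add: cinner_simps fe distrib_left)
    qed
    also have "cinner (?A v) ?e = cinner v (airy (-1) m ?e)"
      by (rule cinner_airy_core[OF v ec])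
    finally have eq: "cinner (?A u) u = c * complex_of_real m * cinner ?f v +
        cnj c * cinner v (airy (-1) m ?e) + cinner (?A v) v" .
    have "cmod (cinner (?A u) u) \<le> cmod c * m * (1 * b) + cmod c * (b * norm (airy (-1) m ?e)) + a * b"
      unfolding eq
      using norm_cinner_le[of ?f v] norm_cinner_le[of v "airy (-1) m ?e"] norm_cinner_le[of "?A v" v] m f
      by (intro norm_triangle_le add_mono) (auto simp: norm_mult a_def b_def intro!: mult_left_mono)
    then have re: "\<bar>Re (cinner (?A u) u)\<bar> \<le> L * cmod c * b + a * b"
      using abs_Re_le_cmod[of "cinner (?A u) u"] by (simp add: L_def algebra_simps)
    have "2 * \<zeta> * Re (cinner (?A u) u) \<le> 2 * \<bar>\<zeta>\<bar> * (L * cmod c * b + a * b)"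
      using mult_mono[OF order_refl[of "\<bar>\<zeta>\<bar>"] re] abs_ge_self[of "\<zeta> * Re (cinner (?A u) u)"]
      by (simp add: abs_mult)
    also have "\<dots> = 2 * (L * \<bar>\<zeta>\<bar> * cmod c) * b + 2 * a * (\<bar>\<zeta>\<bar> * b)"
      by (simp add: algebra_simps)
    \<comment> \<open>The weights in Young's inequality are such that the terms without \<zeta>,
      namely b^2 and a^2 / (m^2 + 2), together stay below a^2 - m^2 b^2.\<close>
    also have "\<dots> \<le> (L\<^sup>2 * \<zeta>\<^sup>2 * (cmod c)\<^sup>2 + b\<^sup>2) + (a\<^sup>2 / (m\<^sup>2 + 2) + (m\<^sup>2 + 2) * \<zeta>\<^sup>2 * b\<^sup>2)"
    proof (rule add_mono)
      show "2 * (L * \<bar>\<zeta>\<bar> * cmod c) * b \<le> L\<^sup>2 * \<zeta>\<^sup>2 * (cmod c)\<^sup>2 + b\<^sup>2"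
        using sum_squares_bound[of "L * \<bar>\<zeta>\<bar> * cmod c" b] by (simp add: power_mult_distrib)
      have q: "m\<^sup>2 + 2 > 0" by (simp add: add_nonneg_pos)
      define p where "p = sqrt (m\<^sup>2 + 2)"
      have p: "p > 0" "p\<^sup>2 = m\<^sup>2 + 2" using q by (simp_all add: p_def)
      show "2 * a * (\<bar>\<zeta>\<bar> * b) \<le> a\<^sup>2 / (m\<^sup>2 + 2) + (m\<^sup>2 + 2) * \<zeta>\<^sup>2 * b\<^sup>2"
        using sum_squares_bound[of "a / p" "p * (\<bar>\<zeta>\<bar> * b)"] p(1)
        by (simp add: power_mult_distrib power_divide mult.assoc p(2)[symmetric])
    qed
    finally have cross: "2 * \<zeta> * Re (cinner (?A u) u) \<le>
        (L\<^sup>2 * \<zeta>\<^sup>2 * (cmod c)\<^sup>2 + b\<^sup>2) + (a\<^sup>2 / (m\<^sup>2 + 2) + (m\<^sup>2 + 2) * \<zeta>\<^sup>2 * b\<^sup>2)" .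
    have "(m\<^sup>2 + 1) * b\<^sup>2 \<le> a\<^sup>2 - a\<^sup>2 / (m\<^sup>2 + 2)"
    proof -
      have q: "m\<^sup>2 + 2 > 0" by (simp add: add_nonneg_pos)
      then have "b\<^sup>2 \<le> a\<^sup>2 / (m\<^sup>2 + 2)"
        using ab by (simp add: pos_le_divide_eq mult.commute)
      from mult_left_mono[OF this, of "m\<^sup>2 + 1"]
      have "(m\<^sup>2 + 1) * b\<^sup>2 \<le> (m\<^sup>2 + 1) * (a\<^sup>2 / (m\<^sup>2 + 2))" by simp
      also have "\<dots> = a\<^sup>2 - a\<^sup>2 / (m\<^sup>2 + 2)" using q by (simp add: field_simps)
      finally show ?thesis .
    qed
    moreover have "(norm (?A u - complex_of_real \<zeta> *\<^sub>C u))\<^sup>2 =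
        (norm (?A u))\<^sup>2 - 2 * \<zeta> * Re (cinner (?A u) u) + \<zeta>\<^sup>2 * (norm u)\<^sup>2"
      by (simp add: norm_diff_square norm_scaleC cinner_simps power_mult_distrib)
    moreover have "\<zeta>\<^sup>2 * (norm u)\<^sup>2 \<ge> 0" by simp
    moreover have "(m\<^sup>2 - C * \<zeta>\<^sup>2) * (norm u)\<^sup>2 \<le> m\<^sup>2 * (cmod c)\<^sup>2 - L\<^sup>2 * \<zeta>\<^sup>2 * (cmod c)\<^sup>2 +
        (m\<^sup>2 + 1) * b\<^sup>2 - b\<^sup>2 - (m\<^sup>2 + 2) * \<zeta>\<^sup>2 * b\<^sup>2"
    proof -
      have "m\<^sup>2 * (cmod c)\<^sup>2 - L\<^sup>2 * \<zeta>\<^sup>2 * (cmod c)\<^sup>2 + (m\<^sup>2 + 1) * b\<^sup>2 - b\<^sup>2 - (m\<^sup>2 + 2) * \<zeta>\<^sup>2 * b\<^sup>2 -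
          (m\<^sup>2 - C * \<zeta>\<^sup>2) * (norm u)\<^sup>2 = (m\<^sup>2 + 2) * \<zeta>\<^sup>2 * (cmod c)\<^sup>2 + L\<^sup>2 * \<zeta>\<^sup>2 * b\<^sup>2"
        by (simp add: nu C_def algebra_simps)
      moreover have "\<dots> \<ge> 0" by (intro add_nonneg_nonneg mult_nonneg_nonneg) auto
      ultimately show ?thesis by linarith
    qed
    ultimately show ?thesis using cross nA by linarith
  qed
  moreover have "C > 0" using L by (simp add: C_def add_pos_nonneg)
  ultimately show ?thesis using that by blast
qed

end

section \<open>The Fourier transform in the Hermite basis\<close>

text \<open>\<open>j div 2\<close> is the Hermite index of \<open>basis_e j\<close>, and (- \<i>)^n
  is the eigenvalue of the unitary Fourier transform on the n-th Hermite function. Only isometry and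
  the intertwining relations on the core are used.\<close>

definition fourier :: "L2 \<Rightarrow> L2" where
  "fourier = diag_op (\<lambda>j. (- \<i>) ^ (j div 2)) basis_e basis_e"

lemma cmod_power_i: "cmod ((- \<i>) ^ k) \<le> 1"
  by (simp add: norm_power)

lemma fourier_phi: "fourier (phi b n) = (- \<i>) ^ n *\<^sub>C phi b n"
  using diag_op_basis[OF onb_basis_e onb_basis_e, of "\<lambda>j. (- \<i>) ^ (j div 2)" 1 "2 * n + (if b then 1 else 0)"]
  by (cases b) (simp_all add: cmod_power_i fourier_def basis_e_def)

lemma fourier_add: "fourier (u + v) = fourier u + fourier v"
  and fourier_scaleC: "fourier (c *\<^sub>C u) = c *\<^sub>C fourier u"
proof -
  have "bounded_clinear fourier"
    unfolding fourier_def by (rule diag_op_bounded_clinear[OF onb_basis_e onb_basis_e cmod_power_i])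
  then show "fourier (u + v) = fourier u + fourier v" "fourier (c *\<^sub>C u) = c *\<^sub>C fourier u"
    by (auto simp: bounded_clinear_def linear_simps)
qed

lemma norm_fourier: "norm (fourier u) = norm u"
proof -
  have "(\<lambda>j. (cmod (cinner (fourier u) (basis_e j)))\<^sup>2) = (\<lambda>j. (cmod (cinner u (basis_e j)))\<^sup>2)"
    unfolding fourier_def cinner_diag_op[OF onb_basis_e onb_basis_e cmod_power_i]
    by (simp add: norm_mult norm_power)
  then have "(norm (fourier u))\<^sup>2 = (norm u)\<^sup>2"
    using onb_parseval[OF onb_basis_e, of "fourier u"] onb_parseval[OF onb_basis_e, of u] sums_unique2
    by metis
  then show ?thesis by simp
qed

lemma fourier_core: "u \<in> core \<Longrightarrow> fourier u \<in> core"
  by (induction rule: core.induct) (auto simp: fourier_phi fourier_add fourier_scaleC intro: core.intros)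

lemma fourier_diff: "fourier (u - v) = fourier u - fourier v"
  using fourier_add[of u "- v"] fourier_scaleC[of "-1" v] by (simp add: scaleC_minus_left)

text \<open>Relative to index n the neighbours n - 1 and n + 1 receive the factors \<i> and - \<i>,
  which turns the sum in the recurrence for x into the difference in that for the derivative, and
  conversely.\<close>

lemma fourier_mult_x: "u \<in> core \<Longrightarrow> fourier (mult_x u) = \<i> *\<^sub>C deriv_L2 (fourier u)"
  and fourier_deriv: "u \<in> core \<Longrightarrow> fourier (deriv_L2 u) = \<i> *\<^sub>C mult_x (fourier u)"
proof (induction rule: core.induct)
  case (phi b n)
  have k: "complex_of_real (hs n) * (- \<i>) ^ (n - 1) = \<i> * (- \<i>) ^ n * complex_of_real (hs n)"
    by (cases n) (simp_all add: mult_ac)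
  have col: "(1/2) *\<^sub>C (a *\<^sub>C p *\<^sub>C x + c *\<^sub>C q *\<^sub>C y) = \<i> *\<^sub>C k *\<^sub>C (1/2) *\<^sub>C (a *\<^sub>C x - c *\<^sub>C y)"
    "(1/2) *\<^sub>C (a *\<^sub>C p *\<^sub>C x - c *\<^sub>C q *\<^sub>C y) = \<i> *\<^sub>C k *\<^sub>C (1/2) *\<^sub>C (a *\<^sub>C x + c *\<^sub>C y)"
    if "a * p = \<i> * k * a" "q = - \<i> * k" for a c k p q and x y :: L2
  proof -
    have "\<i> *\<^sub>C k *\<^sub>C (1/2) *\<^sub>C (a *\<^sub>C x - c *\<^sub>C y) = (1/2) *\<^sub>C ((\<i> * k * a) *\<^sub>C x + (c * (- \<i> * k)) *\<^sub>C y)"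
      "\<i> *\<^sub>C k *\<^sub>C (1/2) *\<^sub>C (a *\<^sub>C x + c *\<^sub>C y) = (1/2) *\<^sub>C ((\<i> * k * a) *\<^sub>C x - (c * (- \<i> * k)) *\<^sub>C y)"
      by (simp_all add: scaleC_add_right scaleC_diff_right scaleC_minus_left mult_ac)
    then show "(1/2) *\<^sub>C (a *\<^sub>C p *\<^sub>C x + c *\<^sub>C q *\<^sub>C y) = \<i> *\<^sub>C k *\<^sub>C (1/2) *\<^sub>C (a *\<^sub>C x - c *\<^sub>C y)"
      "(1/2) *\<^sub>C (a *\<^sub>C p *\<^sub>C x - c *\<^sub>C q *\<^sub>C y) = \<i> *\<^sub>C k *\<^sub>C (1/2) *\<^sub>C (a *\<^sub>C x + c *\<^sub>C y)"
      unfolding that[symmetric] by simp_all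
  qed
  {
    case 1
    show ?case
      unfolding mult_x_phi fourier_scaleC fourier_add fourier_phi dom_scaleC(2)[OF phi_dom] deriv_phi
      by (rule col(1)[OF k]) simp
  next
    case 2
    show ?case
      unfolding deriv_phi fourier_scaleC fourier_diff fourier_phi dom_scaleC(3)[OF phi_dom] mult_x_phi
      by (rule col(2)[OF k]) simp
  }
qed (simp_all add: fourier_add fourier_scaleC dom_add dom_scaleC core_dom fourier_core scaleC_add_right mult_ac)

lemma fourier_S1: "u \<in> core \<Longrightarrow> fourier (S1 u) = S1 (fourier u)"
  and fourier_S3: "u \<in> core \<Longrightarrow> fourier (S3 u) = S3 (fourier u)"
  by (induction rule: core.induct)
    (simp_all add: S1_phi S3_phi fourier_phi fourier_add fourier_scaleC matrix_L2_add matrix_L2_scaleC mult_ac)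

text \<open>In this representation the resolvent equation is the ordinary differential system v' =
  (x \<sigma>1 + m \<sigma>3 - \<zeta>) v - g with real coefficients, accessible to a pointwise
  energy identity.\<close>

lemma fourier_airy:
  assumes "u \<in> core"
  shows "fourier (airy 1 m u) =
    S1 (mult_x (fourier u)) + complex_of_real m *\<^sub>C S3 (fourier u) - deriv_L2 (fourier u)"
proof -
  have "airy 1 m u = complex_of_real m *\<^sub>C S3 u + \<i> *\<^sub>C mult_x u - \<i> *\<^sub>C S1 (deriv_L2 u)"
    by (simp add: airy_def)
  then show ?thesis
    using assms by (simp add: fourier_add fourier_diff fourier_scaleC fourier_mult_x fourier_deriv
        fourier_S1 fourier_S3 core_deriv matrix_L2_scaleC scaleC_minus_left)
qed

section \<open>Energy estimate\<close>

lemma sigma_algebra: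
  fixes a b :: "complex^2"
  shows "(sigma1 *v a) \<bullet> b = a \<bullet> (sigma1 *v b)" "(sigma3 *v a) \<bullet> b = a \<bullet> (sigma3 *v b)"
    "(sigma1 *v a) \<bullet> (sigma1 *v b) = a \<bullet> b" "(sigma3 *v a) \<bullet> (sigma3 *v b) = a \<bullet> b"
    "(sigma1 *v a) \<bullet> (sigma3 *v a) = 0"
  by (simp_all add: sigma1_mult sigma3_mult inner_vec_def sum_2 inner_complex_def algebra_simps)

lemma norm_sigma [simp]: "norm (sigma1 *v a) = norm a" "norm (sigma3 *v a) = norm a"
  by (simp_all add: norm_eq_sqrt_inner sigma_algebra(3,4))

lemma has_vector_derivative_sigma:
  fixes A :: "complex^2^2"
  assumes "(f has_vector_derivative f') (at x)"
  shows "((\<lambda>x. A *v f x) has_vector_derivative A *v f') (at x)"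
  by (rule bounded_linear.has_vector_derivative[OF bounded_linear_matrix_vector_mult assms])

lemma isCont_matrix_vector_mult:
  fixes A :: "complex^2^2"
  shows "isCont f x \<Longrightarrow> isCont (\<lambda>x. A *v f x) x"
  by (rule bounded_linear.isCont[OF bounded_linear_matrix_vector_mult])

text \<open>\<open>\<theta>\<close> interpolates between \<open>2 \<zeta> x\<close> near the origin and constants at infinity: its exponential
  absorbs the spectral parameter where the multiplier \<open>m x \<sigma>\<^sub>1 + \<sigma>\<^sub>3\<close> does not.\<close>

lemma energy_pointwise:
  fixes f g :: "complex^2"
  assumes m: "m > 0" and \<theta>: "\<bar>\<theta>' - 2 * \<zeta>\<bar> * (1 + m * \<bar>x\<bar>) \<le> m * x\<^sup>2"
    and f': "f' = x *\<^sub>R (sigma1 *v f) + m *\<^sub>R (sigma3 *v f) - \<zeta> *\<^sub>R f - g"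
    and Q: "Q = (m * x) * ((sigma1 *v f) \<bullet> f) + (sigma3 *v f) \<bullet> f"
  shows "m / 2 * (norm f)\<^sup>2 \<le> 4 * (1 / m + m) * (norm g)\<^sup>2 +
    (\<theta>' * Q + (m * ((sigma1 *v f) \<bullet> f) + 2 * (f' \<bullet> ((m * x) *\<^sub>R (sigma1 *v f) + sigma3 *v f))))"
proof -
  define n where "n = norm f"
  define B where "B = (m * x) *\<^sub>R (sigma1 *v f) + sigma3 *v f"
  have n0: "n \<ge> 0" by (simp add: n_def)
  define a b where "a = sigma1 *v f" and "b = sigma3 *v f"
  have i: "a \<bullet> a = n\<^sup>2" "b \<bullet> b = n\<^sup>2" "a \<bullet> b = 0" "b \<bullet> a = 0" "f \<bullet> a = a \<bullet> f" "f \<bullet> b = b \<bullet> f"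
    using sigma_algebra(3-5)[of f]
    by (simp_all add: a_def b_def n_def power2_norm_eq_inner inner_commute)
  \<comment> \<open>The mixed terms vanish since \<sigma>1 f and \<sigma>3 f are orthogonal in the
    real inner product; this is what makes \<open>B\<close> a suitable multiplier.\<close>
  have "f' \<bullet> B = m * x\<^sup>2 * n\<^sup>2 + m * n\<^sup>2 - \<zeta> * Q - g \<bullet> B"
    unfolding f' Q B_def a_def[symmetric] b_def[symmetric]
    by (simp add: inner_add_left inner_add_right inner_diff_left i power2_eq_square algebra_simps)
  then have eq: "\<theta>' * Q + (m * ((sigma1 *v f) \<bullet> f) + 2 * (f' \<bullet> B)) =
      (\<theta>' - 2 * \<zeta>) * Q + m * ((sigma1 *v f) \<bullet> f) + 2 * m * (1 + x\<^sup>2) * n\<^sup>2 - 2 * (g \<bullet> B)"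
    by (simp add: algebra_simps)
  have s: "\<bar>(sigma1 *v f) \<bullet> f\<bar> \<le> n\<^sup>2" "\<bar>(sigma3 *v f) \<bullet> f\<bar> \<le> n\<^sup>2"
    using Cauchy_Schwarz_ineq2[of "sigma1 *v f" f] Cauchy_Schwarz_ineq2[of "sigma3 *v f" f]
    by (simp_all add: n_def power2_eq_square)
  have "\<bar>Q\<bar> \<le> \<bar>m * x\<bar> * \<bar>(sigma1 *v f) \<bullet> f\<bar> + \<bar>(sigma3 *v f) \<bullet> f\<bar>"
    unfolding Q using abs_triangle_ineq by (metis abs_mult)
  also have "\<dots> \<le> \<bar>m * x\<bar> * n\<^sup>2 + n\<^sup>2" by (intro add_mono mult_left_mono s) auto
  also have "\<dots> = (1 + m * \<bar>x\<bar>) * n\<^sup>2" using m by (simp add: abs_mult algebra_simps)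
  finally have Qle: "\<bar>Q\<bar> \<le> (1 + m * \<bar>x\<bar>) * n\<^sup>2" .
  have "\<bar>(\<theta>' - 2 * \<zeta>) * Q\<bar> \<le> \<bar>\<theta>' - 2 * \<zeta>\<bar> * ((1 + m * \<bar>x\<bar>) * n\<^sup>2)"
    unfolding abs_mult by (intro mult_left_mono Qle) auto
  also have "\<dots> \<le> m * x\<^sup>2 * n\<^sup>2"
    using mult_right_mono[OF \<theta>, of "n\<^sup>2"] by (simp add: mult_ac)
  finally have 1: "- (m * x\<^sup>2 * n\<^sup>2) \<le> (\<theta>' - 2 * \<zeta>) * Q" by (simp add: abs_le_iff)
  have 2: "- (m * n\<^sup>2) \<le> m * ((sigma1 *v f) \<bullet> f)"
    using mult_left_mono[of "- (n\<^sup>2)" "(sigma1 *v f) \<bullet> f" m] s(1) m by (simp add: abs_le_iff)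
  have "(norm B)\<^sup>2 = (1 + m\<^sup>2 * x\<^sup>2) * n\<^sup>2"
    unfolding power2_norm_eq_inner B_def a_def[symmetric] b_def[symmetric]
    by (simp add: inner_add_left inner_add_right i power2_eq_square algebra_simps)
  also have "\<dots> \<le> ((1 + m\<^sup>2) * (1 + x\<^sup>2)) * n\<^sup>2"
    by (intro mult_right_mono) (auto simp: algebra_simps)
  finally have B: "(norm B)\<^sup>2 \<le> (1 + m\<^sup>2) * (1 + x\<^sup>2) * n\<^sup>2" .
  \<comment> \<open>With c m = 4 (1 + m^2) the source term costs only a quarter of m (1 + x^2)
    |f|^2.\<close>
  define c where "c = 4 * (1 / m + m)"
  have c: "c > 0" "c * m = 4 * (1 + m\<^sup>2)"
    using m by (simp_all add: c_def add_pos_pos field_simps power2_eq_square)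
  have "2 * (g \<bullet> B) \<le> 2 * (norm g * norm B)" using norm_cauchy_schwarz[of g B] by simp
  also have "\<dots> \<le> c * (norm g)\<^sup>2 + (norm B)\<^sup>2 / c"
  proof -
    define p where "p = sqrt c"
    have p: "p > 0" "p\<^sup>2 = c" using c by (simp_all add: p_def)
    show ?thesis
      using sum_squares_bound[of "p * norm g" "norm B / p"] p
      by (simp add: power_mult_distrib power_divide)
  qed
  also have "(norm B)\<^sup>2 / c \<le> m / 4 * (1 + x\<^sup>2) * n\<^sup>2"
  proof -
    have "(norm B)\<^sup>2 \<le> c * (m / 4 * (1 + x\<^sup>2) * n\<^sup>2)"
    proof -
      have "c * (m / 4 * (1 + x\<^sup>2) * n\<^sup>2) = (c * m) / 4 * ((1 + x\<^sup>2) * n\<^sup>2)" by (simp add: mult_ac)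
      also have "\<dots> = (1 + m\<^sup>2) * (1 + x\<^sup>2) * n\<^sup>2" unfolding c(2) by (simp add: mult.assoc)
      finally have "c * (m / 4 * (1 + x\<^sup>2) * n\<^sup>2) = (1 + m\<^sup>2) * (1 + x\<^sup>2) * n\<^sup>2" .
      then show ?thesis by (simp only: B)
    qed
    then show ?thesis using c(1) by (simp add: divide_le_eq mult.commute)
  qed
  finally have 3: "2 * (g \<bullet> B) \<le> c * (norm g)\<^sup>2 + m / 4 * (1 + x\<^sup>2) * n\<^sup>2" by simp
  have "m * x\<^sup>2 * n\<^sup>2 \<ge> 0" "m * n\<^sup>2 \<ge> 0" using m by auto
  then show ?thesis
    unfolding B_def[symmetric] eq n_def[symmetric] c_def[symmetric]
    using 1 2 3 by (simp add: algebra_simps)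
qed

text \<open>What integrating the energy identity requires of a pointwise representative: a
  continuous derivative, integrability of all products, and decay that removes the boundary
  terms.\<close>

definition regular :: "(real \<Rightarrow> complex^2) \<Rightarrow> (real \<Rightarrow> complex^2) \<Rightarrow> bool" where
  "regular f f' \<longleftrightarrow> (\<forall>x. (f has_vector_derivative f' x) (at x)) \<and> (\<forall>x. isCont f' x) \<and>
     sq_integrable f \<and> sq_integrable f' \<and> sq_integrable (\<lambda>x. x *\<^sub>R f x) \<and>
     (\<forall>F\<in>{at_top, at_bot}. (f \<longlongrightarrow> 0) F \<and> ((\<lambda>x. x *\<^sub>R f x) \<longlongrightarrow> 0) F)"

text \<open>Completing the square bounds the Gaussian by a multiple of exp (-x), which beats every
  polynomial; reflection handles the other end.\<close>

lemma tendsto_pgauss: "(pgauss p \<longlongrightarrow> 0) at_top" "(pgauss p \<longlongrightarrow> 0) at_bot"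
proof -
  have top: "(pgauss p \<longlongrightarrow> 0) at_top" for p
  proof (rule Lim_null_comparison)
    have "((\<lambda>x. exp (1/2) * norm (poly p x * exp (- x))) \<longlongrightarrow> exp (1/2) * norm (0::real)) at_top"
      by (intro tendsto_intros tendsto_poly_exp)
    then show "((\<lambda>x. exp (1/2) * norm (poly p x * exp (- x))) \<longlongrightarrow> 0) at_top" by simp
    have "norm (pgauss p x) \<le> exp (1/2) * norm (poly p x * exp (- x))" for x
    proof -
      have "- x\<^sup>2 / 2 \<le> 1/2 + - x" using sum_squares_bound[of x 1] by simp
      then have "gauss x \<le> exp (1/2) * exp (- x)"
        by (simp add: gauss_def flip: exp_add)
      from mult_left_mono[OF this, of "\<bar>poly p x\<bar>"] show ?thesis
        using gauss_pos[of x] by (simp add: pgauss_def abs_mult mult_ac abs_of_pos)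
    qed
    then show "\<forall>\<^sub>F x in at_top. norm (pgauss p x) \<le> exp (1/2) * norm (poly p x * exp (- x))" by simp
  qed
  show "(pgauss p \<longlongrightarrow> 0) at_top" by (rule top)
  have "pgauss p (- x) = pgauss (pcompose p [:0, -1:]) x" for x
    by (simp add: pgauss_def gauss_def poly_pcompose)
  then show "(pgauss p \<longlongrightarrow> 0) at_bot"
    using top[of "pcompose p [:0, -1:]"] by (simp add: filterlim_at_bot_mirror)
qed

lemma core_regular:
  assumes "u \<in> core"
  shows "\<exists>f f'. regular f f' \<and> u = abs_L2 f \<and> deriv_L2 u = abs_L2 f' \<and> mult_x u = abs_L2 (\<lambda>x. x *\<^sub>R f x)"
  using assms
proof induction
  case (phi b n)
  let ?f = "\<lambda>x. hermite n x *\<^sub>R spin b" and ?f' = "\<lambda>x. deriv (hermite n) x *\<^sub>R spin b"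
  have "regular ?f ?f'"
    unfolding regular_def
  proof (intro conjI allI ballI)
    show "(?f has_vector_derivative ?f' x) (at x)" for x
      by (auto intro!: derivative_eq_intros smooth_DERIV[OF smooth_hermite])
    show "isCont ?f' x" for x
      by (intro continuous_intros smooth_isCont smooth_deriv smooth_hermite)
    show "sq_integrable ?f" "sq_integrable ?f'" "sq_integrable (\<lambda>x. x *\<^sub>R ?f x)"
      using sq_integrable_tensor[OF sq_int_hermite] sq_integrable_tensor[OF sq_int_deriv_hermite]
        sq_integrable_tensor[OF sq_int_x_hermite] by simp_all
    fix F :: "real filter" assume "F \<in> {at_top, at_bot}"
    then have "(pgauss p \<longlongrightarrow> 0) F" for p using tendsto_pgauss by auto
    then have "(hermite n \<longlongrightarrow> 0) F" "((\<lambda>x. x * hermite n x) \<longlongrightarrow> 0) F"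
      by (auto simp: hermite_def x_pgauss)
    from this[THEN tendsto_scaleR[OF _ tendsto_const[of "spin b"]]]
    show "(?f \<longlongrightarrow> 0) F" "((\<lambda>x. x *\<^sub>R ?f x) \<longlongrightarrow> 0) F" by simp_all
  qed
  moreover have "deriv_L2 (phi b n) = abs_L2 ?f'" "mult_x (phi b n) = abs_L2 (\<lambda>x. x *\<^sub>R ?f x)"
    using weak_derivativeD(2)[OF weak_derivative_tensor[OF smooth_hermite sq_int_hermite sq_int_deriv_hermite]]
      mult_x_tensor(2)[OF sq_int_hermite sq_int_x_hermite] by (simp_all add: phi_def tensor_def)
  ultimately show ?case
    by (intro exI[of _ ?f] exI[of _ ?f'] conjI) (simp_all add: phi_def tensor_def)
next
  case (add u v)
  then obtain f f' g g' where f: "regular f f'" "u = abs_L2 f" "deriv_L2 u = abs_L2 f'"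
    "mult_x u = abs_L2 (\<lambda>x. x *\<^sub>R f x)" and g: "regular g g'" "v = abs_L2 g" "deriv_L2 v = abs_L2 g'"
    "mult_x v = abs_L2 (\<lambda>x. x *\<^sub>R g x)" by auto
  have "regular (\<lambda>x. f x + g x) (\<lambda>x. f' x + g' x)"
    using f(1) g(1) unfolding regular_def
    by (auto intro!: has_vector_derivative_add continuous_intros sq_integrable_add tendsto_add_zero
        simp: scaleR_add_right)
  moreover have "u + v = abs_L2 (\<lambda>x. f x + g x)" "deriv_L2 (u + v) = abs_L2 (\<lambda>x. f' x + g' x)"
    "mult_x (u + v) = abs_L2 (\<lambda>x. x *\<^sub>R (f x + g x))"
    using f(1) g(1) dom_add[OF core_dom core_dom, OF add.hyps]
    unfolding f(3,4) g(3,4) unfolding f(2) g(2)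
    by (simp_all add: regular_def abs_L2_algebra scaleR_add_right)
  ultimately show ?case by blast
next
  case (scaleC u c)
  then obtain f f' where f: "regular f f'" "u = abs_L2 f" "deriv_L2 u = abs_L2 f'"
    "mult_x u = abs_L2 (\<lambda>x. x *\<^sub>R f x)" by auto
  note bl = bounded_linear_vector_scalar_mult[of c]
  have x: "x *\<^sub>R (c *s f x) = c *s (x *\<^sub>R f x)" for x by (simp add: scaleR_smult_commute)
  have "regular (\<lambda>x. c *s f x) (\<lambda>x. c *s f' x)"
    using f(1) unfolding regular_def x
    by (auto intro!: bounded_linear.has_vector_derivative[OF bl] bounded_linear.isCont[OF bl]
        sq_integrable_bounded_linear[OF bl] bounded_linear.tendsto_zero[OF bl])
  moreover have "c *\<^sub>C u = abs_L2 (\<lambda>x. c *s f x)" "deriv_L2 (c *\<^sub>C u) = abs_L2 (\<lambda>x. c *s f' x)"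
    "mult_x (c *\<^sub>C u) = abs_L2 (\<lambda>x. x *\<^sub>R (c *s f x))"
    using f(1) dom_scaleC[OF core_dom, OF scaleC.hyps, of c]
    unfolding f(3,4) unfolding f(2)
    by (simp_all add: regular_def abs_L2_unary x)
  ultimately show ?case by blast
qed

text \<open>The arctangent profile has slope 2 \<zeta> at the origin and saturates at the scale
  \<open>R\<close>, so its size is at most of order |\<zeta>| R, a multiple of \<zeta>^2. In the
  last bound, after x^2 is factored out, two terms of at most m/2 remain: \<kappa> >= 2 controls the
  one with |x|, and \<kappa> >= 4 / (m \<zeta>0) the other. The lower bound \<open>\<zeta>0\<close>
  on |\<zeta>| makes \<kappa> independent of \<zeta>.\<close>

lemma weight_bounds:
  fixes m \<zeta>0 \<zeta> x :: real
  assumes m: "m > 0" and z0: "\<zeta>0 > 0" "\<zeta>0 \<le> \<bar>\<zeta>\<bar>"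
  defines "\<kappa> \<equiv> 2 + 4 / (m * \<zeta>0)"
  defines "R \<equiv> \<kappa> * \<bar>\<zeta>\<bar>"
  shows "\<bar>2 * \<zeta> * R * arctan (x / R)\<bar> \<le> 4 * \<kappa> * \<zeta>\<^sup>2"
    and "((\<lambda>x. 2 * \<zeta> * R * arctan (x / R)) has_real_derivative 2 * \<zeta> * R\<^sup>2 / (R\<^sup>2 + x\<^sup>2)) (at x)"
    and "\<bar>2 * \<zeta> * R\<^sup>2 / (R\<^sup>2 + x\<^sup>2)\<bar> \<le> 2 * \<bar>\<zeta>\<bar>"
    and "\<bar>2 * \<zeta> * R\<^sup>2 / (R\<^sup>2 + x\<^sup>2) - 2 * \<zeta>\<bar> * (1 + m * \<bar>x\<bar>) \<le> m * x\<^sup>2"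
proof -
  have z: "\<bar>\<zeta>\<bar> > 0" using z0 by linarith
  have k: "\<kappa> \<ge> 2" "\<kappa> \<ge> 4 / (m * \<zeta>0)" using m z0 by (simp_all add: \<kappa>_def)
  have R: "R > 0" using k(1) z by (simp add: R_def)
  then have R2: "R\<^sup>2 > 0" "R\<^sup>2 + x\<^sup>2 > 0" by (simp_all add: add_pos_nonneg)
  have "\<bar>arctan (x / R)\<bar> \<le> 2"
    using arctan_bounded[of "x / R"] pi_less_4 by (simp add: abs_le_iff)
  then have "\<bar>2 * \<zeta> * R\<bar> * \<bar>arctan (x / R)\<bar> \<le> \<bar>2 * \<zeta> * R\<bar> * 2" by (intro mult_left_mono) auto
  also have "\<bar>2 * \<zeta> * R\<bar> * 2 = 4 * \<kappa> * \<zeta>\<^sup>2"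
    using k(1) by (simp add: R_def abs_mult power2_eq_square)
  finally show "\<bar>2 * \<zeta> * R * arctan (x / R)\<bar> \<le> 4 * \<kappa> * \<zeta>\<^sup>2" by (simp only: abs_mult)
  show "((\<lambda>x. 2 * \<zeta> * R * arctan (x / R)) has_real_derivative 2 * \<zeta> * R\<^sup>2 / (R\<^sup>2 + x\<^sup>2)) (at x)"
    using R R2 by (auto intro!: derivative_eq_intros simp: field_simps power2_eq_square)
  have "R\<^sup>2 / (R\<^sup>2 + x\<^sup>2) \<le> 1" using R2 by (simp add: divide_le_eq)
  then have "\<bar>2 * \<zeta>\<bar> * (R\<^sup>2 / (R\<^sup>2 + x\<^sup>2)) \<le> \<bar>2 * \<zeta>\<bar> * 1" by (intro mult_left_mono) auto
  then show "\<bar>2 * \<zeta> * R\<^sup>2 / (R\<^sup>2 + x\<^sup>2)\<bar> \<le> 2 * \<bar>\<zeta>\<bar>"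
    using R2 by (simp add: abs_mult)
  have "2 * \<zeta> * R\<^sup>2 / (R\<^sup>2 + x\<^sup>2) - 2 * \<zeta> = - (2 * \<zeta> * x\<^sup>2 / (R\<^sup>2 + x\<^sup>2))"
    using R2 by (simp add: field_simps)
  then have "\<bar>2 * \<zeta> * R\<^sup>2 / (R\<^sup>2 + x\<^sup>2) - 2 * \<zeta>\<bar> = 2 * \<bar>\<zeta>\<bar> * x\<^sup>2 / (R\<^sup>2 + x\<^sup>2)"
    using R2 by (simp only: abs_minus_cancel abs_divide abs_mult abs_of_pos) simp
  then have eq: "\<bar>2 * \<zeta> * R\<^sup>2 / (R\<^sup>2 + x\<^sup>2) - 2 * \<zeta>\<bar> * (1 + m * \<bar>x\<bar>) =
      x\<^sup>2 * (2 * \<bar>\<zeta>\<bar> / (R\<^sup>2 + x\<^sup>2) + m * \<bar>\<zeta>\<bar> * (2 * \<bar>x\<bar> / (R\<^sup>2 + x\<^sup>2)))"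
    by (simp add: divide_inverse algebra_simps)
  have "2 * \<bar>\<zeta>\<bar> / (R\<^sup>2 + x\<^sup>2) \<le> 2 * \<bar>\<zeta>\<bar> / R\<^sup>2"
    using R2 by (intro divide_left_mono) auto
  also have "\<dots> \<le> m / 2"
  proof -
    have "4 * \<bar>\<zeta>\<bar> \<le> (\<kappa> * (m * \<zeta>0)) * \<bar>\<zeta>\<bar>"
      using k(2) m z0 by (intro mult_right_mono) (auto simp: divide_le_eq)
    also have "\<dots> \<le> (\<kappa> * (m * \<bar>\<zeta>\<bar>)) * \<bar>\<zeta>\<bar>"
      using k(1) m z0 by (intro mult_right_mono mult_left_mono) auto
    also have "\<dots> \<le> \<kappa> * (\<kappa> * (m * \<bar>\<zeta>\<bar>)) * \<bar>\<zeta>\<bar>"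
    proof (rule mult_right_mono)
      have "1 * (\<kappa> * (m * \<bar>\<zeta>\<bar>)) \<le> \<kappa> * (\<kappa> * (m * \<bar>\<zeta>\<bar>))"
        using k(1) m by (intro mult_right_mono) auto
      then show "\<kappa> * (m * \<bar>\<zeta>\<bar>) \<le> \<kappa> * (\<kappa> * (m * \<bar>\<zeta>\<bar>))" by simp
    qed simp
    also have "\<dots> = m * R\<^sup>2" by (simp add: R_def power2_eq_square)
    finally show ?thesis using R2 by (simp add: divide_le_eq)
  qed
  finally have 1: "2 * \<bar>\<zeta>\<bar> / (R\<^sup>2 + x\<^sup>2) \<le> m / 2" .
  have "2 * \<bar>x\<bar> / (R\<^sup>2 + x\<^sup>2) \<le> 1 / R"
    using sum_squares_bound[of R "\<bar>x\<bar>"] R R2 by (simp add: divide_le_eq) (simp add: field_simps power2_eq_square)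
  then have "m * \<bar>\<zeta>\<bar> * (2 * \<bar>x\<bar> / (R\<^sup>2 + x\<^sup>2)) \<le> m * \<bar>\<zeta>\<bar> * (1 / R)"
    using m by (intro mult_left_mono) auto
  also have "\<dots> = m / \<kappa>" using z by (simp add: R_def)
  also have "\<dots> \<le> m / 2" using k(1) m by (intro divide_left_mono) auto
  finally have "2 * \<bar>\<zeta>\<bar> / (R\<^sup>2 + x\<^sup>2) + m * \<bar>\<zeta>\<bar> * (2 * \<bar>x\<bar> / (R\<^sup>2 + x\<^sup>2)) \<le> m"
    using 1 by simp
  from mult_left_mono[OF this, of "x\<^sup>2"]
  show "\<bar>2 * \<zeta> * R\<^sup>2 / (R\<^sup>2 + x\<^sup>2) - 2 * \<zeta>\<bar> * (1 + m * \<bar>x\<bar>) \<le> m * x\<^sup>2"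
    unfolding eq by (simp add: mult.commute)
qed

text \<open>The pointwise inequality is multiplied by exp \<theta> and integrated. The bracket
  becomes a total derivative with vanishing integral, and the bounds exp (-K), exp K of the weight
  account for the two exponentials.\<close>

lemma energy_estimate:
  assumes m: "m > 0" and z0: "\<zeta>0 > 0" "\<zeta>0 \<le> \<bar>\<zeta>\<bar>" and v: "v \<in> core"
  defines "\<kappa> \<equiv> 2 + 4 / (m * \<zeta>0)"
  shows "m / 2 * exp (- (4 * \<kappa> * \<zeta>\<^sup>2)) * (norm v)\<^sup>2 \<le> 4 * (1 / m + m) * exp (4 * \<kappa> * \<zeta>\<^sup>2) *
    (norm (S1 (mult_x v) + complex_of_real m *\<^sub>C S3 v - deriv_L2 v - complex_of_real \<zeta> *\<^sub>C v))\<^sup>2"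
proof -
  obtain f f' where reg: "regular f f'" and vf: "v = abs_L2 f" "deriv_L2 v = abs_L2 f'"
    "mult_x v = abs_L2 (\<lambda>x. x *\<^sub>R f x)" using core_regular[OF v] by blast
  note bl = bounded_linear_matrix_vector_mult
  have sq: "sq_integrable f" "sq_integrable f'" "sq_integrable (\<lambda>x. x *\<^sub>R f x)"
    and d: "\<And>x. (f has_vector_derivative f' x) (at x)" and c': "\<And>x. isCont f' x"
    using reg by (simp_all add: regular_def)
  have c: "isCont f x" for x using has_vector_derivative_continuous[OF d] .
  note sqs = sq[THEN sq_integrable_bounded_linear[OF bl, of _ sigma1]]
    sq[THEN sq_integrable_bounded_linear[OF bl, of _ sigma3]]
  define R where "R = \<kappa> * \<bar>\<zeta>\<bar>"
  define \<theta> where "\<theta> x = 2 * \<zeta> * R * arctan (x / R)" for x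
  define \<theta>' where "\<theta>' x = 2 * \<zeta> * R\<^sup>2 / (R\<^sup>2 + x\<^sup>2)" for x
  define K where "K = 4 * \<kappa> * \<zeta>\<^sup>2"
  note w = weight_bounds[OF m z0, folded \<kappa>_def, folded R_def, folded \<theta>_def \<theta>'_def K_def]
  have R2: "R\<^sup>2 + x\<^sup>2 \<noteq> 0" for x
  proof -
    have "\<kappa> > 0" using m z0 by (simp add: \<kappa>_def add_pos_pos)
    then have "R > 0" using z0 by (simp add: R_def)
    then show ?thesis by (simp add: add_pos_nonneg less_imp_neq[symmetric])
  qed
  have E: "exp (- K) \<le> exp (\<theta> x)" "exp (\<theta> x) \<le> exp K" for x
    using w(1)[of x] by (simp_all add: abs_le_iff)
  define g where "g x = sigma1 *v (x *\<^sub>R f x) + m *\<^sub>R (sigma3 *v f x) - f' x - \<zeta> *\<^sub>R f x" for x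
  define q where "q x = m * ((sigma1 *v (x *\<^sub>R f x)) \<bullet> f x) + (sigma3 *v f x) \<bullet> f x" for x
  define q' where "q' x = m * ((sigma1 *v f x) \<bullet> f x) +
    2 * (f' x \<bullet> (m *\<^sub>R (sigma1 *v (x *\<^sub>R f x)) + sigma3 *v f x))" for x
  note scale = sq_integrable_bounded_linear[OF bounded_linear_scaleR_right]
  have g: "sq_integrable g"
    unfolding g_def[abs_def] by (intro sq_integrable_add sq_integrable_diff scale sq sqs)
  have vg: "S1 (mult_x v) + complex_of_real m *\<^sub>C S3 v - deriv_L2 v - complex_of_real \<zeta> *\<^sub>C v = abs_L2 g"
    unfolding vf(2,3) unfolding vf(1) g_def[abs_def] scaleR_scaleC[symmetric]
    using sq sqs by (simp add: abs_L2_unary abs_L2_algebra scale sq_integrable_add sq_integrable_diff)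
  have iq: "integrable lborel q" "integrable lborel q'"
    unfolding q_def[abs_def] q'_def[abs_def] inner_add_right inner_scaleR_right
    by (intro Bochner_Integration.integrable_add integrable_mult_right integrable_inner sq sqs)+
  have x1: "sigma1 *v (x *\<^sub>R f x) = x *\<^sub>R (sigma1 *v f x)" for x
    by (rule matrix_vector_mult_scaleR_complex)
  have q_deriv: "(q has_real_derivative q' x) (at x)" for x
  proof -
    have dxf: "((\<lambda>x. x *\<^sub>R f x) has_vector_derivative f x + x *\<^sub>R f' x) (at x)"
      using has_vector_derivative_scaleR[OF DERIV_ident d[of x]] by (simp add: add.commute)
    note i = bounded_bilinear.has_vector_derivative[OF bounded_bilinear_inner]
    have 1: "((\<lambda>x. (sigma1 *v (x *\<^sub>R f x)) \<bullet> f x) has_real_derivative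
        (sigma1 *v (x *\<^sub>R f x)) \<bullet> f' x + (sigma1 *v (f x + x *\<^sub>R f' x)) \<bullet> f x) (at x)"
      unfolding has_real_derivative_iff_has_vector_derivative
      by (rule i[OF has_vector_derivative_sigma[OF dxf] d])
    have 2: "((\<lambda>x. (sigma3 *v f x) \<bullet> f x) has_real_derivative
        (sigma3 *v f x) \<bullet> f' x + (sigma3 *v f' x) \<bullet> f x) (at x)"
      unfolding has_real_derivative_iff_has_vector_derivative
      by (rule i[OF has_vector_derivative_sigma[OF d] d])
    have "m * ((sigma1 *v (x *\<^sub>R f x)) \<bullet> f' x + (sigma1 *v (f x + x *\<^sub>R f' x)) \<bullet> f x) +
        ((sigma3 *v f x) \<bullet> f' x + (sigma3 *v f' x) \<bullet> f x) = q' x"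
      unfolding q'_def
      by (simp add: matrix_vector_right_distrib matrix_vector_mult_scaleR_complex inner_simps
          sigma_algebra(1,2) inner_commute[of _ "f' x"] algebra_simps)
    then show ?thesis
      unfolding q_def[abs_def] using DERIV_add[OF DERIV_cmult[OF 1, of m] 2] by simp
  qed
  have q_lim: "(q \<longlongrightarrow> 0) F" if "F = at_top \<or> F = at_bot" for F
  proof -
    have l: "(f \<longlongrightarrow> 0) F" "((\<lambda>x. x *\<^sub>R f x) \<longlongrightarrow> 0) F" using reg that by (auto simp: regular_def)
    have "(q \<longlongrightarrow> m * ((0::complex^2) \<bullet> 0) + (0::complex^2) \<bullet> 0) F"
      unfolding q_def[abs_def]
      by (intro tendsto_add tendsto_mult tendsto_const tendsto_inner l
          bounded_linear.tendsto_zero[OF bl])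
    then show ?thesis by simp
  qed
  \<comment> \<open>The derivative of exp \<theta> times \<open>q\<close>, where \<open>q\<close> is
    the quadratic form of the multiplier.\<close>
  define F' where "F' x = exp (\<theta> x) * (\<theta>' x * q x + q' x)" for x
  have th_cont: "isCont \<theta> x" "isCont \<theta>' x" for x
  proof -
    show "isCont \<theta> x" using DERIV_isCont[OF w(2)] by (simp add: \<theta>_def[abs_def])
    show "isCont \<theta>' x" unfolding \<theta>'_def[abs_def] using R2 by (intro continuous_intros) auto
  qed
  have F'_cont: "isCont F' x" for x
  proof -
    have "isCont q' x"
      unfolding q'_def[abs_def] by (intro continuous_intros isCont_matrix_vector_mult c c')
    then show ?thesis
      unfolding F'_def[abs_def] using DERIV_isCont[OF q_deriv[of x]] th_cont[of x]
      by (intro continuous_intros) auto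
  qed
  have F'_int: "integrable lborel F'"
  proof (rule Bochner_Integration.integrable_bound)
    show "integrable lborel (\<lambda>x. exp K * (2 * \<bar>\<zeta>\<bar> * \<bar>q x\<bar> + \<bar>q' x\<bar>))"
      using iq by (intro integrable_mult_right Bochner_Integration.integrable_add integrable_abs)
    show "F' \<in> borel_measurable lborel"
      using borel_measurable_continuous_onI[of F'] F'_cont by (simp add: continuous_at_imp_continuous_on)
    have "norm (F' x) \<le> norm (exp K * (2 * \<bar>\<zeta>\<bar> * \<bar>q x\<bar> + \<bar>q' x\<bar>))" for x
    proof -
      have "\<bar>\<theta>' x * q x + q' x\<bar> \<le> 2 * \<bar>\<zeta>\<bar> * \<bar>q x\<bar> + \<bar>q' x\<bar>"
        using abs_triangle_ineq[of "\<theta>' x * q x" "q' x"] mult_right_mono[OF w(3)[of x], of "\<bar>q x\<bar>"]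
        by (simp add: abs_mult)
      then have "exp (\<theta> x) * \<bar>\<theta>' x * q x + q' x\<bar> \<le> exp K * (2 * \<bar>\<zeta>\<bar> * \<bar>q x\<bar> + \<bar>q' x\<bar>)"
        using E(2)[of x] by (intro mult_mono) auto
      then show ?thesis by (simp add: F'_def abs_mult)
    qed
    then show "AE x in lborel. norm (F' x) \<le> norm (exp K * (2 * \<bar>\<zeta>\<bar> * \<bar>q x\<bar> + \<bar>q' x\<bar>))" by simp
  qed
  have "(LINT x|lborel. F' x) = 0"
  proof (rule integral_derivative_eq_0[OF _ F'_cont F'_int])
    show "((\<lambda>x. exp (\<theta> x) * q x) has_vector_derivative F' x) (at x)" for x
    proof -
      have "((\<lambda>x. exp (\<theta> x)) has_real_derivative exp (\<theta> x) * \<theta>' x) (at x)"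
        using DERIV_chain2[OF DERIV_exp w(2)[of x]] by (simp add: \<theta>_def[abs_def])
      from DERIV_mult[OF this q_deriv[of x]] show ?thesis
        unfolding has_real_derivative_iff_has_vector_derivative[symmetric]
        by (simp add: F'_def algebra_simps)
    qed
    have "((\<lambda>x. exp (\<theta> x) * q x) \<longlongrightarrow> 0) F" if F: "F = at_top \<or> F = at_bot" for F
    proof (rule Lim_null_comparison)
      show "((\<lambda>x. exp K * \<bar>q x\<bar>) \<longlongrightarrow> 0) F"
        using tendsto_mult[OF tendsto_const[of "exp K"] tendsto_rabs_zero[OF q_lim[OF F]]] by simp
      show "\<forall>\<^sub>F x in F. norm (exp (\<theta> x) * q x) \<le> exp K * \<bar>q x\<bar>"
        using E(2) by (intro always_eventually allI) (auto simp: abs_mult intro!: mult_right_mono)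
    qed
    then show "((\<lambda>x. exp (\<theta> x) * q x) \<longlongrightarrow> 0) at_top" "((\<lambda>x. exp (\<theta> x) * q x) \<longlongrightarrow> 0) at_bot"
      by auto
  qed
  have point: "m / 2 * exp (- K) * (norm (f x))\<^sup>2 \<le> 4 * (1 / m + m) * exp K * (norm (g x))\<^sup>2 + F' x" for x
  proof -
    have "m / 2 * (norm (f x))\<^sup>2 \<le> 4 * (1 / m + m) * (norm (g x))\<^sup>2 + (\<theta>' x * q x + (m * ((sigma1 *v f x) \<bullet> f x) +
        2 * (f' x \<bullet> ((m * x) *\<^sub>R (sigma1 *v f x) + sigma3 *v f x))))"
      by (rule energy_pointwise[OF m w(4)]) (simp_all add: g_def q_def x1)
    then have "m / 2 * (norm (f x))\<^sup>2 \<le> 4 * (1 / m + m) * (norm (g x))\<^sup>2 + (\<theta>' x * q x + q' x)"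
      by (simp add: q'_def x1)
    from mult_left_mono[OF this, of "exp (\<theta> x)"]
    have "exp (\<theta> x) * (m / 2 * (norm (f x))\<^sup>2) \<le> exp (\<theta> x) * (4 * (1 / m + m) * (norm (g x))\<^sup>2) + F' x"
      by (simp add: F'_def distrib_left)
    moreover have "exp (- K) * (m / 2 * (norm (f x))\<^sup>2) \<le> exp (\<theta> x) * (m / 2 * (norm (f x))\<^sup>2)"
      using E(1) m by (intro mult_right_mono) auto
    moreover have "exp (\<theta> x) * (4 * (1 / m + m) * (norm (g x))\<^sup>2) \<le> exp K * (4 * (1 / m + m) * (norm (g x))\<^sup>2)"
      using E(2) m by (intro mult_right_mono) (auto simp: add_nonneg_nonneg)
    ultimately have "exp (- K) * (m / 2 * (norm (f x))\<^sup>2) \<le>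
        exp K * (4 * (1 / m + m) * (norm (g x))\<^sup>2) + F' x"
      by (meson add_right_mono order_trans)
    then show ?thesis by (simp only: mult_ac)
  qed
  have if2: "integrable lborel (\<lambda>x. (norm (f x))\<^sup>2)" and ig2: "integrable lborel (\<lambda>x. (norm (g x))\<^sup>2)"
    using sq(1) g by (simp_all add: sq_integrable_def)
  have "(LINT x|lborel. m / 2 * exp (- K) * (norm (f x))\<^sup>2) \<le>
      (LINT x|lborel. 4 * (1 / m + m) * exp K * (norm (g x))\<^sup>2 + F' x)"
    by (intro integral_mono integrable_mult_right if2 ig2 Bochner_Integration.integrable_add F'_int point)
  also have "\<dots> = 4 * (1 / m + m) * exp K * (LINT x|lborel. (norm (g x))\<^sup>2)"
    using \<open>(LINT x|lborel. F' x) = 0\<close>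
    by (subst Bochner_Integration.integral_add[OF integrable_mult_right[OF ig2] F'_int]) simp
  finally show ?thesis
    unfolding vg unfolding vf(1) norm_abs_L2[OF g] norm_abs_L2[OF sq(1)] K_def[symmetric] by simp
qed

lemma core_approx:
  assumes "diagonalised s m \<mu> e f" "u \<in> airy_dirac_dom"
  obtains U where "\<And>n. U n \<in> core" "U \<longlonglongrightarrow> u" "(\<lambda>n. airy s m (U n)) \<longlonglongrightarrow> airy s m u"
  using that[OF K_approx[OF assms(1), where y = "airy s m u", unfolded K_airy[OF assms]]] .

lemma resolvent_estimate_large:
  assumes m: "m > 0" and z0: "\<zeta>0 > 0"
  obtains \<beta> \<kappa> where "\<beta> > 0" "\<kappa> > 0"
    "\<And>\<zeta> u. \<zeta>0 \<le> \<bar>\<zeta>\<bar> \<Longrightarrow> u \<in> airy_dirac_dom \<Longrightarrow>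
       \<beta> * exp (- \<kappa> * \<zeta>\<^sup>2) * norm u \<le> norm (airy 1 m u - complex_of_real \<zeta> *\<^sub>C u)"
proof -
  define k where "k = 2 + 4 / (m * \<zeta>0)"
  define c where "c = 4 * (1 / m + m)"
  \<comment> \<open>Dividing the energy estimate by exp K leaves m/2 exp (- 2 K) on one side and
    \<open>c\<close> on the other; \<beta>^2 is their quotient without the exponential.\<close>
  define \<beta> where "\<beta> = sqrt (m / (2 * c))"
  have k: "k > 0" using m z0 by (simp add: k_def add_pos_pos)
  have c: "c > 0" using m by (simp add: c_def add_pos_pos)
  have b: "\<beta> > 0" "\<beta>\<^sup>2 = m / (2 * c)" using c m by (simp_all add: \<beta>_def)
  have core: "\<beta> * exp (- (4 * k) * \<zeta>\<^sup>2) * norm u \<le> norm (airy 1 m u - complex_of_real \<zeta> *\<^sub>C u)"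
    if "\<zeta>0 \<le> \<bar>\<zeta>\<bar>" "u \<in> core" for \<zeta> u
  proof -
    define K where "K = 4 * k * \<zeta>\<^sup>2"
    define N where "N = norm (airy 1 m u - complex_of_real \<zeta> *\<^sub>C u)"
    have "N = norm (fourier (airy 1 m u - complex_of_real \<zeta> *\<^sub>C u))"
      by (simp add: norm_fourier N_def)
    also have "\<dots> = norm (S1 (mult_x (fourier u)) + complex_of_real m *\<^sub>C S3 (fourier u) -
        deriv_L2 (fourier u) - complex_of_real \<zeta> *\<^sub>C fourier u)"
      by (simp add: fourier_diff fourier_scaleC fourier_airy[OF that(2)])
    finally have "m / 2 * exp (- K) * (norm u)\<^sup>2 \<le> c * exp K * N\<^sup>2"
      using energy_estimate[OF m z0 that(1) fourier_core[OF that(2)], folded k_def c_def]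
      by (simp add: norm_fourier K_def)
    then have "exp (- K) * (m / 2 * exp (- K) * (norm u)\<^sup>2) \<le> exp (- K) * (c * exp K * N\<^sup>2)"
      by (intro mult_left_mono) auto
    also have "exp (- K) * (c * exp K * N\<^sup>2) = c * N\<^sup>2" by (simp add: exp_minus)
    finally have "(\<beta> * exp (- K) * norm u)\<^sup>2 \<le> N\<^sup>2"
      using c by (simp add: power_mult_distrib b(2) field_simps) (simp add: power2_eq_square mult_ac)
    moreover have "N \<ge> 0" by (simp add: N_def)
    ultimately have "\<beta> * exp (- K) * norm u \<le> N" by (rule power2_le_imp_le)
    then show ?thesis unfolding N_def K_def mult_minus_left .
  qed
  note dg = diagonalised_airy[OF m]
  have "\<beta> * exp (- (4 * k) * \<zeta>\<^sup>2) * norm u \<le> norm (airy 1 m u - complex_of_real \<zeta> *\<^sub>C u)"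
    if z: "\<zeta>0 \<le> \<bar>\<zeta>\<bar>" and u: "u \<in> airy_dirac_dom" for \<zeta> u
  proof -
    obtain U where U: "\<And>n. U n \<in> core" "U \<longlonglongrightarrow> u" "(\<lambda>n. airy 1 m (U n)) \<longlonglongrightarrow> airy 1 m u"
      using core_approx[OF dg u] by blast
    show ?thesis
    proof (rule LIMSEQ_le)
      show "(\<lambda>n. \<beta> * exp (- (4 * k) * \<zeta>\<^sup>2) * norm (U n)) \<longlonglongrightarrow> \<beta> * exp (- (4 * k) * \<zeta>\<^sup>2) * norm u"
        by (intro tendsto_intros U)
      show "(\<lambda>n. norm (airy 1 m (U n) - complex_of_real \<zeta> *\<^sub>C U n)) \<longlonglongrightarrow>
          norm (airy 1 m u - complex_of_real \<zeta> *\<^sub>C u)"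
        by (intro tendsto_intros tendsto_scaleC U)
    qed (use core[OF z U(1)] in auto)
  qed
  then show ?thesis using b(1) k by (intro that[of \<beta> "4 * k"]) auto
qed

section \<open>The resolvent\<close>

text \<open>Since (1 - y)(1 + 2 y) >= 1 on the interval from 0 to 1/2. It converts the polynomial
  loss for small parameters into an exponential one.\<close>

lemma exp_le_one_minus:
  fixes y :: real
  assumes "0 \<le> y" "y \<le> 1/2"
  shows "exp (- (2 * y)) \<le> 1 - y"
proof -
  have "1 = (1 - y) * (1 + 2 * y) - y * (1 - 2 * y)" by (simp add: algebra_simps)
  also have "\<dots> \<le> (1 - y) * (1 + 2 * y)" using assms by simp
  also have "\<dots> \<le> (1 - y) * exp (2 * y)" using assms exp_ge_add_one_self[of "2 * y"] by (intro mult_left_mono) auto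
  finally have "1 / exp (2 * y) \<le> 1 - y" by (simp add: divide_le_eq)
  then show ?thesis by (simp add: exp_minus inverse_eq_divide)
qed

lemma resolvent_estimate_real:
  assumes m: "m > 0"
  obtains c where "c > 0"
    "\<And>\<zeta> u. u \<in> airy_dirac_dom \<Longrightarrow> m * exp (- c * \<zeta>\<^sup>2) * norm u \<le> norm (airy 1 m u - complex_of_real \<zeta> *\<^sub>C u)"
proof -
  obtain C where C: "C > 0" "\<And>\<zeta> u. u \<in> airy_dirac_dom \<Longrightarrow>
       (m\<^sup>2 - C * \<zeta>\<^sup>2) * (norm u)\<^sup>2 \<le> (norm (airy 1 m u - complex_of_real \<zeta> *\<^sub>C u))\<^sup>2"
    using resolvent_estimate_small[OF m] by blast
  \<comment> \<open>Chosen so that C \<zeta>^2 / m^2 is at most 1/2 for |\<zeta>| <= z0, the range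
    of \<open>exp_le_one_minus\<close>.\<close>
  define z0 where "z0 = m / sqrt (2 * C)"
  have z0: "z0 > 0" "z0\<^sup>2 = m\<^sup>2 / (2 * C)" using m C(1) by (simp_all add: z0_def power_divide)
  obtain \<beta> \<kappa> where bk: "\<beta> > 0" "\<kappa> > 0" "\<And>\<zeta> u. z0 \<le> \<bar>\<zeta>\<bar> \<Longrightarrow> u \<in> airy_dirac_dom \<Longrightarrow>
       \<beta> * exp (- \<kappa> * \<zeta>\<^sup>2) * norm u \<le> norm (airy 1 m u - complex_of_real \<zeta> *\<^sub>C u)"
    using resolvent_estimate_large[OF m z0(1)] by blast
  \<comment> \<open>The first summand serves small parameters and \<kappa> the energy estimate; the
    last one turns the factor m / \<beta> into an exponential, using \<zeta>^2 >= z0^2.\<close>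
  define c where "c = C / m\<^sup>2 + (\<kappa> + m / (\<beta> * z0\<^sup>2))"
  have c: "c > 0" using C(1) m bk(1,2) z0(1) by (simp add: c_def add_pos_pos)
  have "m * exp (- c * \<zeta>\<^sup>2) * norm u \<le> norm (airy 1 m u - complex_of_real \<zeta> *\<^sub>C u)"
    if u: "u \<in> airy_dirac_dom" for \<zeta> u
  proof (cases "z0 \<le> \<bar>\<zeta>\<bar>")
    case True
    have z: "z0\<^sup>2 \<le> \<zeta>\<^sup>2" using True z0(1) by (simp add: abs_le_square_iff[symmetric])
    have "m / \<beta> = m / (\<beta> * z0\<^sup>2) * z0\<^sup>2" using z0(1) by simp
    also have "\<dots> \<le> m / (\<beta> * z0\<^sup>2) * \<zeta>\<^sup>2" using z m bk(1) by (intro mult_left_mono) auto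
    also have "\<dots> \<le> (c - \<kappa>) * \<zeta>\<^sup>2"
      using C(1) by (intro mult_right_mono) (auto simp: c_def)
    also have "\<dots> \<le> exp ((c - \<kappa>) * \<zeta>\<^sup>2)" using exp_ge_add_one_self[of "(c - \<kappa>) * \<zeta>\<^sup>2"] by linarith
    finally have "m \<le> \<beta> * exp ((c - \<kappa>) * \<zeta>\<^sup>2)" using bk(1) by (simp add: divide_le_eq mult.commute)
    then have "m * exp (- c * \<zeta>\<^sup>2) \<le> \<beta> * exp ((c - \<kappa>) * \<zeta>\<^sup>2) * exp (- c * \<zeta>\<^sup>2)"
      by (intro mult_right_mono) auto
    also have "\<dots> = \<beta> * exp (- \<kappa> * \<zeta>\<^sup>2)"
      by (simp add: mult.assoc exp_add[symmetric] algebra_simps)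
    finally have "m * exp (- c * \<zeta>\<^sup>2) * norm u \<le> \<beta> * exp (- \<kappa> * \<zeta>\<^sup>2) * norm u"
      by (intro mult_right_mono) auto
    then show ?thesis using bk(3)[OF True u] by linarith
  next
    case False
    then have "\<zeta>\<^sup>2 \<le> z0\<^sup>2" using z0(1) by (simp add: abs_le_square_iff[symmetric])
    then have "C * \<zeta>\<^sup>2 / m\<^sup>2 \<le> 1/2" using m C(1) by (simp add: z0(2) field_simps)
    then have "exp (- (2 * (C * \<zeta>\<^sup>2 / m\<^sup>2))) \<le> 1 - C * \<zeta>\<^sup>2 / m\<^sup>2"
      using C(1) by (intro exp_le_one_minus) auto
    then have "m\<^sup>2 * exp (- (2 * (C * \<zeta>\<^sup>2 / m\<^sup>2))) \<le> m\<^sup>2 * (1 - C * \<zeta>\<^sup>2 / m\<^sup>2)"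
      by (intro mult_left_mono) auto
    also have "\<dots> = m\<^sup>2 - C * \<zeta>\<^sup>2" using m by (simp add: field_simps)
    finally have le: "m\<^sup>2 * exp (- (2 * (C * \<zeta>\<^sup>2 / m\<^sup>2))) \<le> m\<^sup>2 - C * \<zeta>\<^sup>2" .
    have "m * exp (- c * \<zeta>\<^sup>2) * norm u \<le> m * exp (- (C * \<zeta>\<^sup>2 / m\<^sup>2)) * norm u"
    proof (intro mult_right_mono mult_left_mono)
      have "C / m\<^sup>2 * \<zeta>\<^sup>2 \<le> c * \<zeta>\<^sup>2"
        using m bk by (intro mult_right_mono) (auto simp: c_def)
      then show "exp (- c * \<zeta>\<^sup>2) \<le> exp (- (C * \<zeta>\<^sup>2 / m\<^sup>2))" by simp
    qed (use m in auto)
    also have "\<dots> \<le> norm (airy 1 m u - complex_of_real \<zeta> *\<^sub>C u)"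
    proof (rule power2_le_imp_le)
      have "(m * exp (- (C * \<zeta>\<^sup>2 / m\<^sup>2)) * norm u)\<^sup>2 = m\<^sup>2 * exp (- (2 * (C * \<zeta>\<^sup>2 / m\<^sup>2))) * (norm u)\<^sup>2"
        by (simp add: power_mult_distrib exp_double[symmetric])
      also have "\<dots> \<le> (m\<^sup>2 - C * \<zeta>\<^sup>2) * (norm u)\<^sup>2" by (intro mult_right_mono le) auto
      also have "\<dots> \<le> (norm (airy 1 m u - complex_of_real \<zeta> *\<^sub>C u))\<^sup>2" by (rule C(2)[OF u])
      finally show "(m * exp (- (C * \<zeta>\<^sup>2 / m\<^sup>2)) * norm u)\<^sup>2 \<le> (norm (airy 1 m u - complex_of_real \<zeta> *\<^sub>C u))\<^sup>2" .
    qed simp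
    finally show ?thesis .
  qed
  with c show ?thesis using that by blast
qed

section \<open>Removing the imaginary part of the spectral parameter by translation\<close>

lemma translate_diff: "translate b (u - v) = translate b u - translate b v"
  using translate_add[of b u "- v"] translate_scaleC[of b "-1" v] by (simp add: scaleC_minus_left)

lemma airy_translate:
  assumes "u \<in> airy_dirac_dom"
  shows "translate b u \<in> airy_dirac_dom"
    "airy 1 m (translate b u) = translate b (airy 1 m u) + (\<i> * complex_of_real b) *\<^sub>C translate b u"
proof -
  note w = weak_derivativeD[OF weak_derivative_translate[OF weak_derivative_deriv_L2[OF dom_H1[OF assms]], of b]]
  note x = mult_x_translate[OF dom_x[OF assms], of b]
  show "translate b u \<in> airy_dirac_dom" using w x by (simp add: airy_dirac_dom_def)
  show "airy 1 m (translate b u) = translate b (airy 1 m u) + (\<i> * complex_of_real b) *\<^sub>C translate b u"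
    unfolding airy_def w(2) x(2) by (simp add: translate_add translate_scaleC translate_matrix scaleC_add_right translate_diff)
qed

lemma airy_translate_shift:
  assumes "u \<in> airy_dirac_dom"
  shows "airy 1 m (translate (Im z) u) - z *\<^sub>C translate (Im z) u =
    translate (Im z) (airy 1 m u - complex_of_real (Re z) *\<^sub>C u)"
proof -
  have z: "z *\<^sub>C w = complex_of_real (Re z) *\<^sub>C w + (\<i> * complex_of_real (Im z)) *\<^sub>C w" for w :: L2
    using complex_eq[of z] by (simp add: scaleC_add_left[symmetric])
  show ?thesis
    unfolding airy_translate(2)[OF assms] z[of "translate (Im z) u"]
    by (simp add: translate_diff translate_scaleC)
qed

lemma resolvent_estimate:
  assumes m: "m > 0"
  obtains c where "c > 0"
    "\<And>z u. u \<in> airy_dirac_dom \<Longrightarrow> m * exp (- c * (Re z)\<^sup>2) * norm u \<le> norm (airy 1 m u - z *\<^sub>C u)"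
proof -
  obtain c where c: "c > 0"
    "\<And>\<zeta> u. u \<in> airy_dirac_dom \<Longrightarrow> m * exp (- c * \<zeta>\<^sup>2) * norm u \<le> norm (airy 1 m u - complex_of_real \<zeta> *\<^sub>C u)"
    using resolvent_estimate_real[OF m] by blast
  have "m * exp (- c * (Re z)\<^sup>2) * norm u \<le> norm (airy 1 m u - z *\<^sub>C u)" if u: "u \<in> airy_dirac_dom" for z u
  proof -
    define w where "w = translate (- Im z) u"
    have w: "w \<in> airy_dirac_dom" "u = translate (Im z) w" using airy_translate(1)[OF u] by (simp_all add: w_def)
    show ?thesis using c(2)[OF w(1), of "Re z"] unfolding w(2) airy_translate_shift[OF w(1)] by simp
  qed
  with c(1) show ?thesis using that by blast
qed

text \<open>Method of continuity: along the segment from \<open>0\<close> to \<open>z\<close> the estimate bounds the inverse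
  uniformly, and the fixed point theorem propagates surjectivity in steps of fixed length.\<close>

lemma airy_surj:
  assumes m: "m > 0"
  shows "\<exists>u\<in>airy_dirac_dom. airy 1 m u - z *\<^sub>C u = y"
proof -
  obtain c where c: "c > 0"
    "\<And>z u. u \<in> airy_dirac_dom \<Longrightarrow> m * exp (- c * (Re z)\<^sup>2) * norm u \<le> norm (airy 1 m u - z *\<^sub>C u)"
    using resolvent_estimate[OF m] by blast
  define \<delta> where "\<delta> = m * exp (- c * (Re z)\<^sup>2)"
  have \<delta>: "\<delta> > 0" using m by (simp add: \<delta>_def)
  \<comment> \<open>The real part only shrinks along the segment, so the constant \<delta> belonging
    to \<open>z\<close> serves all of its points.\<close>
  have low: "\<delta> * norm u \<le> norm (airy 1 m u - (complex_of_real t * z) *\<^sub>C u)"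
    if t: "0 \<le> t" "t \<le> 1" and u: "u \<in> airy_dirac_dom" for t u
  proof -
    have "t\<^sup>2 \<le> 1" using t by (simp add: power_le_one)
    then have "c * (t\<^sup>2 * (Re z)\<^sup>2) \<le> c * (1 * (Re z)\<^sup>2)"
      using c(1) by (intro mult_left_mono mult_right_mono) auto
    then have "\<delta> \<le> m * exp (- c * (Re (complex_of_real t * z))\<^sup>2)"
      using m by (simp add: \<delta>_def power_mult_distrib)
    from mult_right_mono[OF this, of "norm u"] c(2)[OF u, of "complex_of_real t * z"]
    show ?thesis by simp
  qed
  \<comment> \<open>With this many steps each one changes the spectral parameter by less than
    \<delta>, so the contraction ratio \<open>q\<close> below is less than 1.\<close>
  define N where "N = nat \<lceil>cmod z / \<delta>\<rceil> + 1"
  have N: "cmod z / \<delta> < real N" "N > 0" unfolding N_def by linarith+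
  have "\<forall>y. \<exists>u\<in>airy_dirac_dom. airy 1 m u - (complex_of_real (real k / real N) * z) *\<^sub>C u = y" if "k \<le> N" for k
    using that
  proof (induction k)
    case 0
    show ?case
      using K_dom[OF diagonalised_airy[OF m]] airy_K[OF diagonalised_airy[OF m]] by force
  next
    case (Suc k)
    define t where "t = real k / real N"
    define t' where "t' = real (Suc k) / real N"
    have t: "0 \<le> t" "t \<le> 1" using Suc.prems N(2) by (simp_all add: t_def)
    define q where "q = cmod (complex_of_real (t' - t) * z) / \<delta>"
    have "t' - t = 1 / real N" by (simp add: t_def t'_def diff_divide_distrib[symmetric])
    then have "q = (cmod z / \<delta>) / real N"
      unfolding q_def norm_mult norm_of_real by simp
    then have q: "0 \<le> q" "q < 1" using N \<delta> by (simp_all add: divide_less_eq mult.commute)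
    obtain G where G: "\<And>y. G y \<in> airy_dirac_dom" "\<And>y. airy 1 m (G y) - (complex_of_real t * z) *\<^sub>C G y = y"
      using Suc by (metis Suc_leD t_def)
    have Gdiff: "\<delta> * norm (G y - G y') \<le> norm (y - y')" for y y'
    proof -
      have "airy 1 m (G y - G y') - (complex_of_real t * z) *\<^sub>C (G y - G y') = y - y'"
        unfolding airy_diff[OF G(1) G(1)]
        using G(2)[of y] G(2)[of y'] by (simp add: scaleC_diff_right algebra_simps)
      then show ?thesis using low[OF t dom_diff[OF G(1) G(1)], of y y'] by simp
    qed
    show ?case
    proof
      fix y
      \<comment> \<open>A fixed point solves the equation at \<open>t'\<close>: the increment of the
        spectral parameter is moved to the right-hand side.\<close>
      define \<Phi> where "\<Phi> u = G (y + (complex_of_real (t' - t) * z) *\<^sub>C u)" for u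
      have "dist (\<Phi> u) (\<Phi> v) \<le> q * dist u v" for u v
      proof -
        have "\<delta> * norm (\<Phi> u - \<Phi> v) \<le> norm ((complex_of_real (t' - t) * z) *\<^sub>C (u - v))"
          using Gdiff[of "y + (complex_of_real (t' - t) * z) *\<^sub>C u" "y + (complex_of_real (t' - t) * z) *\<^sub>C v"]
          by (simp add: \<Phi>_def scaleC_diff_right)
        also have "\<dots> = (\<delta> * q) * norm (u - v)"
          using \<delta> by (simp add: norm_scaleC q_def)
        finally have "\<delta> * norm (\<Phi> u - \<Phi> v) \<le> \<delta> * (q * norm (u - v))" by (simp add: mult.assoc)
        then show ?thesis using \<delta> by (simp add: dist_norm)
      qed
      then obtain u where u: "\<Phi> u = u"
        using banach_fix_type[OF q, of \<Phi>] by blast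
      have "u \<in> airy_dirac_dom" using G(1) u by (metis \<Phi>_def)
      moreover have "airy 1 m u - (complex_of_real t' * z) *\<^sub>C u = y"
      proof -
        have "airy 1 m u - (complex_of_real t * z) *\<^sub>C u = y + (complex_of_real (t' - t) * z) *\<^sub>C u"
          using G(2) u by (metis \<Phi>_def)
        also have "(complex_of_real (t' - t) * z) *\<^sub>C u = (complex_of_real t' * z) *\<^sub>C u - (complex_of_real t * z) *\<^sub>C u"
          by (simp add: scaleC_diff_left[symmetric] left_diff_distrib)
        finally show ?thesis by (simp add: algebra_simps)
      qed
      ultimately show "\<exists>u\<in>airy_dirac_dom. airy 1 m u - (complex_of_real (real (Suc k) / real N) * z) *\<^sub>C u = y"
        unfolding t'_def by blast
    qed
  qed
  from this[of N] N(2) show ?thesis by auto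
qed

section \<open>Bijectivity, bounds and compactness of the resolvent\<close>

context
  fixes m :: real
  assumes m: "m > 0"
begin

abbreviation (input) "Rsv \<equiv> resolvent airy_dirac_dom (airy_dirac m)"

lemma airy_dirac_bij: "bij_betw (\<lambda>u. airy_dirac m u - z *\<^sub>C u) airy_dirac_dom UNIV"
proof -
  obtain c where c: "c > 0"
    "\<And>z u. u \<in> airy_dirac_dom \<Longrightarrow> m * exp (- c * (Re z)\<^sup>2) * norm u \<le> norm (airy 1 m u - z *\<^sub>C u)"
    using resolvent_estimate[OF m] by blast
  have "inj_on (\<lambda>u. airy_dirac m u - z *\<^sub>C u) airy_dirac_dom"
  proof (rule inj_onI)
    fix u v assume uv: "u \<in> airy_dirac_dom" "v \<in> airy_dirac_dom" "airy_dirac m u - z *\<^sub>C u = airy_dirac m v - z *\<^sub>C v"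
    have "airy 1 m (u - v) - z *\<^sub>C (u - v) = 0"
      unfolding airy_diff[OF uv(1,2)] unfolding airy_1 scaleC_diff_right using uv(3) by (simp add: algebra_simps)
    then have "m * exp (- c * (Re z)\<^sup>2) * norm (u - v) \<le> 0"
      using c(2)[OF dom_diff[OF uv(1,2)], of z] by simp
    then show "u = v" using m by (simp add: mult_le_0_iff)
  qed
  moreover have "(\<lambda>u. airy_dirac m u - z *\<^sub>C u) ` airy_dirac_dom = UNIV"
    using airy_surj[OF m, of z] by (auto simp: airy_1 image_iff) metis
  ultimately show ?thesis by (simp add: bij_betw_def)
qed

lemma resolvent_dom: "Rsv z y \<in> airy_dirac_dom"
  and airy_dirac_resolvent: "airy_dirac m (Rsv z y) - z *\<^sub>C Rsv z y = y"
  and resolvent_airy_dirac: "u \<in> airy_dirac_dom \<Longrightarrow> Rsv z (airy_dirac m u - z *\<^sub>C u) = u"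
proof -
  note b = airy_dirac_bij[of z]
  show "Rsv z y \<in> airy_dirac_dom"
    using b inv_into_into[of y "\<lambda>u. airy_dirac m u - z *\<^sub>C u" airy_dirac_dom] by (simp add: resolvent_def bij_betw_def)
  show "airy_dirac m (Rsv z y) - z *\<^sub>C Rsv z y = y"
    using bij_betw_inv_into_right[OF b, of y] by (simp add: resolvent_def)
  show "u \<in> airy_dirac_dom \<Longrightarrow> Rsv z (airy_dirac m u - z *\<^sub>C u) = u"
    using bij_betw_inv_into_left[OF b, of u] by (simp add: resolvent_def)
qed

lemma resolvent_bound: "\<exists>c>0. \<forall>z y. norm (Rsv z y) \<le> (exp (c * (Re z)\<^sup>2) / m) * norm y"
proof -
  obtain c where c: "c > 0"
    "\<And>z u. u \<in> airy_dirac_dom \<Longrightarrow> m * exp (- c * (Re z)\<^sup>2) * norm u \<le> norm (airy 1 m u - z *\<^sub>C u)"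
    using resolvent_estimate[OF m] by blast
  have "norm (Rsv z y) \<le> (exp (c * (Re z)\<^sup>2) / m) * norm y" for z y
  proof -
    have "m * exp (- c * (Re z)\<^sup>2) * norm (Rsv z y) \<le> norm y"
      using c(2)[OF resolvent_dom, of z z y] by (simp add: airy_1 airy_dirac_resolvent)
    then have "(exp (c * (Re z)\<^sup>2) / m) * (m * exp (- c * (Re z)\<^sup>2) * norm (Rsv z y)) \<le>
        (exp (c * (Re z)\<^sup>2) / m) * norm y"
      using m by (intro mult_left_mono) auto
    also have "(exp (c * (Re z)\<^sup>2) / m) * (m * exp (- c * (Re z)\<^sup>2) * norm (Rsv z y)) =
        (exp (c * (Re z)\<^sup>2) * exp (- c * (Re z)\<^sup>2)) * norm (Rsv z y)"
      using m by simp
    also have "exp (c * (Re z)\<^sup>2) * exp (- c * (Re z)\<^sup>2) = 1"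
      by (simp flip: exp_add)
    finally show ?thesis by simp
  qed
  with c(1) show ?thesis by blast
qed

lemma resolvent_bounded_clinear: "bounded_clinear (Rsv z)"
proof -
  obtain c where "c > 0" and c: "\<And>z y. norm (Rsv z y) \<le> (exp (c * (Re z)\<^sup>2) / m) * norm y"
    using resolvent_bound by blast
  show ?thesis
  proof (rule bounded_clinearI)
    show "norm (Rsv z y) \<le> (exp (c * (Re z)\<^sup>2) / m) * norm y" for y by (rule c)
    show "Rsv z (x + y) = Rsv z x + Rsv z y" for x y
    proof -
      have "airy_dirac m (Rsv z x + Rsv z y) - z *\<^sub>C (Rsv z x + Rsv z y) = x + y"
        using airy_dirac_resolvent[of z x] airy_dirac_resolvent[of z y]
          airy_add[OF resolvent_dom resolvent_dom, of 1 m z x z y]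
        by (simp add: airy_1 scaleC_add_right algebra_simps)
      then show ?thesis
        using resolvent_airy_dirac[OF dom_add(1)[OF resolvent_dom resolvent_dom], of z z x z y] by simp
    qed
    show "Rsv z (a *\<^sub>C x) = a *\<^sub>C Rsv z x" for a x
    proof -
      have "airy_dirac m (a *\<^sub>C Rsv z x) - z *\<^sub>C a *\<^sub>C Rsv z x = a *\<^sub>C (airy_dirac m (Rsv z x) - z *\<^sub>C Rsv z x)"
        using airy_scaleC[OF resolvent_dom, of 1 m a z x]
        by (simp add: airy_1 scaleC_diff_right mult.commute)
      then show ?thesis
        using resolvent_airy_dirac[OF dom_scaleC(1)[OF resolvent_dom], of z a z x]
        by (simp add: airy_dirac_resolvent)
    qed
  qed
qed

lemma resolvent_set_airy_dirac: "resolvent_set airy_dirac_dom (airy_dirac m) = UNIV"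
  using airy_dirac_bij resolvent_bounded_clinear by (simp add: resolvent_set_def)

definition "airy_dirac_inverse = diag_op (\<lambda>j. complex_of_real (1 / mu m j)) basis_e (basis_f m)"

lemma inv_into_airy_dirac: "inv_into airy_dirac_dom (airy_dirac m) = airy_dirac_inverse"
proof
  fix y
  note dg = diagonalised_airy[OF m]
  have inj: "inj_on (airy_dirac m) airy_dirac_dom" using airy_dirac_bij[of 0] by (simp add: bij_betw_def)
  have "airy_dirac m (airy_dirac_inverse y) = y" "airy_dirac_inverse y \<in> airy_dirac_dom"
    using airy_K[OF dg, of y] K_dom[OF dg, of y] by (simp_all add: airy_1 airy_dirac_inverse_def)
  then show "inv_into airy_dirac_dom (airy_dirac m) y = airy_dirac_inverse y" using inv_into_f_f[OF inj, of "airy_dirac_inverse y"] by simp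
qed

lemma inverse_mu_LIMSEQ: "(\<lambda>j. 1 / mu m j) \<longlonglongrightarrow> 0"
proof (rule tendsto_sandwich[OF always_eventually eventually_sequentiallyI tendsto_const])
  show "\<forall>j. 0 \<le> 1 / mu m j" using mu_pos[OF m] by (auto intro: less_imp_le)
  show "1 / mu m j \<le> 1 / sqrt (real j)" if "j \<ge> 1" for j
  proof -
    have "j \<le> 2 * ((j + 1) div 2)" by presburger
    then have "real j \<le> 2 * real ((j + 1) div 2)" by linarith
    then have "real j \<le> m\<^sup>2 + 2 * real ((j + 1) div 2)" by (simp add: add_increasing)
    then show ?thesis
      using that unfolding mu_def by (intro divide_left_mono mult_pos_pos) (auto simp: add_pos_nonneg m)
  qed
  show "(\<lambda>j. 1 / sqrt (real j)) \<longlonglongrightarrow> 0"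
    by (intro tendsto_divide_0[OF tendsto_const] filterlim_at_top_imp_at_infinity
        filterlim_compose[OF sqrt_at_top filterlim_real_sequentially])
qed

lemma inverse_mu_decseq: "decseq (\<lambda>j. 1 / mu m j)"
  unfolding decseq_def
proof (intro allI impI)
  fix i j :: nat assume "i \<le> j"
  then have "(i + 1) div 2 \<le> (j + 1) div 2" by (intro div_le_mono) simp
  then have "mu m i \<le> mu m j" by (simp add: mu_def)
  then show "1 / mu m j \<le> 1 / mu m i" using mu_pos[OF m] by (intro divide_left_mono) (auto intro: mult_pos_pos)
qed

lemma singular_values_airy_dirac_inverse: "singular_values airy_dirac_inverse (\<lambda>j. 1 / mu m j)"
  unfolding airy_dirac_inverse_def
  by (rule diag_op_singular_values[OF onb_basis_e onb_basis_f[OF m] inverse_mu_LIMSEQ inverse_mu_decseq])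

lemma onorm_airy_dirac_inverse: "onorm airy_dirac_inverse = 1 / m"
proof -
  have "cmod (complex_of_real (1 / mu m j)) \<le> cmod (complex_of_real (1 / mu m 0))" for j
    using decseqD[OF inverse_mu_decseq, of 0 j] mu_pos[OF m]
    unfolding norm_of_real by (simp add: abs_of_pos)
  from diag_op_onorm[OF onb_basis_e onb_basis_f[OF m], of "\<lambda>j. complex_of_real (1 / mu m j)", OF this]
  show ?thesis using m unfolding airy_dirac_inverse_def norm_of_real by (simp add: mu_def)
qed

text \<open>The resolvent equation w = A^(-1) (y + z w) places the image of the unit ball inside a
  multiple of its image under the compact inverse; \<open>r\<close> bounds the norm of y + z
  w.\<close>

lemma resolvent_compact: "compact_op (Rsv z)"
proof -
  obtain c where "c > 0" and c: "\<And>z y. norm (Rsv z y) \<le> (exp (c * (Re z)\<^sup>2) / m) * norm y"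
    using resolvent_bound by blast
  define r where "r = 1 + cmod z * (exp (c * (Re z)\<^sup>2) / m)"
  have r: "r > 0" using m by (simp add: r_def add_pos_nonneg)
  have K: "compact_op airy_dirac_inverse" using singular_values_airy_dirac_inverse by (simp add: singular_values_def)
  let ?C = "(\<lambda>v. r *\<^sub>R v) ` closure (airy_dirac_inverse ` cball 0 1)"
  have C: "compact ?C"
    using K by (intro compact_continuous_image continuous_intros) (simp add: compact_op_def)
  have "Rsv z ` cball 0 1 \<subseteq> ?C"
  proof
    fix w assume "w \<in> Rsv z ` cball 0 1"
    then obtain y where y: "norm y \<le> 1" "w = Rsv z y" by auto
    define v where "v = y + z *\<^sub>C w"
    have "airy_dirac m w = v" using airy_dirac_resolvent[of z y] by (simp add: v_def y(2) algebra_simps)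
    then have w: "w = airy_dirac_inverse v"
      using K_airy[OF diagonalised_airy[OF m] resolvent_dom, of z y]
      by (simp add: airy_1 airy_dirac_inverse_def y(2))
    have "norm v \<le> norm y + cmod z * norm w"
      using norm_triangle_ineq[of y "z *\<^sub>C w"] by (simp add: v_def norm_scaleC)
    also have "\<dots> \<le> 1 + cmod z * ((exp (c * (Re z)\<^sup>2) / m) * 1)"
    proof (intro add_mono mult_left_mono y(1))
      have "norm w \<le> (exp (c * (Re z)\<^sup>2) / m) * norm y" unfolding y(2) by (rule c)
      also have "\<dots> \<le> (exp (c * (Re z)\<^sup>2) / m) * 1" using y(1) m by (intro mult_left_mono) auto
      finally show "norm w \<le> (exp (c * (Re z)\<^sup>2) / m) * 1" .
    qed simp
    finally have "norm ((1 / r) *\<^sub>R v) \<le> 1" using r by (simp add: r_def)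
    moreover have "w = r *\<^sub>R airy_dirac_inverse ((1 / r) *\<^sub>R v)"
    proof -
      have "linear airy_dirac_inverse" using K by (simp add: compact_op_def bounded_clinear_def bounded_linear.linear)
      then show ?thesis using r by (simp add: w linear_scale)
    qed
    ultimately show "w \<in> ?C"
      using closure_subset[of "airy_dirac_inverse ` cball 0 1"]
      by (intro image_eqI[of _ _ "airy_dirac_inverse ((1 / r) *\<^sub>R v)"]) auto
  qed
  then have "closure (Rsv z ` cball 0 1) \<subseteq> ?C"
    using C compact_imp_closed closure_minimal by blast
  then have "compact (closure (Rsv z ` cball 0 1))"
    using compact_Int_closed[OF C closed_closure] by (metis inf.absorb2)
  then show ?thesis using resolvent_bounded_clinear by (simp add: compact_op_def)
qed

text \<open>Translation by \<open>Im z\<close> conjugates the two resolvents; as a surjective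
  isometry it merely reindexes the quotients whose supremum is \<open>onorm\<close>.\<close>

lemma onorm_resolvent_Re: "onorm (Rsv z) = onorm (Rsv (complex_of_real (Re z)))"
proof -
  let ?\<zeta> = "complex_of_real (Re z)" and ?\<tau> = "translate (Im z)"
  have eq: "Rsv z (?\<tau> y) = ?\<tau> (Rsv ?\<zeta> y)" for y
  proof -
    let ?u = "Rsv ?\<zeta> y"
    have "airy_dirac m (?\<tau> ?u) - z *\<^sub>C ?\<tau> ?u = ?\<tau> y"
      using airy_translate_shift[OF resolvent_dom, of m z ?\<zeta> y]
      by (simp add: airy_1 airy_dirac_resolvent)
    then show ?thesis
      using resolvent_airy_dirac[OF airy_translate(1)[OF resolvent_dom], of z "Im z" ?\<zeta> y] by simp
  qed
  have surj: "range ?\<tau> = UNIV"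
    unfolding surj_def by (metis translate_translate)
  have "range (\<lambda>x. norm (Rsv z x) / norm x) = (\<lambda>x. norm (Rsv z x) / norm x) ` range ?\<tau>"
    unfolding surj ..
  also have "\<dots> = range (\<lambda>y. norm (Rsv ?\<zeta> y) / norm y)"
    unfolding image_image eq norm_translate ..
  finally show ?thesis unfolding onorm_def by simp
qed

lemma ln_onorm_resolvent:
  obtains c where "c > 0" "\<And>z. ln (onorm (Rsv z)) \<le> c * (Re z)\<^sup>2 + max 0 (ln (1 / m))"
proof -
  obtain c where c: "c > 0" "\<And>z y. norm (Rsv z y) \<le> (exp (c * (Re z)\<^sup>2) / m) * norm y"
    using resolvent_bound by blast
  have "ln (onorm (Rsv z)) \<le> c * (Re z)\<^sup>2 + max 0 (ln (1 / m))" for z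
  proof -
    have le: "onorm (Rsv z) \<le> exp (c * (Re z)\<^sup>2) / m"
      using m by (intro onorm_bound c) auto
    have "0 \<le> onorm (Rsv z)"
      using resolvent_bounded_clinear by (intro onorm_pos_le) (simp add: bounded_clinear_def)
    \<comment> \<open>In the degenerate case the convention \<open>ln 0 = 0\<close> applies, and the
      right-hand side is non-negative thanks to \<open>max\<close>.\<close>
    then consider "onorm (Rsv z) = 0" | "onorm (Rsv z) > 0" by linarith
    then show ?thesis
    proof cases
      case 1
      then show ?thesis using c(1) by (simp add: add_nonneg_nonneg)
    next
      case 2
      then have "ln (onorm (Rsv z)) \<le> ln (exp (c * (Re z)\<^sup>2) / m)"
        using le m by (simp add: ln_le_cancel_iff)
      also have "\<dots> = c * (Re z)\<^sup>2 + ln (1 / m)" using m by (simp add: ln_div)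
      finally show ?thesis by simp
    qed
  qed
  with c(1) show ?thesis using that by blast
qed

end

theorem proposition2p3:
  fixes m :: real
  assumes "m > 0"
  shows
    "adjoint_domain airy_dirac_dom (airy_dirac m) = airy_dirac_dom \<and>
     (\<forall>u\<in>airy_dirac_dom.
        (norm (airy_dirac m u))\<^sup>2 + (norm u)\<^sup>2
          \<ge> (norm (deriv_L2 u))\<^sup>2 + (norm (mult_x u))\<^sup>2 + m\<^sup>2 * (norm u)\<^sup>2 \<and>
        (norm (adjoint_op airy_dirac_dom (airy_dirac m) u))\<^sup>2 + (norm u)\<^sup>2
          \<ge> (norm (deriv_L2 u))\<^sup>2 + (norm (mult_x u))\<^sup>2 + m\<^sup>2 * (norm u)\<^sup>2) \<and>
     (\<forall>z\<in>resolvent_set airy_dirac_dom (airy_dirac m).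
        compact_op (resolvent airy_dirac_dom (airy_dirac m) z)) \<and>
     spectrum airy_dirac_dom (airy_dirac m) = {} \<and>
     (\<forall>z. onorm (resolvent airy_dirac_dom (airy_dirac m) z) =
           onorm (resolvent airy_dirac_dom (airy_dirac m) (complex_of_real (Re z)))) \<and>
     (\<exists>s. singular_values (inv_into airy_dirac_dom (airy_dirac m)) s \<and>
        (\<forall>k. s (2 * k) = 1 / sqrt (m\<^sup>2 + 2 * real k) \<and>
             s (2 * k + 1) = 1 / sqrt (m\<^sup>2 + 2 * real k + 2))) \<and>
     onorm (inv_into airy_dirac_dom (airy_dirac m)) = 1 / m \<and>
     (\<exists>c>0. \<forall>z. ln (onorm (resolvent airy_dirac_dom (airy_dirac m) z))
        \<le> c * (Re z)\<^sup>2 + max 0 (ln (1 / m)))"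
proof (intro conjI ballI allI)
  note dg = diagonalised_airy[OF assms]
  show "adjoint_domain airy_dirac_dom (airy_dirac m) = airy_dirac_dom"
    using adjoint_domain_airy[OF dg] by (simp add: airy_1)
  show "(norm (airy_dirac m u))\<^sup>2 + (norm u)\<^sup>2
      \<ge> (norm (deriv_L2 u))\<^sup>2 + (norm (mult_x u))\<^sup>2 + m\<^sup>2 * (norm u)\<^sup>2" if "u \<in> airy_dirac_dom" for u
    using norm_airy_ge[OF dg that] by (simp add: airy_1)
  show "(norm (adjoint_op airy_dirac_dom (airy_dirac m) u))\<^sup>2 + (norm u)\<^sup>2
      \<ge> (norm (deriv_L2 u))\<^sup>2 + (norm (mult_x u))\<^sup>2 + m\<^sup>2 * (norm u)\<^sup>2" if "u \<in> airy_dirac_dom" for u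
    using norm_airy_ge[OF diagonalised_sym[OF dg] that] adjoint_op_airy[OF dg that] by (simp add: airy_1)
  show "compact_op (resolvent airy_dirac_dom (airy_dirac m) z)" for z
    by (rule resolvent_compact[OF assms])
  show "spectrum airy_dirac_dom (airy_dirac m) = {}"
    by (simp add: spectrum_def resolvent_set_airy_dirac[OF assms])
  show "onorm (resolvent airy_dirac_dom (airy_dirac m) z) =
      onorm (resolvent airy_dirac_dom (airy_dirac m) (complex_of_real (Re z)))" for z
    by (rule onorm_resolvent_Re[OF assms])
  show "\<exists>s. singular_values (inv_into airy_dirac_dom (airy_dirac m)) s \<and>
      (\<forall>k. s (2 * k) = 1 / sqrt (m\<^sup>2 + 2 * real k) \<and>
           s (2 * k + 1) = 1 / sqrt (m\<^sup>2 + 2 * real k + 2))"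
    \<comment> \<open>Integer division gives \<open>(2 * k + 1) div 2 = k\<close> and
      \<open>(2 * k + 2) div 2 = k + 1\<close>, the two stated families.\<close>
    using singular_values_airy_dirac_inverse[OF assms]
    by (intro exI[of _ "\<lambda>j. 1 / mu m j"])
      (simp add: inv_into_airy_dirac[OF assms] mu_def add.assoc)
  show "onorm (inv_into airy_dirac_dom (airy_dirac m)) = 1 / m"
    unfolding inv_into_airy_dirac[OF assms] by (rule onorm_airy_dirac_inverse[OF assms])
  show "\<exists>c>0. \<forall>z. ln (onorm (resolvent airy_dirac_dom (airy_dirac m) z))
      \<le> c * (Re z)\<^sup>2 + max 0 (ln (1 / m))"
    using ln_onorm_resolvent[OF assms] by metis
qed

end
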